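(* Let $\Omega$ be a subshift of finite type with left shift $T$, and let $\mu$ be a $T$-ergodic Borel probability measure on $\Omega$, with $\operatorname{supp}\mu=\Omega$, that satisfies the bounded distortion property. Let $0<\alpha\le1$ and let $f:\Omega\to\mathbb R$ be $\alpha$-Hölder continuous. Let $I\subset\mathbb R$ be a Borel set on which both of the following hold: (PLE) $\inf_{E\in I}L(E)>0$; (ULD) for every $\varepsilon>0$ there are constants $C,c>0$, depending only on $\varepsilon$ and $f$, such that for all $E\in I$ and all $n\ge1$, $\ \mu\{\omega\in\Omega:|\frac1n\log\|A^E_n(\omega)\|-L(E)|>\varepsilon\}<Ce^{-cn}$. Then, for $\mu$-almost every $\omega\in\Omega$, the operator $H_\omega$ with potential $V_\omega(n)=f(T^n\omega)$ has spectral localization on $I$.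
   Context: Base dynamics. $\mathcal A=\{1,\dots,\ell\}$, $\ell\ge2$; $\mathcal A^{\mathbb Z}$ carries the metric $d(\omega,\tilde\omega)=e^{-N(\omega,\tilde\omega)}$, where $N(\omega,\tilde\omega)=\max\{N\ge0:\omega_n=\tilde\omega_n\ \forall |n|<N\}$ (and $d=0$ if the points coincide). $T$ is the left shift $(T\omega)_n=\omega_{n+1}$. A subshift of finite type $\Omega\subset\mathcal A^{\mathbb Z}$ is the set of all two-sided sequences whose consecutive letter pairs are all allowed by a fixed $0$-$1$ matrix. Cylinders are $[n;j_0,\dots,j_k]=\{\omega\in\Omega:\omega_{n+i}=j_i,\ 0\le i\le k\}$. Bounded distortion. $\mu$ has the bounded distortion property if there is $C\ge1$ such that for all cylinders $[n;j_0,\dots,j_k]$ and $[l;i_0,\dots,i_s]$ in $\Omega$ with $l>n+k$ and nonempty intersection, $$C^{-1}\le\frac{\mu([n;j_0,\dots,j_k]\cap[l;i_0,\dots,i_s])}{\mu([n;j_0,\dots,j_k])\,\mu([l;i_0,\dots,i_s])}\le C.$$ Operators and cocycles. $[H_\omega u](n)=u(n+1)+u(n-1)+V_\omega(n)u(n)$ on $\ell^2(\mathbb Z)$. $A^E(\omega)=\begin{pmatrix}E-f(\omega)&-1\\1&0\end{pmatrix}$, $A^E_n(\omega)=A^E(T^{n-1}\omega)\cdots A^E(\omega)$ for $n\ge1$, and $L(E)=\lim_{n\to\infty}\frac1n\int\log\|A^E_n\|\,d\mu$. Spectral localization of $H_\omega$ on $I$ means: $H_\omega$ has pure point spectrum on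 $I$ (all spectral measures of $H_\omega$ restricted to $I$ are pure point) and every eigenfunction in $\ell^2(\mathbb Z)$ corresponding to an eigenvalue in $I$ decays exponentially. *)

theory Defs
  imports "HOL-Analysis.Analysis" "HOL-Probability.Probability"
begin

section \<open>Subshifts of finite type\<close>

text \<open>
  Points of the full shift are functions \<open>int \<Rightarrow> nat\<close> with values in \<open>{1..l}\<close>. The type
  \<open>int \<Rightarrow> nat\<close> carries the product topology of the discrete topologies; by
  \<open>open_iff_sft_dist\<close> below this is the topology of the metric \<open>sft_dist\<close>, so that
  \<open>borel\<close> is the Borel sigma-algebra of that metric.
\<close>

definition agree_lengths :: "(int \<Rightarrow> nat) \<Rightarrow> (int \<Rightarrow> nat) \<Rightarrow> nat set" where
  "agree_lengths \<omega> \<omega>' = {N. \<forall>n. \<bar>n\<bar> < int N \<longrightarrow> \<omega> n = \<omega>' n}"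

definition sft_dist :: "(int \<Rightarrow> nat) \<Rightarrow> (int \<Rightarrow> nat) \<Rightarrow> real" where
  "sft_dist \<omega> \<omega>' = (if \<omega> = \<omega>' then 0 else exp (- real (Max (agree_lengths \<omega> \<omega>'))))"

text \<open>\<open>seq_shift k\<close> is the \<open>k\<close>-th iterate of the left shift \<open>T = seq_shift 1\<close>, for every integer \<open>k\<close>.\<close>

definition seq_shift :: "int \<Rightarrow> (int \<Rightarrow> nat) \<Rightarrow> int \<Rightarrow> nat" where
  "seq_shift k \<omega> = (\<lambda>n. \<omega> (n + k))"

definition subshift_of_finite_type :: "nat \<Rightarrow> (int \<Rightarrow> nat) set \<Rightarrow> bool" where
  "subshift_of_finite_type l \<Omega> \<longleftrightarrow>
     (\<exists>A :: nat \<Rightarrow> nat \<Rightarrow> nat.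
        (\<forall>i\<in>{1..l}. \<forall>j\<in>{1..l}. A i j \<in> {0, 1}) \<and>
        \<Omega> = {\<omega>. \<forall>n. \<omega> n \<in> {1..l} \<and> A (\<omega> n) (\<omega> (n + 1)) = 1})"

text \<open>\<open>cylinder \<Omega> n [j\<^sub>0, \<dots>, j\<^sub>k]\<close> is \<open>[n; j\<^sub>0, \<dots>, j\<^sub>k]\<close>; the list has length \<open>k + 1\<close>.\<close>

definition cylinder :: "(int \<Rightarrow> nat) set \<Rightarrow> int \<Rightarrow> nat list \<Rightarrow> (int \<Rightarrow> nat) set" where
  "cylinder \<Omega> n js = {\<omega>\<in>\<Omega>. \<forall>i<length js. \<omega> (n + int i) = js ! i}"

definition hoelder_on :: "real \<Rightarrow> (int \<Rightarrow> nat) set \<Rightarrow> ((int \<Rightarrow> nat) \<Rightarrow> real) \<Rightarrow> bool" where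
  "hoelder_on \<alpha> \<Omega> f \<longleftrightarrow>
     (\<exists>K. \<forall>\<omega>\<in>\<Omega>. \<forall>\<omega>'\<in>\<Omega>. \<bar>f \<omega> - f \<omega>'\<bar> \<le> K * sft_dist \<omega> \<omega>' powr \<alpha>)"

lemma sft_dist_le_iff: "sft_dist \<omega> \<omega>' \<le> exp (- real N) \<longleftrightarrow> (\<forall>n. \<bar>n\<bar> < int N \<longrightarrow> \<omega> n = \<omega>' n)"
proof (cases "\<omega> = \<omega>'")
  case False
  then obtain m where m: "\<omega> m \<noteq> \<omega>' m" by auto
  let ?S = "agree_lengths \<omega> \<omega>'"
  have "?S \<subseteq> {..nat \<bar>m\<bar>}"
  proof
    fix k assume "k \<in> ?S"
    with m have "\<not> \<bar>m\<bar> < int k" by (auto simp: agree_lengths_def)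
    then show "k \<in> {..nat \<bar>m\<bar>}" by simp
  qed
  then have fin: "finite ?S" by (rule finite_subset) simp
  have "0 \<in> ?S" by (simp add: agree_lengths_def)
  then have max: "Max ?S \<in> ?S" using fin Max_in by blast
  have "N \<le> Max ?S \<longleftrightarrow> N \<in> ?S"
  proof
    assume "N \<le> Max ?S"
    then show "N \<in> ?S" using max by (force simp: agree_lengths_def)
  qed (simp add: fin)
  then show ?thesis using False by (simp add: sft_dist_def agree_lengths_def)
qed (simp add: sft_dist_def)

lemma open_iff_sft_dist:
  "open U \<longleftrightarrow> (\<forall>\<omega>\<in>U. \<exists>r>0. \<forall>\<omega>'. sft_dist \<omega> \<omega>' < r \<longrightarrow> \<omega>' \<in> U)"
proof (intro iffI ballI)
  fix \<omega> assume "open U" "\<omega> \<in> U"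
  then have "openin (product_topology (\<lambda>i::int. euclidean :: nat topology) UNIV) U"
    by (simp add: open_fun_def)
  from product_topology_open_contains_basis[OF this \<open>\<omega> \<in> U\<close>]
  obtain X where X: "\<omega> \<in> (\<Pi>\<^sub>E i\<in>UNIV. X i)" "finite {i. X i \<noteq> UNIV}" "(\<Pi>\<^sub>E i\<in>UNIV. X i) \<subseteq> U"
    by auto
  obtain N where N: "\<And>i. X i \<noteq> UNIV \<Longrightarrow> \<bar>i\<bar> < int N"
  proof -
    have "finite ((\<lambda>i. nat \<bar>i\<bar>) ` {i. X i \<noteq> UNIV})" using X(2) by simp
    then obtain N where "\<forall>k\<in>(\<lambda>i. nat \<bar>i\<bar>) ` {i. X i \<noteq> UNIV}. k < N"
      using finite_nat_set_iff_bounded by blast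
    then show ?thesis by (intro that[of N]) force
  qed
  show "\<exists>r>0. \<forall>\<omega>'. sft_dist \<omega> \<omega>' < r \<longrightarrow> \<omega>' \<in> U"
  proof (intro exI[of _ "exp (- real N)"] conjI allI impI)
    fix \<omega>' assume "sft_dist \<omega> \<omega>' < exp (- real N)"
    then have "\<forall>n. \<bar>n\<bar> < int N \<longrightarrow> \<omega> n = \<omega>' n" by (simp flip: sft_dist_le_iff)
    then have "\<omega>' i \<in> X i" for i
      using N[of i] X(1) by (metis PiE_mem UNIV_I)
    then show "\<omega>' \<in> U" using X(3) by (auto simp: PiE_iff)
  qed simp
next
  assume *: "\<forall>\<omega>\<in>U. \<exists>r>0. \<forall>\<omega>'. sft_dist \<omega> \<omega>' < r \<longrightarrow> \<omega>' \<in> U"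
  show "open U"
  proof (subst open_subopen, rule ballI)
    fix \<omega> assume "\<omega> \<in> U"
    with * obtain r where r: "r > 0" "\<And>\<omega>'. sft_dist \<omega> \<omega>' < r \<Longrightarrow> \<omega>' \<in> U" by blast
    obtain N where N: "exp (- real N) < r"
    proof -
      obtain N where "real N > - ln r" using reals_Archimedean2 by blast
      then have "exp (- real N) < exp (ln r)" by (subst exp_less_cancel_iff) linarith
      then show ?thesis using r(1) that by simp
    qed
    let ?X = "\<lambda>i. if \<bar>i\<bar> < int N then {\<omega> i} else UNIV"
    have "{i. ?X i \<noteq> UNIV} \<subseteq> {- int N..int N}" by auto
    then have "finite {i. ?X i \<noteq> UNIV}" by (rule finite_subset) simp
    then have "open (\<Pi>\<^sub>E i\<in>UNIV. ?X i)"
      by (intro open_PiE) (auto intro: Topological_Spaces.open_discrete)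
    moreover have "(\<Pi>\<^sub>E i\<in>UNIV. ?X i) \<subseteq> U"
    proof
      fix \<omega>' assume mem: "\<omega>' \<in> (\<Pi>\<^sub>E i\<in>UNIV. ?X i)"
      have "\<omega> n = \<omega>' n" if "\<bar>n\<bar> < int N" for n
      proof -
        have "\<omega>' n \<in> ?X n" using mem by (simp add: PiE_iff)
        then show ?thesis using that by simp
      qed
      then show "\<omega>' \<in> U" using r(2) N sft_dist_le_iff[of \<omega> \<omega>' N] by fastforce
    qed
    ultimately show "\<exists>W. open W \<and> \<omega> \<in> W \<and> W \<subseteq> U"
      by (intro exI[of _ "\<Pi>\<^sub>E i\<in>UNIV. ?X i"]) (auto simp: PiE_iff)
  qed
qed


section \<open>Measures on the subshift\<close>

definition ergodic_wrt :: "'a measure \<Rightarrow> ('a \<Rightarrow> 'a) \<Rightarrow> bool" where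
  "ergodic_wrt M T \<longleftrightarrow>
     T \<in> M \<rightarrow>\<^sub>M M \<and> distr M M T = M \<and>
     (\<forall>A\<in>sets M. T -` A \<inter> space M = A \<longrightarrow> measure M A = 0 \<or> measure M A = 1)"

definition measure_support :: "'a::topological_space measure \<Rightarrow> 'a set" where
  "measure_support M = {x\<in>space M. \<forall>U. open U \<and> x \<in> U \<longrightarrow> emeasure M (U \<inter> space M) > 0}"

definition bounded_distortion :: "(int \<Rightarrow> nat) set \<Rightarrow> (int \<Rightarrow> nat) measure \<Rightarrow> bool" where
  "bounded_distortion \<Omega> M \<longleftrightarrow>
     (\<exists>C\<ge>1. \<forall>n l js is.
        js \<noteq> [] \<and> is \<noteq> [] \<and> l \<ge> n + int (length js) \<and>
        cylinder \<Omega> n js \<inter> cylinder \<Omega> l is \<noteq> {} \<longrightarrow>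
        (let q = measure M (cylinder \<Omega> n js \<inter> cylinder \<Omega> l is) /
                 (measure M (cylinder \<Omega> n js) * measure M (cylinder \<Omega> l is))
         in 1 / C \<le> q \<and> q \<le> C))"


section \<open>Cocycles and the Lyapunov exponent\<close>

definition schroedinger_matrix :: "((int \<Rightarrow> nat) \<Rightarrow> real) \<Rightarrow> real \<Rightarrow> (int \<Rightarrow> nat) \<Rightarrow> real^2^2" where
  "schroedinger_matrix f E \<omega> = vector [vector [E - f \<omega>, -1], vector [1, 0]]"

primrec cocycle :: "((int \<Rightarrow> nat) \<Rightarrow> real) \<Rightarrow> real \<Rightarrow> nat \<Rightarrow> (int \<Rightarrow> nat) \<Rightarrow> real^2^2" where
  "cocycle f E 0 \<omega> = mat 1"
| "cocycle f E (Suc n) \<omega> = schroedinger_matrix f E (seq_shift (int n) \<omega>) ** cocycle f E n \<omega>"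

text \<open>The operator norm is used; \<open>norm\<close> on \<open>real^2^2\<close> would be the Frobenius norm.\<close>

definition log_norm_avg :: "((int \<Rightarrow> nat) \<Rightarrow> real) \<Rightarrow> real \<Rightarrow> nat \<Rightarrow> (int \<Rightarrow> nat) \<Rightarrow> real" where
  "log_norm_avg f E n \<omega> = 1 / real n * ln (onorm (\<lambda>v. cocycle f E n \<omega> *v v))"

definition lyapunov_exponent ::
  "(int \<Rightarrow> nat) measure \<Rightarrow> ((int \<Rightarrow> nat) \<Rightarrow> real) \<Rightarrow> real \<Rightarrow> real" where
  "lyapunov_exponent M f E =
     lim (\<lambda>n. 1 / real n * (\<integral>\<omega>. ln (onorm (\<lambda>v. cocycle f E n \<omega> *v v)) \<partial>M))"

text \<open>The infimum is taken in the extended reals, so that \<open>PLE\<close> holds for \<open>I = {}\<close>.\<close>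

definition PLE :: "(int \<Rightarrow> nat) measure \<Rightarrow> ((int \<Rightarrow> nat) \<Rightarrow> real) \<Rightarrow> real set \<Rightarrow> bool" where
  "PLE M f I \<longleftrightarrow> (INF E\<in>I. ereal (lyapunov_exponent M f E)) > 0"

definition ULD :: "(int \<Rightarrow> nat) measure \<Rightarrow> ((int \<Rightarrow> nat) \<Rightarrow> real) \<Rightarrow> real set \<Rightarrow> bool" where
  "ULD M f I \<longleftrightarrow>
     (\<forall>\<epsilon>>0. \<exists>C>0. \<exists>c>0. \<forall>E\<in>I. \<forall>n\<ge>1.
        measure M {\<omega>\<in>space M. \<bar>log_norm_avg f E n \<omega> - lyapunov_exponent M f E\<bar> > \<epsilon>}
          < C * exp (- c * real n))"


section \<open>Spectral localization on the Hilbert space of square-summable sequences\<close>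

definition l2 :: "(int \<Rightarrow> complex) set" where
  "l2 = {u. (\<lambda>n. (cmod (u n))\<^sup>2) summable_on UNIV}"

definition l2_inner :: "(int \<Rightarrow> complex) \<Rightarrow> (int \<Rightarrow> complex) \<Rightarrow> complex" where
  "l2_inner u v = (\<Sum>\<^sub>\<infinity>n. cnj (u n) * v n)"

type_synonym seq_operator = "(int \<Rightarrow> complex) \<Rightarrow> int \<Rightarrow> complex"

definition schroedinger_operator :: "(int \<Rightarrow> real) \<Rightarrow> seq_operator" where
  "schroedinger_operator V u = (\<lambda>n. u (n + 1) + u (n - 1) + complex_of_real (V n) * u n)"

definition orthogonal_projection :: "seq_operator \<Rightarrow> bool" where
  "orthogonal_projection P \<longleftrightarrow>
     (\<forall>u\<in>l2. P u \<in> l2) \<and>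
     (\<forall>u\<in>l2. \<forall>v\<in>l2. \<forall>a b. P (\<lambda>n. a * u n + b * v n) = (\<lambda>n. a * P u n + b * P v n)) \<and>
     (\<forall>u\<in>l2. P (P u) = P u) \<and>
     (\<forall>u\<in>l2. \<forall>v\<in>l2. l2_inner (P u) v = l2_inner u (P v))"

text \<open>
  Countable additivity is required in the weak sense; \<open>P {} = 0\<close> follows from it.
\<close>

definition projection_valued_measure :: "(real set \<Rightarrow> seq_operator) \<Rightarrow> bool" where
  "projection_valued_measure P \<longleftrightarrow>
     (\<forall>B\<in>sets borel. orthogonal_projection (P B)) \<and>
     (\<forall>u\<in>l2. P UNIV u = u) \<and>
     (\<forall>A\<in>sets borel. \<forall>B\<in>sets borel. \<forall>u\<in>l2. P (A \<inter> B) u = P A (P B u)) \<and>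
     (\<forall>B :: nat \<Rightarrow> real set. range B \<subseteq> sets borel \<and> disjoint_family B \<longrightarrow>
        (\<forall>u\<in>l2. \<forall>v\<in>l2.
          (\<lambda>i. l2_inner u (P (B i) v)) sums l2_inner u (P (\<Union>i. B i) v)))"

text \<open>The measure \<open>B \<mapsto> \<langle>u, P B u\<rangle>\<close>; the values are real and nonnegative.\<close>

definition spectral_measure :: "(real set \<Rightarrow> seq_operator) \<Rightarrow> (int \<Rightarrow> complex) \<Rightarrow> real measure" where
  "spectral_measure P u = measure_of UNIV (sets borel) (\<lambda>B. ennreal (Re (l2_inner u (P B u))))"

text \<open>
  The spectral resolution \<open>H = \<integral> x dP(x)\<close> of a bounded self-adjoint operator \<open>H\<close>. By the
  spectral theorem there is exactly one such \<open>P\<close>, up to its values outside \<open>l2\<close> and on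
  sets that are not Borel. It suffices to state the identity for the quadratic forms, by polarization.
\<close>

definition spectral_resolution :: "seq_operator \<Rightarrow> (real set \<Rightarrow> seq_operator) \<Rightarrow> bool" where
  "spectral_resolution H P \<longleftrightarrow>
     projection_valued_measure P \<and>
     (\<forall>u\<in>l2. integrable (spectral_measure P u) (\<lambda>x. x) \<and>
        l2_inner u (H u) = complex_of_real (\<integral>x. x \<partial>spectral_measure P u))"

definition pure_point_measure :: "real measure \<Rightarrow> bool" where
  "pure_point_measure \<nu> \<longleftrightarrow> (\<exists>S. countable S \<and> (AE x in \<nu>. x \<in> S))"

definition pure_point_spectrum_on :: "seq_operator \<Rightarrow> real set \<Rightarrow> bool" where
  "pure_point_spectrum_on H I \<longleftrightarrow>
     (\<forall>P. spectral_resolution H P \<longrightarrow>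
        (\<forall>u\<in>l2. pure_point_measure (restrict_space (spectral_measure P u) I)))"

definition eigenfunction :: "seq_operator \<Rightarrow> real \<Rightarrow> (int \<Rightarrow> complex) \<Rightarrow> bool" where
  "eigenfunction H E u \<longleftrightarrow>
     u \<in> l2 \<and> u \<noteq> (\<lambda>n. 0) \<and> H u = (\<lambda>n. complex_of_real E * u n)"

definition exponentially_decaying :: "(int \<Rightarrow> complex) \<Rightarrow> bool" where
  "exponentially_decaying u \<longleftrightarrow>
     (\<exists>C>0. \<exists>\<gamma>>0. \<forall>n. cmod (u n) \<le> C * exp (- \<gamma> * real_of_int \<bar>n\<bar>))"

definition spectral_localization :: "seq_operator \<Rightarrow> real set \<Rightarrow> bool" where
  "spectral_localization H I \<longleftrightarrow>
     pure_point_spectrum_on H I \<and>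
     (\<forall>E\<in>I. \<forall>u. eigenfunction H E u \<longrightarrow> exponentially_decaying u)"

end

theory Submission
  imports Defs "HOL-Real_Asymp.Real_Asymp"
begin

text \<open>
  Only norms of transfer matrices are used. If \<open>A\<close> and \<open>B\<close> are the transfer matrices over the blocks
  of length \<open>k\<close> to the left and to the right of a site \<open>b\<close>, then a solution satisfies
  \<open>\<parallel>BA\<parallel> \<cdot> \<parallel>v b\<parallel> \<le> \<parallel>A\<parallel> \<cdot> \<parallel>v (b + k)\<parallel> + \<parallel>B\<parallel> \<cdot> \<parallel>v (b - k)\<parallel>\<close>, so that it contracts at \<open>b\<close> as soon as \<open>\<parallel>A\<parallel>\<close> and
  \<open>\<parallel>B\<parallel>\<close> are exponentially smaller than \<open>\<parallel>BA\<parallel>\<close>; by PLE and ULD this fails only with exponentially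
  small probability, uniformly on \<open>I\<close>. Two applications give localization. First, among boundedly
  many well separated blocks of length \<open>D k\<close> on either side of the origin one is good for every energy
  of \<open>I\<close>, by near independence (bounded distortion) and a net of energies. Truncating a polynomially
  bounded solution there shows that its energy is exponentially close to an element of a set which
  depends only on the potential near the origin and which has a net of polynomial cardinality, since
  approximate eigenvectors for separated energies are almost orthogonal. Secondly, again by bounded
  distortion, for these energies all blocks of length \<open>k\<close> at distance between \<open>const \<cdot> k\<close> and \<open>k ^ 3\<close> from
  the origin are good. Hence polynomially bounded solutions decay exponentially. Finally, spectrally
  almost every energy has a polynomially bounded solution, namely a Radon-Nikodym density
  \<open>d\<langle>\<delta> m, P \<delta> n\<rangle> / d\<rho>\<close> as a function of \<open>m\<close>.
\<close>

section \<open>Transfer matrices\<close>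

text \<open>The a priori growth of transfer matrices forces two scales. Changing the energy by
  \<delta> disturbs a product of length \<open>2 * k\<close> by about
  \<open>(S + 2) ^ (2 * k) * \<delta>\<close>, so goodness at scale \<open>k\<close> passes only
  between energies that are \<open>exp (- A * k)\<close> close, where \<open>A\<close> is larger
  than the contraction rate. A truncation at blocks of length \<open>D * k\<close> has error
  \<open>exp (- g * D * k)\<close>, and \<open>g * D \<ge> A + 1\<close> makes this precise enough.
  In the first application a net of precision \<open>exp (- A * n)\<close> has about
  \<open>exp (A * n)\<close> points, while a single block fails with probability about
  \<open>exp (- c * n)\<close>; hence \<open>r + 1\<close> blocks with
  \<open>c * (r + 1) \<ge> A + 1\<close>. Bounded distortion compares cylinders, but
  \<open>f\<close> may depend on all letters. Each bad event is therefore enlarged to one decided by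
  a finite window. The rates record the losses: \<open>5 * g\<close> comes from large deviations,
  \<open>4 * g\<close> survives the change of letters outside the window, \<open>3 * g\<close>
  survives the passage to a nearby energy, and \<open>g\<close> is left for the truncation once
  polynomial growth is paid for.\<close>

definition tm_step :: "real \<Rightarrow> real^2^2" where
  "tm_step t = vector [vector [t, -1], vector [1, 0]]"

text \<open>\<open>x\<close> stands for \<open>E - V n\<close>. Energy and potential enter only
  through this difference, so a change of either is the same kind of perturbation.\<close>

primrec tm :: "(int \<Rightarrow> real) \<Rightarrow> int \<Rightarrow> nat \<Rightarrow> real^2^2" where
  "tm x a 0 = mat 1"
| "tm x a (Suc k) = tm_step (x (a + int k)) ** tm x a k"

abbreviation mnorm :: "real^2^2 \<Rightarrow> real" where
  "mnorm A \<equiv> onorm (\<lambda>v. A *v v)"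

text \<open>The determinant with columns \<open>v\<close> and \<open>w\<close>. Its invariance is
  the form in which determinant one of the transfer matrices is used.\<close>

definition symp :: "real^2 \<Rightarrow> real^2 \<Rightarrow> real" where
  "symp v w = v$1 * w$2 - v$2 * w$1"

lemma seq_shift_seq_shift [simp]: "seq_shift i (seq_shift j \<omega>) = seq_shift (i + j) \<omega>"
  by (simp add: seq_shift_def fun_eq_iff add.assoc)

lemma cocycle_eq_tm:
  "cocycle f E k (seq_shift a \<omega>) = tm (\<lambda>n. E - f (seq_shift n \<omega>)) a k"
  by (induction k) (simp_all add: schroedinger_matrix_def tm_step_def add.commute)

lemma tm_add: "tm x a (j + k) = tm x (a + int j) k ** tm x a j"
  by (induction k) (simp_all add: matrix_mul_assoc add.assoc)

lemma bounded_linear_mv: "bounded_linear (\<lambda>v. (A::real^2^2) *v v)"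
  by simp

lemma norm_mv_le: "norm ((A::real^2^2) *v v) \<le> mnorm A * norm v"
  by (rule onorm) simp

lemma mnorm_nonneg: "0 \<le> mnorm A"
  by (rule onorm_pos_le) simp

lemma mnorm_mult: "mnorm (A ** B) \<le> mnorm A * mnorm B"
  using onorm_compose[OF bounded_linear_mv bounded_linear_mv, of A B]
  by (simp add: o_def matrix_vector_mul_assoc)

lemma mnorm_add: "mnorm (A + B) \<le> mnorm A + mnorm B"
  using onorm_triangle[OF bounded_linear_mv bounded_linear_mv, of A B]
  by (simp add: matrix_vector_mult_add_rdistrib)

lemma mnorm_diff_le: "mnorm A \<le> mnorm B + mnorm (A - B)"
  using mnorm_add[of B "A - B"] by simp

lemma mnorm_minus_commute: "mnorm (A - B) = mnorm (B - A)"
  using onorm_neg[of "\<lambda>v. (A - B) *v v"] by (simp add: matrix_vector_mult_diff_rdistrib)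

lemma mnorm_le_entries: "mnorm A \<le> \<bar>A$1$1\<bar> + \<bar>A$1$2\<bar> + \<bar>A$2$1\<bar> + \<bar>A$2$2\<bar>"
  using onorm_le_matrix_component_sum[of A] by (simp add: sum_2)

lemma vec2_norm: "(norm (v::real^2))\<^sup>2 = (v$1)\<^sup>2 + (v$2)\<^sup>2"
  unfolding power2_norm_eq_inner by (simp add: inner_vec_def sum_2 power2_eq_square)

lemma symp_le: "\<bar>symp v w\<bar> \<le> norm v * norm w"
proof (rule power2_le_imp_le)
  have "(symp v w)\<^sup>2 \<le> (norm v)\<^sup>2 * (norm w)\<^sup>2"
    unfolding vec2_norm symp_def
    using zero_le_power2[of "v$1 * w$1 + v$2 * w$2"]
    by (simp add: power2_eq_square algebra_simps)
  then show "\<bar>symp v w\<bar>\<^sup>2 \<le> (norm v * norm w)\<^sup>2" by (simp add: power_mult_distrib)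
qed simp

lemma tm_step_mv: "tm_step t *v v = vector [t * v$1 - v$2, v$1]"
  by (simp add: tm_step_def vec_eq_iff forall_2 matrix_vector_mult_def sum_2)

lemma symp_tm_step: "symp (tm_step t *v v) (tm_step t *v w) = symp v w"
  by (simp add: tm_step_mv symp_def algebra_simps)

lemma symp_tm: "symp (tm x a k *v v) (tm x a k *v w) = symp v w"
  by (induction k) (simp_all add: symp_tm_step flip: matrix_vector_mul_assoc)

text \<open>The images of the two basis vectors still span unit area, so they cannot both be short.
  This lower bound later turns absolute errors into relative ones.\<close>

lemma mnorm_tm_ge_1: "1 \<le> mnorm (tm x a k)"
proof -
  let ?A = "tm x a k" and ?e = "axis 1 1 :: real^2" and ?e' = "axis 2 1 :: real^2"
  have "1 = \<bar>symp (?A *v ?e) (?A *v ?e')\<bar>"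
    unfolding symp_tm by (simp add: symp_def axis_def)
  also have "\<dots> \<le> norm (?A *v ?e) * norm (?A *v ?e')" by (rule symp_le)
  also have "\<dots> \<le> mnorm ?A * mnorm ?A"
    using norm_mv_le[of ?A ?e] norm_mv_le[of ?A ?e'] by (intro mult_mono) (auto simp: mnorm_nonneg)
  finally have "1\<^sup>2 \<le> (mnorm ?A)\<^sup>2" by (simp add: power2_eq_square)
  then show ?thesis by (rule power2_le_imp_le) (rule mnorm_nonneg)
qed

text \<open>Expand \<open>A *v z\<close> in the orthogonal basis of \<open>v = A *v w\<close> and
  its rotation \<open>v'\<close>. Invariance turns the coefficient along \<open>v'\<close> into
  \<open>symp w z\<close>, which involves \<open>norm w\<close> and not \<open>norm A\<close>; this
  is what leaves only \<open>mnorm B * norm w\<close> in the second term.\<close>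

lemma mnorm_mult_mul_norm_le:
  assumes "\<And>y z. symp (A *v y) (A *v z) = symp y z"
  shows "mnorm (B ** A) * norm (A *v w) \<le> mnorm A * norm (B *v (A *v w)) + mnorm B * norm w"
proof (cases "A *v w = 0")
  case True
  then show ?thesis by (simp add: mnorm_nonneg)
next
  case False
  define v where "v = A *v w"
  define v' :: "real^2" where "v' = vector [- (v$2), v$1]"
  have v: "norm v > 0" using False by (simp add: v_def)
  have v': "norm v' = norm v"
    by (rule power2_eq_imp_eq) (simp_all add: vec2_norm v'_def)
  let ?c = "(mnorm A * norm (B *v v) + mnorm B * norm w) / norm v"
  have "norm ((B ** A) *v z) \<le> ?c * norm z" for z
  proof -
    let ?y = "A *v z"
    have eq: "(norm v)\<^sup>2 *\<^sub>R ?y = (?y \<bullet> v) *\<^sub>R v + symp v ?y *\<^sub>R v'"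
      unfolding vec2_norm
      by (simp add: vec_eq_iff forall_2 v'_def symp_def inner_vec_def sum_2 power2_eq_square algebra_simps)
    have "(norm v)\<^sup>2 * norm (B *v ?y) = norm (B *v ((norm v)\<^sup>2 *\<^sub>R ?y))"
      by (simp add: matrix_vector_mult_scaleR)
    also have "\<dots> = norm ((?y \<bullet> v) *\<^sub>R (B *v v) + symp v ?y *\<^sub>R (B *v v'))"
      by (simp only: eq matrix_vector_right_distrib matrix_vector_mult_scaleR)
    also have "\<dots> \<le> \<bar>?y \<bullet> v\<bar> * norm (B *v v) + \<bar>symp v ?y\<bar> * norm (B *v v')"
      by (rule norm_triangle_le) simp
    also have "\<dots> \<le> ((mnorm A * norm z) * norm v) * norm (B *v v) + (norm w * norm z) * (mnorm B * norm v)"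
    proof (intro add_mono mult_right_mono mult_mono)
      show "\<bar>?y \<bullet> v\<bar> \<le> (mnorm A * norm z) * norm v"
        using Cauchy_Schwarz_ineq2[of ?y v] norm_mv_le[of A z]
        by (meson mult_right_mono norm_ge_zero order_trans)
      show "\<bar>symp v ?y\<bar> \<le> norm w * norm z"
        using symp_le[of w z] by (simp add: v_def assms)
      show "norm (B *v v') \<le> mnorm B * norm v" using norm_mv_le[of B v'] by (simp add: v')
    qed auto
    also have "\<dots> = (norm v)\<^sup>2 * (?c * norm z)" using v by (simp add: power2_eq_square field_simps)
    finally show ?thesis using v by (simp add: matrix_vector_mul_assoc del: times_divide_eq_left)
  qed
  then have "mnorm (B ** A) \<le> ?c"
    by (intro onorm_le)
  then show ?thesis using v by (simp add: pos_le_divide_eq v_def)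
qed

definition sol :: "(int \<Rightarrow> real) \<Rightarrow> (int \<Rightarrow> real) \<Rightarrow> bool" where
  "sol x u \<longleftrightarrow> (\<forall>n. u (n + 1) + u (n - 1) = x n * u n)"

definition svec :: "(int \<Rightarrow> real) \<Rightarrow> int \<Rightarrow> real^2" where
  "svec u n = vector [u n, u (n - 1)]"

lemma tm_svec:
  assumes "sol x u"
  shows "tm x a k *v svec u a = svec u (a + int k)"
proof (induction k)
  case (Suc k)
  have "x (a + int k) * u (a + int k) - u (a + int k - 1) = u (a + int k + 1)"
    using assms unfolding sol_def by (metis add_diff_cancel_right')
  then show ?case
    using Suc by (simp add: tm_step_mv svec_def algebra_simps flip: matrix_vector_mul_assoc)
qed simp

text \<open>When norms grow like \<open>exp (L * length)\<close>, each half is smaller than the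
  product by about \<open>exp (- L * k)\<close>, so rates slightly below \<open>L\<close> are
  typical. The notion plays the role of a decay estimate for the Green function of the interval
  around \<open>b\<close>.\<close>

definition good_block :: "(int \<Rightarrow> real) \<Rightarrow> int \<Rightarrow> nat \<Rightarrow> real \<Rightarrow> bool" where
  "good_block x b k \<gamma> \<longleftrightarrow>
     mnorm (tm x (b - int k) k) \<le> exp (- \<gamma> * real k) * mnorm (tm x (b - int k) (2 * k)) \<and>
     mnorm (tm x b k) \<le> exp (- \<gamma> * real k) * mnorm (tm x (b - int k) (2 * k))"

lemma good_block_norm_svec:
  assumes "sol x u" "good_block x b k \<gamma>"
  shows "norm (svec u b) \<le> exp (- \<gamma> * real k) * (norm (svec u (b - int k)) + norm (svec u (b + int k)))"
proof -
  let ?A = "tm x (b - int k) k" and ?B = "tm x b k" and ?AB = "tm x (b - int k) (2 * k)"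
  let ?w = "svec u (b - int k)"
  have AB: "?AB = ?B ** ?A" using tm_add[of x "b - int k" k k] by (simp add: mult_2)
  have Aw: "?A *v ?w = svec u b" "?B *v svec u b = svec u (b + int k)"
    using tm_svec[OF assms(1)] by simp_all
  have "mnorm ?AB * norm (svec u b) \<le> mnorm ?A * norm (svec u (b + int k)) + mnorm ?B * norm ?w"
    unfolding AB using mnorm_mult_mul_norm_le[of ?A ?B ?w, OF symp_tm] by (simp add: Aw)
  also have "\<dots> \<le> (exp (- \<gamma> * real k) * mnorm ?AB) * norm (svec u (b + int k)) +
      (exp (- \<gamma> * real k) * mnorm ?AB) * norm ?w"
    using assms(2) unfolding good_block_def by (intro add_mono mult_right_mono) auto
  also have "\<dots> = mnorm ?AB * (exp (- \<gamma> * real k) * (norm ?w + norm (svec u (b + int k))))"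
    by (simp add: algebra_simps)
  finally show ?thesis using mnorm_tm_ge_1[of x "b - int k" "2 * k"] by simp
qed

section \<open>Stability of good blocks under perturbations\<close>

lemma mnorm_tm_step: "mnorm (tm_step t) \<le> \<bar>t\<bar> + 2"
  using mnorm_le_entries[of "tm_step t"] by (simp add: tm_step_def)

lemma mnorm_tm_le:
  assumes "\<And>j. \<bar>x j\<bar> \<le> S"
  shows "mnorm (tm x a k) \<le> (S + 2) ^ k"
proof (induction k)
  case (Suc k)
  have S: "0 \<le> S" using assms[of 0] by linarith
  have "mnorm (tm x a (Suc k)) \<le> mnorm (tm_step (x (a + int k))) * mnorm (tm x a k)"
    using mnorm_mult by simp
  also have "\<dots> \<le> (S + 2) * (S + 2) ^ k"
    using Suc mnorm_tm_step[of "x (a + int k)"] assms[of "a + int k"] S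
    by (intro mult_mono) (auto simp: mnorm_nonneg)
  finally show ?case by simp
qed (simp add: onorm_id)

text \<open>Factors are exchanged one at a time; each exchange costs \<delta>, and the other factors
  are bounded by \<open>S + 2\<close>.\<close>

lemma mnorm_tm_diff_le:
  assumes x: "\<And>j. \<bar>x j\<bar> \<le> S" and y: "\<And>j. \<bar>y j\<bar> \<le> S"
    and d: "\<And>j. a \<le> j \<Longrightarrow> j < a + int k \<Longrightarrow> \<bar>x j - y j\<bar> \<le> \<delta>" and "0 \<le> \<delta>"
  shows "mnorm (tm x a k - tm y a k) \<le> real k * (S + 2) ^ k * \<delta>"
  using d
proof (induction k)
  case 0
  then show ?case by (simp add: onorm_zero)
next
  case (Suc k)
  have S: "0 \<le> S" using x[of 0] by linarith
  let ?X = "tm_step (x (a + int k))" and ?Y = "tm_step (y (a + int k))"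
  have IH: "mnorm (tm x a k - tm y a k) \<le> real k * (S + 2) ^ k * \<delta>"
    using Suc by simp
  have "tm x a (Suc k) - tm y a (Suc k) = ?X ** (tm x a k - tm y a k) + (?X - ?Y) ** tm y a k"
    by (simp add: vec_eq_iff matrix_matrix_mult_def sum_2 algebra_simps)
  then have "mnorm (tm x a (Suc k) - tm y a (Suc k))
     \<le> mnorm ?X * mnorm (tm x a k - tm y a k) + mnorm (?X - ?Y) * mnorm (tm y a k)"
    using order_trans[OF mnorm_add add_mono[OF mnorm_mult mnorm_mult]] by (simp only:)
  also have "\<dots> \<le> (S + 2) * (real k * (S + 2) ^ k * \<delta>) + \<delta> * (S + 2) ^ k"
  proof (intro add_mono mult_mono)
    show "mnorm ?X \<le> S + 2" using mnorm_tm_step[of "x (a + int k)"] x[of "a + int k"] by linarith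
    show "mnorm (?X - ?Y) \<le> \<delta>"
      using mnorm_le_entries[of "?X - ?Y"] Suc.prems[of "a + int k"] by (simp add: tm_step_def)
  qed (use IH S \<open>0 \<le> \<delta>\<close> mnorm_tm_le[of y, OF y] in \<open>auto simp: mnorm_nonneg\<close>)
  also have "\<dots> \<le> (S + 2) * (real k * (S + 2) ^ k * \<delta>) + (S + 2) * ((S + 2) ^ k * \<delta>)"
    using S \<open>0 \<le> \<delta>\<close> mult_right_mono[of 1 "S + 2" "(S + 2) ^ k * \<delta>"] by (simp add: algebra_simps)
  also have "\<dots> = real (Suc k) * (S + 2) ^ Suc k * \<delta>"
    by (simp add: algebra_simps)
  finally show ?case .
qed

text \<open>The tangent to \<open>exp\<close> at \<open>ln 2\<close> has slope 2 and lies above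
  \<open>2 * t\<close>. The bound absorbs the linear factor of a telescoping sum into one unit of
  exponent.\<close>

lemma two_mult_le_exp: "2 * t \<le> exp (t::real)"
proof -
  have "t - ln 2 + 1 \<le> exp (t - ln 2)" using exp_ge_add_one_self[of "t - ln 2"] by linarith
  then have "2 * (t - ln 2 + 1) \<le> exp t" by (simp add: exp_diff)
  moreover have "ln 2 \<le> (1::real)" using ln_le_minus_one[of 2] by simp
  ultimately show ?thesis using mult_left_mono[of t "t - ln 2 + 1" 2] by simp
qed

text \<open>In the condition on \<open>A\<close>, \<open>2 * ln (S + 2)\<close> pays for the growth
  of a product of length \<open>2 * k\<close> and the summand 1 for the factor \<open>2 * k\<close>.
  What remains is an absolute error \<open>exp (- \<gamma> * k)\<close>, harmless because all norms
  are at least 1.\<close>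

lemma good_block_perturb:
  assumes g: "good_block x b k \<gamma>" and "0 \<le> \<gamma>"
    and x: "\<And>j. \<bar>x j\<bar> \<le> S" and y: "\<And>j. \<bar>y j\<bar> \<le> S"
    and d: "\<And>j. b - int k \<le> j \<Longrightarrow> j \<le> b + int k \<Longrightarrow> \<bar>x j - y j\<bar> \<le> exp (- A * real k)"
    and A: "2 * ln (S + 2) + \<gamma> + 1 \<le> A" and \<gamma>: "3 \<le> exp ((\<gamma> - \<gamma>') * real k)"
  shows "good_block y b k \<gamma>'"
proof -
  have S: "0 \<le> S" using x[of 0] by linarith
  let ?e = "exp (- \<gamma> * real k)"
  have M: "(S + 2) ^ j = exp (real j * ln (S + 2))" for j
    using S by (simp add: exp_of_nat_mult)
  have small: "mnorm (tm x a j - tm y a j) \<le> ?e"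
    if "b - int k \<le> a" "a + int j \<le> b + int k" "j \<le> 2 * k" for a j
  proof -
    have "mnorm (tm x a j - tm y a j) \<le> real j * (S + 2) ^ j * exp (- A * real k)"
      by (rule mnorm_tm_diff_le[OF x y d]) (use that in auto)
    also have "\<dots> \<le> real (2 * k) * (S + 2) ^ (2 * k) * exp (- A * real k)"
      using that S by (intro mult_mono power_increasing) auto
    also have "\<dots> \<le> exp (real k) * (S + 2) ^ (2 * k) * exp (- A * real k)"
      using two_mult_le_exp[of "real k"] S by (intro mult_right_mono) auto
    also have "\<dots> = exp (real k * (1 + 2 * ln (S + 2) - A))"
      unfolding M by (simp add: algebra_simps flip: exp_add)
    also have "\<dots> \<le> exp (real k * - \<gamma>)"
      using A unfolding exp_le_cancel_iff by (intro mult_left_mono) auto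
    finally show ?thesis by (simp add: mult.commute)
  qed
  let ?X = "mnorm (tm x (b - int k) (2 * k))" and ?Y = "mnorm (tm y (b - int k) (2 * k))"
  have XY: "?X \<le> ?Y + ?e"
    using small[of "b - int k" "2 * k"] mnorm_diff_le[of "tm x (b - int k) (2 * k)" "tm y (b - int k) (2 * k)"]
    by simp
  have e3: "3 * ?e \<le> exp (- \<gamma>' * real k)"
  proof -
    have "3 * ?e \<le> exp ((\<gamma> - \<gamma>') * real k) * ?e" using \<gamma> by (intro mult_right_mono) auto
    also have "\<dots> = exp (- \<gamma>' * real k)" by (simp add: algebra_simps flip: exp_add)
    finally show ?thesis .
  qed
  have Y1: "1 \<le> ?Y" by (rule mnorm_tm_ge_1)
  have e1: "?e \<le> ?Y"
    using Y1 \<open>0 \<le> \<gamma>\<close> by (intro order_trans[OF _ Y1]) simp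
  have *: "mnorm (tm y a k) \<le> exp (- \<gamma>' * real k) * ?Y"
    if "b - int k \<le> a" "a + int k \<le> b + int k" "mnorm (tm x a k) \<le> ?e * ?X" for a
  proof -
    \<comment> \<open>Three terms of size \<open>?e * ?Y\<close> arise: the goodness of
      \<open>x\<close>, the passage from \<open>?X\<close> to \<open>?Y\<close>, and the passage
      from \<open>tm x\<close> to \<open>tm y\<close>. This is the 3 that the loss of rate has to
      cover.\<close>
    have "mnorm (tm y a k) \<le> ?e * ?X + ?e"
      using small[of a k] that mnorm_diff_le[of "tm y a k" "tm x a k"] mnorm_minus_commute[of "tm x a k" "tm y a k"]
      by simp
    also have "\<dots> \<le> ?e * (?Y + ?e) + ?e" using XY by simp
    also have "\<dots> \<le> ?e * (?Y + ?Y) + ?e * ?Y"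
      using e1 Y1 by (intro add_mono mult_left_mono) auto
    also have "\<dots> = 3 * ?e * ?Y" by simp
    also have "\<dots> \<le> exp (- \<gamma>' * real k) * ?Y" using e3 Y1 by (intro mult_right_mono) auto
    finally show ?thesis .
  qed
  show ?thesis
    using g *[of "b - int k"] *[of b] unfolding good_block_def by simp
qed

section \<open>Exponential decay of polynomially bounded solutions\<close>

text \<open>A normalized quasimode supported in \<open>[-N, N]\<close>. The residual is controlled
  at every site, so the defects just outside the support count as well.\<close>

definition approx_sol :: "(int \<Rightarrow> real) \<Rightarrow> int \<Rightarrow> real \<Rightarrow> bool" where
  "approx_sol x N \<eta> \<longleftrightarrow>
     (\<exists>u. (\<forall>n. N < \<bar>n\<bar> \<longrightarrow> u n = 0) \<and> (\<Sum>n\<in>{-N..N}. (u n)\<^sup>2) = 1 \<and>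
          (\<forall>n. \<bar>u (n + 1) + u (n - 1) - x n * u n\<bar> \<le> \<eta>))"

lemma norm_svec_ge: "\<bar>u n\<bar> \<le> norm (svec u n)" "\<bar>u (n - 1)\<bar> \<le> norm (svec u n)"
  using component_le_norm_cart[of "svec u n" 1] component_le_norm_cart[of "svec u n" 2]
  by (simp_all add: svec_def)

lemma norm_svec_le: "norm (svec u n) \<le> \<bar>u n\<bar> + \<bar>u (n - 1)\<bar>"
  using norm_le_l1_cart[of "svec u n"] by (simp add: svec_def sum_2)

text \<open>Cutting off to \<open>[s, t - 1]\<close> violates the equation only at
  \<open>s - 1\<close>, \<open>s\<close>, \<open>t - 1\<close> and \<open>t\<close>, and the defects
  are, up to sign, entries of \<open>svec u s\<close> and \<open>svec u t\<close>. The interval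
  contains -1 and 0, so normalization divides by at least \<open>norm (svec u 0)\<close>.\<close>

lemma approx_sol_truncate:
  assumes u: "sol x u" and m: "0 < norm (svec u 0)"
    and s: "- N \<le> s" "s \<le> - 1" "norm (svec u s) \<le> \<eta> * norm (svec u 0)"
    and t: "1 \<le> t" "t \<le> N" "norm (svec u t) \<le> \<eta> * norm (svec u 0)"
  shows "approx_sol x N \<eta>"
proof -
  define w where "w = (\<lambda>n. if s \<le> n \<and> n \<le> t - 1 then u n else 0)"
  define c where "c = sqrt (\<Sum>n\<in>{-N..N}. (w n)\<^sup>2)"
  have eq: "u (n + 1) + u (n - 1) - x n * u n = 0" for n
    using u by (simp add: sol_def)
  have "(norm (svec u 0))\<^sup>2 = (\<Sum>n\<in>{0, -1}. (w n)\<^sup>2)"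
    unfolding vec2_norm using s t by (simp add: svec_def w_def)
  also have "\<dots> \<le> (\<Sum>n\<in>{-N..N}. (w n)\<^sup>2)"
    using s t by (intro sum_mono2) auto
  finally have c: "norm (svec u 0) \<le> c" unfolding c_def by (rule real_le_rsqrt)
  have res: "\<bar>w (n + 1) + w (n - 1) - x n * w n\<bar> \<le> \<eta> * norm (svec u 0)" for n
  proof -
    have pos: "0 \<le> \<eta> * norm (svec u 0)" using s(3) norm_ge_zero order_trans by blast
    note b = order_trans[OF norm_svec_ge(1) s(3)] order_trans[OF norm_svec_ge(2) s(3)]
       order_trans[OF norm_svec_ge(1) t(3)] order_trans[OF norm_svec_ge(2) t(3)]
    consider "n < s - 1" | "n = s - 1" | "n = s" | "s < n" "n < t - 1" | "n = t - 1" "n \<noteq> s" | "n = t" | "t < n"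
      by linarith
    then show ?thesis
    proof cases
      case 1 then show ?thesis using pos s t by (simp add: w_def)
    next
      case 2 then show ?thesis using b s t by (simp add: w_def)
    next
      case 3
      have "w (n + 1) + w (n - 1) - x n * w n = - u (s - 1)"
        using eq[of n] 3 s t by (simp add: w_def)
      then show ?thesis using b by simp
    next
      case 4
      have "w (n + 1) + w (n - 1) - x n * w n = 0"
        using eq[of n] 4 s t by (simp add: w_def)
      then show ?thesis using pos by simp
    next
      case 5
      have "w (n + 1) + w (n - 1) - x n * w n = - u t"
        using eq[of n] 5 s t by (simp add: w_def)
      then show ?thesis using b by simp
    next
      case 6 then show ?thesis using b s t by (simp add: w_def)
    next
      case 7 then show ?thesis using pos s t by (simp add: w_def)
    qed
  qed
  show ?thesis unfolding approx_sol_def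
  proof (intro exI[of _ "\<lambda>n. w n / c"] conjI allI impI)
    show "w n / c = 0" if "N < \<bar>n\<bar>" for n using that s t by (auto simp: w_def)
    have "c\<^sup>2 = (\<Sum>n\<in>{-N..N}. (w n)\<^sup>2)" by (simp add: c_def sum_nonneg)
    then show "(\<Sum>n\<in>{-N..N}. (w n / c)\<^sup>2) = 1"
      using c m by (auto simp: power_divide simp flip: sum_divide_distrib)
    fix n
    have "w (n + 1) / c + w (n - 1) / c - x n * (w n / c) = (w (n + 1) + w (n - 1) - x n * w n) / c"
      by (simp add: add_divide_distrib diff_divide_distrib)
    also have "\<bar>\<dots>\<bar> = \<bar>w (n + 1) + w (n - 1) - x n * w n\<bar> / c"
      using order_less_le_trans[OF m c] by simp
    also have "\<dots> \<le> (\<eta> * norm (svec u 0)) / c"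
      using order_less_le_trans[OF m c] by (intro divide_right_mono res) auto
    also have "\<dots> \<le> \<eta>"
    proof -
      have "0 \<le> \<eta>" using s(3) m by (metis norm_ge_zero order_trans zero_le_mult_iff not_le)
      then show ?thesis using mult_left_mono[OF c, of \<eta>] order_less_le_trans[OF m c]
        by (simp add: divide_le_eq)
    qed
    finally show "\<bar>w (n + 1) / c + w (n - 1) / c - x n * (w n / c)\<bar> \<le> \<eta>" .
  qed
qed

lemma sol_eq_0:
  assumes "sol x u" "svec u 0 = 0"
  shows "u n = 0"
proof -
  have "u n = 0 \<and> u (n - 1) = 0"
  proof (induction n rule: int_induct[where k = 0])
    case base
    then show ?case using norm_svec_ge[of u 0] assms(2) by simp
  next
    case (step1 i)
    then show ?case using assms(1)[unfolded sol_def, rule_format, of i] by simp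
  next
    case (step2 i)
    then show ?case using assms(1)[unfolded sol_def, rule_format, of "i - 1"] by simp
  qed
  then show ?thesis ..
qed

lemma norm_svec_growth:
  assumes "\<And>n. \<bar>u n\<bar> \<le> C * (1 + \<bar>real_of_int n\<bar>)\<^sup>2"
  shows "norm (svec u n) \<le> 2 * C * (2 + \<bar>real_of_int n\<bar>)\<^sup>2"
proof -
  have C: "0 \<le> C" using assms[of 0] by simp
  have "norm (svec u n) \<le> C * (1 + \<bar>real_of_int n\<bar>)\<^sup>2 + C * (1 + \<bar>real_of_int (n - 1)\<bar>)\<^sup>2"
    using norm_svec_le[of u n] assms[of n] assms[of "n - 1"] by linarith
  also have "\<dots> \<le> C * (2 + \<bar>real_of_int n\<bar>)\<^sup>2 + C * (2 + \<bar>real_of_int n\<bar>)\<^sup>2"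
  proof -
    have "1 + \<bar>real_of_int (n - 1)\<bar> \<le> 2 + \<bar>real_of_int n\<bar>" by linarith
    from power_mono[OF this, of 2] power_mono[of "1 + \<bar>real_of_int n\<bar>" "2 + \<bar>real_of_int n\<bar>" 2]
    show ?thesis using C by (intro add_mono[OF mult_left_mono mult_left_mono]) auto
  qed
  finally show ?thesis by simp
qed

text \<open>Each contraction gains \<open>2 * exp (- \<gamma> * k)\<close> and moves by
  \<open>k\<close>; from the centre of a good zone of radius \<open>J * k\<close> it can be repeated
  \<open>J\<close> times before the a priori bound \<open>W\<close> is needed.\<close>

lemma norm_svec_iterate:
  assumes u: "sol x u"
    and good: "\<And>b. \<bar>b - m\<bar> \<le> int (J * k) \<Longrightarrow> good_block x b k \<gamma>"
    and W: "\<And>b. \<bar>b - m\<bar> \<le> int (J * k) \<Longrightarrow> norm (svec u b) \<le> W"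
  shows "j \<le> J \<Longrightarrow> \<bar>b - m\<bar> \<le> int ((J - j) * k) \<Longrightarrow> norm (svec u b) \<le> (2 * exp (- \<gamma> * real k)) ^ j * W"
proof (induction j arbitrary: b)
  case 0
  then show ?case using W[of b] by simp
next
  case (Suc j)
  have Jj: "(J - j) * k = (J - Suc j) * k + k"
  proof -
    have "J - j = Suc (J - Suc j)" using Suc.prems(1) by simp
    then show ?thesis by simp
  qed
  have "(J - j) * k \<le> J * k" by simp
  then have bd: "\<bar>b - m\<bar> \<le> int (J * k)" using Suc.prems(2) Jj by linarith
  have n1: "norm (svec u (b - int k)) \<le> (2 * exp (- \<gamma> * real k)) ^ j * W"
    by (rule Suc.IH) (use Suc.prems Jj in linarith)+
  have n2: "norm (svec u (b + int k)) \<le> (2 * exp (- \<gamma> * real k)) ^ j * W"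
    by (rule Suc.IH) (use Suc.prems Jj in linarith)+
  have "norm (svec u b) \<le> exp (- \<gamma> * real k) * (norm (svec u (b - int k)) + norm (svec u (b + int k)))"
    by (rule good_block_norm_svec[OF u good[OF bd]])
  also have "\<dots> \<le> exp (- \<gamma> * real k) * ((2 * exp (- \<gamma> * real k)) ^ j * W + (2 * exp (- \<gamma> * real k)) ^ j * W)"
    using n1 n2 by (intro mult_left_mono add_mono) auto
  finally show ?case by (simp add: mult_ac)
qed

lemma exp_decay_from_eventually:
  fixes u :: "int \<Rightarrow> real"
  assumes "\<And>n. m0 \<le> \<bar>n\<bar> \<Longrightarrow> \<bar>u n\<bar> \<le> C0 * exp (- \<gamma> * real_of_int \<bar>n\<bar>)"
  shows "\<exists>C>0. \<forall>n. \<bar>u n\<bar> \<le> C * exp (- \<gamma> * real_of_int \<bar>n\<bar>)"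
proof -
  let ?h = "\<lambda>n. \<bar>u n\<bar> * exp (\<gamma> * real_of_int \<bar>n\<bar>)"
  let ?C = "\<bar>C0\<bar> + 1 + (\<Sum>n\<in>{-m0..m0}. ?h n)"
  have nn: "0 \<le> (\<Sum>n\<in>{-m0..m0}. ?h n)" by (intro sum_nonneg) auto
  have "\<bar>u n\<bar> \<le> ?C * exp (- \<gamma> * real_of_int \<bar>n\<bar>)" for n
  proof (cases "m0 \<le> \<bar>n\<bar>")
    case True
    then have "\<bar>u n\<bar> \<le> C0 * exp (- \<gamma> * real_of_int \<bar>n\<bar>)" by (rule assms)
    also have "\<dots> \<le> ?C * exp (- \<gamma> * real_of_int \<bar>n\<bar>)"
      using nn by (intro mult_right_mono) auto
    finally show ?thesis .
  next
    case False
    then have "?h n \<le> (\<Sum>n\<in>{-m0..m0}. ?h n)"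
      by (intro member_le_sum) auto
    then have "?h n \<le> ?C" by linarith
    then have "?h n * exp (- \<gamma> * real_of_int \<bar>n\<bar>) \<le> ?C * exp (- \<gamma> * real_of_int \<bar>n\<bar>)"
      by (intro mult_right_mono) auto
    then show ?thesis by (simp add: mult.assoc flip: exp_add)
  qed
  then show ?thesis using nn by (intro exI[of _ ?C]) auto
qed

text \<open>The deterministic core. For a site \<open>n\<close> the scale is chosen as
  \<open>k\<close> near the square root of \<open>\<bar>n\<bar>\<close>: there is then room for
  about \<open>k / 2\<close> contractions of size \<open>exp (- const * k)\<close>, and the product
  is exponential in \<open>\<bar>n\<bar>\<close>.\<close>

lemma exp_decay_of_good_blocks:
  fixes u x :: "int \<Rightarrow> real" and g C :: real and R D R' :: nat
  assumes u: "sol x u" and growth: "\<And>n. \<bar>u n\<bar> \<le> C * (1 + \<bar>real_of_int n\<bar>)\<^sup>2"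
    and g: "0 < g" and D: "1 \<le> D"
    and good: "\<forall>\<^sub>F k in sequentially.
      (\<exists>t. 1 \<le> t \<and> t \<le> int (R * k) \<and> good_block x t (D * k) (3 * g)) \<and>
      (\<exists>s. - int (R * k) \<le> s \<and> s \<le> - 1 \<and> good_block x s (D * k) (3 * g))"
    and res: "\<forall>\<^sub>F k in sequentially. approx_sol x (int (R * k)) (exp (- g * real (D * k))) \<longrightarrow>
      (\<forall>b. int (R' * k) \<le> \<bar>b\<bar> \<and> \<bar>b\<bar> \<le> int (k ^ 3) \<longrightarrow> good_block x b k (3 * g))"
  shows "\<exists>C>0. \<exists>\<gamma>>0. \<forall>n. \<bar>u n\<bar> \<le> C * exp (- \<gamma> * real_of_int \<bar>n\<bar>)"
proof (cases "svec u 0 = 0")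
  case True
  then show ?thesis using sol_eq_0[OF u True] by (intro exI[of _ "1::real"] conjI) auto
next
  case False
  define m where "m = norm (svec u 0)"
  have m: "0 < m" using False by (simp add: m_def)
  have C: "0 \<le> C" using growth[of 0] by simp
  note gr = norm_svec_growth[of u C, OF growth]
  let ?P = "\<lambda>k. 4 * C * (2 + (real R + real D) * real k)\<^sup>2"
  \<comment> \<open>Of the rate \<open>3 * g\<close>, two parts beat the quadratic growth and the
    normalization \<open>m\<close>; the third remains as truncation error.\<close>
  have "((\<lambda>k. exp (- (2 * g * real D) * real k) * ?P k) \<longlongrightarrow> 0) sequentially"
  proof -
    have pos: "2 * g * real D > 0" "real R + real D > 0" using g D by auto
    have "((\<lambda>k. exp (- d * real k) * (4 * C * (2 + r * real k)\<^sup>2)) \<longlongrightarrow> 0) sequentially" if "d > 0" "r > 0" for d r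
      using that by real_asymp
    from this[OF pos] show ?thesis .
  qed
  then have small: "\<forall>\<^sub>F k in sequentially. exp (- (2 * g * real D) * real k) * ?P k < m"
    using m by (rule order_tendstoD)
  have approx: "\<forall>\<^sub>F k in sequentially. approx_sol x (int (R * k)) (exp (- g * real (D * k)))"
    using good small
  proof eventually_elim
    case (elim k)
    have le: "norm (svec u b) \<le> exp (- g * real (D * k)) * norm (svec u 0)"
      if b: "\<bar>b\<bar> \<le> int (R * k)" and gd: "good_block x b (D * k) (3 * g)" for b
    proof -
      have half: "norm (svec u b') \<le> ?P k / 2" if "\<bar>b'\<bar> \<le> int (R * k) + int (D * k)" for b'
      proof -
        have "\<bar>real_of_int b'\<bar> \<le> (real R + real D) * real k"
          using that by (simp add: algebra_simps flip: of_int_abs of_nat_mult)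
        then have "2 * C * (2 + \<bar>real_of_int b'\<bar>)\<^sup>2 \<le> 2 * C * (2 + (real R + real D) * real k)\<^sup>2"
          using C by (intro mult_left_mono power_mono) auto
        then show ?thesis using gr[of b'] by simp
      qed
      have "norm (svec u b) \<le> exp (- (3 * g) * real (D * k)) *
          (norm (svec u (b - int (D * k))) + norm (svec u (b + int (D * k))))"
        by (rule good_block_norm_svec[OF u gd])
      also have "\<dots> \<le> exp (- (3 * g) * real (D * k)) * (?P k / 2 + ?P k / 2)"
        using b by (intro mult_left_mono add_mono half) (auto simp del: of_nat_mult)
      also have "\<dots> = exp (- g * real (D * k)) * (exp (- (2 * g * real D) * real k) * ?P k)"
        by (simp add: algebra_simps flip: exp_add)
      also have "\<dots> \<le> exp (- g * real (D * k)) * m"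
        using elim(2) by (intro mult_left_mono) auto
      finally show ?thesis by (simp add: m_def)
    qed
    from elim(1) obtain s t where st: "1 \<le> t" "t \<le> int (R * k)" "good_block x t (D * k) (3 * g)"
      "- int (R * k) \<le> s" "s \<le> - 1" "good_block x s (D * k) (3 * g)" by blast
    show ?case
      by (rule approx_sol_truncate[OF u, of _ s _ t]) (use st False le[of s] le[of t] in auto)
  qed
  have ev: "\<forall>\<^sub>F k in sequentially. \<forall>b. int (R' * k) \<le> \<bar>b\<bar> \<and> \<bar>b\<bar> \<le> int (k ^ 3) \<longrightarrow> good_block x b k (3 * g)"
    using approx res by eventually_elim blast
  have "\<forall>\<^sub>F k in sequentially. exp (- (g / 2) * (real k)\<^sup>2) * (2 * C * (3 * (real k)\<^sup>2 + 2 * real k + 2)\<^sup>2) < 1"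
  proof (rule order_tendstoD)
    show "((\<lambda>k. exp (- (g / 2) * (real k)\<^sup>2) * (2 * C * (3 * (real k)\<^sup>2 + 2 * real k + 2)\<^sup>2)) \<longlongrightarrow> 0) sequentially"
      using g by real_asymp
  qed simp
  moreover have "\<forall>\<^sub>F k in sequentially. ln 2 \<le> g * real k"
    using g by real_asymp
  ultimately have "\<forall>\<^sub>F k in sequentially. (\<forall>b. int (R' * k) \<le> \<bar>b\<bar> \<and> \<bar>b\<bar> \<le> int (k ^ 3) \<longrightarrow> good_block x b k (3 * g))
     \<and> exp (- (g / 2) * (real k)\<^sup>2) * (2 * C * (3 * (real k)\<^sup>2 + 2 * real k + 2)\<^sup>2) < 1 \<and>
       ln 2 \<le> g * real k \<and> 2 * R' \<le> k \<and> 4 \<le> k"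
    using ev eventually_ge_at_top[of "2 * R'"] eventually_ge_at_top[of 4] by eventually_elim auto
  then obtain k0 where k0: "\<And>k. k0 \<le> k \<Longrightarrow> (\<forall>b. int (R' * k) \<le> \<bar>b\<bar> \<and> \<bar>b\<bar> \<le> int (k ^ 3) \<longrightarrow> good_block x b k (3 * g))
     \<and> exp (- (g / 2) * (real k)\<^sup>2) * (2 * C * (3 * (real k)\<^sup>2 + 2 * real k + 2)\<^sup>2) < 1 \<and>
       ln 2 \<le> g * real k \<and> 2 * R' \<le> k \<and> 4 \<le> k"
    unfolding eventually_sequentially by blast
  have bound: "\<bar>u n\<bar> \<le> 1 * exp (- (g / 6) * real_of_int \<bar>n\<bar>)" if n: "int (k0\<^sup>2) \<le> \<bar>n\<bar>" for n
  proof -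
    \<comment> \<open>Now \<open>\<bar>n\<bar>\<close> lies between \<open>k\<^sup>2\<close> and
      \<open>k\<^sup>2 + 2 * k\<close>, and \<open>J * k\<close> is at most half of
      \<open>k\<^sup>2\<close>. The sites visited thus stay beyond \<open>R' * k\<close> and within
      \<open>k ^ 3\<close>.\<close>
    define k where "k = nat \<lfloor>sqrt \<bar>real_of_int n\<bar>\<rfloor>"
    define J where "J = k div 2"
    have k_le: "real k \<le> sqrt \<bar>real_of_int n\<bar>" and k_gt: "sqrt \<bar>real_of_int n\<bar> < real k + 1"
      unfolding k_def by (simp_all add: of_nat_nat)
    have "(real k)\<^sup>2 \<le> \<bar>real_of_int n\<bar>"
      using power_mono[OF k_le, of 2] by simp
    then have kn: "int (k\<^sup>2) \<le> \<bar>n\<bar>"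
      by (metis of_int_abs of_int_le_iff of_int_of_nat_eq of_nat_power)
    have "\<bar>real_of_int n\<bar> < (real k + 1)\<^sup>2"
      using power_strict_mono[OF k_gt, of 2] by simp
    then have "real_of_int \<bar>n\<bar> < real_of_int (int ((k + 1)\<^sup>2))" by (simp add: add.commute)
    then have "\<bar>n\<bar> < int ((k + 1)\<^sup>2)" unfolding of_int_less_iff .
    then have nk: "\<bar>n\<bar> \<le> int (k\<^sup>2) + 2 * int k" by (simp add: power2_eq_square algebra_simps)
    have "k0 \<le> k"
    proof (rule ccontr)
      assume "\<not> k0 \<le> k"
      then have "(k + 1)\<^sup>2 \<le> k0\<^sup>2" by (intro power_mono) auto
      with \<open>\<bar>n\<bar> < int ((k + 1)\<^sup>2)\<close> n show False by linarith
    qed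
    from k0[OF this] have gd: "\<And>b. int (R' * k) \<le> \<bar>b\<bar> \<Longrightarrow> \<bar>b\<bar> \<le> int (k ^ 3) \<Longrightarrow> good_block x b k (3 * g)"
      and sm: "exp (- (g / 2) * (real k)\<^sup>2) * (2 * C * (3 * (real k)\<^sup>2 + 2 * real k + 2)\<^sup>2) < 1"
      and l2: "ln 2 \<le> g * real k" and R'k: "2 * R' \<le> k" and k4: "4 \<le> k" by blast+
    let ?W = "2 * C * (3 * (real k)\<^sup>2 + 2 * real k + 2)\<^sup>2"
    have Jk: "2 * (J * k) \<le> k\<^sup>2" unfolding J_def power2_eq_square
      by (metis div_times_less_eq_dividend mult.assoc mult.commute mult_le_mono1)
    have rng: "int (R' * k) \<le> \<bar>b\<bar> \<and> \<bar>b\<bar> \<le> int (k ^ 3) \<and> \<bar>b\<bar> \<le> 3 * int (k\<^sup>2) + 2 * int k"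
      if b: "\<bar>b - n\<bar> \<le> int (J * k)" for b
    proof -
      have "2 * R' * k \<le> k * k" using R'k by (rule mult_le_mono1)
      then have 1: "2 * int (R' * k) \<le> int (k\<^sup>2)"
        by (metis mult.assoc of_nat_le_iff of_nat_mult of_nat_numeral power2_eq_square)
      have 2: "2 * int (J * k) \<le> int (k\<^sup>2)" using Jk by linarith
      have "4 * k\<^sup>2 \<le> k ^ 3" using mult_le_mono1[OF k4, of "k\<^sup>2"] by (simp add: power2_eq_square power3_eq_cube)
      then have 3: "4 * int (k\<^sup>2) \<le> int (k ^ 3)" by linarith
      have "4 * k \<le> k\<^sup>2" using mult_le_mono1[OF k4, of k] by (simp add: power2_eq_square)
      then have 4: "4 * int k \<le> int (k\<^sup>2)" by linarith
      show ?thesis using b kn nk 1 2 3 4 by linarith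
    qed
    have "norm (svec u n) \<le> (2 * exp (- (3 * g) * real k)) ^ J * ?W"
    proof (rule norm_svec_iterate[OF u, where m = n and J = J and j = J])
      fix b assume b: "\<bar>b - n\<bar> \<le> int (J * k)"
      show "good_block x b k (3 * g)" using rng[OF b] gd by blast
      have "\<bar>b\<bar> \<le> 3 * int (k\<^sup>2) + 2 * int k" using rng[OF b] by blast
      then have "real_of_int \<bar>b\<bar> \<le> real_of_int (3 * int (k\<^sup>2) + 2 * int k)" unfolding of_int_le_iff .
      then have "2 + \<bar>real_of_int b\<bar> \<le> 3 * (real k)\<^sup>2 + 2 * real k + 2" by simp
      then have "2 * C * (2 + \<bar>real_of_int b\<bar>)\<^sup>2 \<le> ?W" using C by (intro mult_left_mono power_mono) auto
      then show "norm (svec u b) \<le> ?W" using gr[of b] by linarith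
    qed auto
    also have "\<dots> \<le> exp (- (2 * g) * real k) ^ J * ?W"
    proof (intro mult_right_mono power_mono)
      have "2 \<le> exp (g * real k)" using l2 by (metis exp_le_cancel_iff exp_ln zero_less_numeral)
      then have "2 * exp (- (3 * g) * real k) \<le> exp (g * real k) * exp (- (3 * g) * real k)"
        by (intro mult_right_mono) auto
      also have "\<dots> = exp (- (2 * g) * real k)" by (simp add: algebra_simps flip: exp_add)
      finally show "2 * exp (- (3 * g) * real k) \<le> exp (- (2 * g) * real k)" .
    qed (use C in auto)
    also have "\<dots> = exp (- (2 * g) * (real J * real k)) * ?W"
      by (simp add: mult_ac flip: exp_of_nat_mult)
    \<comment> \<open>For \<open>k \<ge> 4\<close>, \<open>J * k\<close> is at least three eighths
      of \<open>k\<^sup>2\<close>, which gives the exponent \<open>3 * g / 4\<close>. The part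
      \<open>g / 2\<close> absorbs \<open>?W\<close>; the part \<open>g / 4\<close> becomes the rate
      \<open>g / 6\<close> because \<open>2 * \<bar>n\<bar> \<le> 3 * k\<^sup>2\<close>.\<close>
    also have "\<dots> \<le> exp (- (g / 4) * (real k)\<^sup>2 - (g / 2) * (real k)\<^sup>2) * ?W"
    proof -
      have "k \<le> 2 * J + 1" by (simp add: J_def)
      then have "real k * real k \<le> (2 * real J + 1) * real k" by (intro mult_right_mono) auto
      moreover have "4 * real k \<le> real k * real k" using k4 by (intro mult_right_mono) auto
      ultimately have "3 * (real k)\<^sup>2 \<le> 8 * (real J * real k)"
        by (simp add: power2_eq_square algebra_simps)
      then have "g * (3 * (real k)\<^sup>2) \<le> g * (8 * (real J * real k))" using g by (intro mult_left_mono) auto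
      then have "- (2 * g) * (real J * real k) \<le> - (g / 4) * (real k)\<^sup>2 - (g / 2) * (real k)\<^sup>2"
        by (simp add: algebra_simps)
      then show ?thesis using C by (intro mult_right_mono) auto
    qed
    also have "\<dots> = exp (- (g / 4) * (real k)\<^sup>2) * (exp (- (g / 2) * (real k)\<^sup>2) * ?W)"
      by (simp only: diff_conv_add_uminus exp_add mult_minus_left mult.assoc)
    also have "\<dots> \<le> exp (- (g / 4) * (real k)\<^sup>2) * 1" using sm by (intro mult_left_mono) auto
    also have "\<dots> \<le> exp (- (g / 6) * real_of_int \<bar>n\<bar>)"
    proof -
      have "real_of_int \<bar>n\<bar> \<le> real_of_int (int (k\<^sup>2) + 2 * int k)" using nk unfolding of_int_le_iff .
      moreover have "4 * real k \<le> real k * real k" using k4 by (intro mult_right_mono) auto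
      ultimately have "2 * real_of_int \<bar>n\<bar> \<le> 3 * (real k)\<^sup>2" by (simp add: power2_eq_square)
      then have "g * (2 * real_of_int \<bar>n\<bar>) \<le> g * (3 * (real k)\<^sup>2)" using g by (intro mult_left_mono) auto
      then show ?thesis by simp
    qed
    finally show ?thesis using norm_svec_ge(1)[of u n] by simp
  qed
  from exp_decay_from_eventually[OF bound] g show ?thesis
    by (meson divide_pos_pos zero_less_numeral)
qed

section \<open>Nets for approximate eigenvalues\<close>

lemma sum_squares_le_near_orthonormal:
  fixes u :: "'a \<Rightarrow> 'b \<Rightarrow> real"
  assumes L: "finite L" and F: "finite F" and k: "k \<in> L"
    and norm1: "\<And>i. i \<in> F \<Longrightarrow> (\<Sum>n\<in>L. (u i n)\<^sup>2) \<le> 1"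
    and off: "\<And>i j. i \<in> F \<Longrightarrow> j \<in> F \<Longrightarrow> i \<noteq> j \<Longrightarrow> \<bar>\<Sum>n\<in>L. u i n * u j n\<bar> \<le> \<epsilon>"
    and eps: "0 \<le> \<epsilon>" "real (card F) * \<epsilon> \<le> 1 / 2"
  shows "(\<Sum>i\<in>F. (u i k)\<^sup>2) \<le> 2"
proof -
  define c where "c = (\<lambda>i. u i k)"
  define s where "s = (\<Sum>i\<in>F. (c i)\<^sup>2)"
  define y where "y = (\<lambda>n. \<Sum>i\<in>F. c i * u i n)"
  define G where "G = (\<lambda>i j. \<Sum>n\<in>L. u i n * u j n)"
  have yk: "y k = s" by (simp add: y_def s_def c_def power2_eq_square)
  have "(\<Sum>n\<in>L. (y n)\<^sup>2) = (\<Sum>n\<in>L. \<Sum>i\<in>F. \<Sum>j\<in>F. c i * u i n * (c j * u j n))"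
    by (simp add: y_def power2_eq_square sum_product)
  also have "\<dots> = (\<Sum>i\<in>F. \<Sum>j\<in>F. \<Sum>n\<in>L. c i * u i n * (c j * u j n))"
    by (subst sum.swap) (rule sum.cong[OF refl], rule sum.swap)
  also have "\<dots> = (\<Sum>i\<in>F. \<Sum>j\<in>F. c i * c j * G i j)"
    by (simp add: G_def sum_distrib_left mult_ac)
  also have "\<dots> \<le> (\<Sum>i\<in>F. \<Sum>j\<in>F. (if i = j then (c i)\<^sup>2 else 0) + \<epsilon> * ((c i)\<^sup>2 + (c j)\<^sup>2) / 2)"
  proof (intro sum_mono)
    fix i j assume ij: "i \<in> F" "j \<in> F"
    show "c i * c j * G i j \<le> (if i = j then (c i)\<^sup>2 else 0) + \<epsilon> * ((c i)\<^sup>2 + (c j)\<^sup>2) / 2"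
    proof (cases "i = j")
      case True
      then have "G i j \<le> 1" using norm1[OF ij(1)] by (simp add: G_def power2_eq_square)
      then have "(c i)\<^sup>2 * G i j \<le> (c i)\<^sup>2 * 1" by (intro mult_left_mono) auto
      moreover have "0 \<le> \<epsilon> * ((c i)\<^sup>2 + (c i)\<^sup>2) / 2" using eps(1) by simp
      ultimately show ?thesis using True by (simp add: power2_eq_square)
    next
      case False
      have "c i * c j * G i j \<le> \<bar>c i * c j\<bar> * \<bar>G i j\<bar>" by (metis abs_ge_self abs_mult)
      also have "\<dots> \<le> ((c i)\<^sup>2 + (c j)\<^sup>2) / 2 * \<epsilon>"
      proof (intro mult_mono)
        have "0 \<le> (\<bar>c i\<bar> - \<bar>c j\<bar>)\<^sup>2" by simp
        then show "\<bar>c i * c j\<bar> \<le> ((c i)\<^sup>2 + (c j)\<^sup>2) / 2"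
          by (simp add: power2_diff abs_mult)
      qed (use off[OF ij False] in \<open>auto simp: G_def\<close>)
      finally show ?thesis using False by (simp add: mult.commute)
    qed
  qed
  also have "\<dots> = s + \<epsilon> * (real (card F) * s)"
  proof -
    have "(\<Sum>i\<in>F. \<Sum>j\<in>F. ((c i)\<^sup>2 + (c j)\<^sup>2)) = 2 * (real (card F) * s)"
      by (simp add: sum.distrib s_def sum_distrib_left)
    then have "\<epsilon> / 2 * (\<Sum>i\<in>F. \<Sum>j\<in>F. ((c i)\<^sup>2 + (c j)\<^sup>2)) = \<epsilon> / 2 * (2 * (real (card F) * s))"
      by (rule arg_cong)
    then have "(\<Sum>i\<in>F. \<Sum>j\<in>F. \<epsilon> * ((c i)\<^sup>2 + (c j)\<^sup>2) / 2) = \<epsilon> / 2 * (2 * (real (card F) * s))"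
      unfolding sum_distrib_left by simp
    then show ?thesis using F by (simp add: sum.distrib s_def)
  qed
  also have "\<dots> \<le> s + s / 2"
  proof -
    have "0 \<le> s" by (auto simp: s_def intro: sum_nonneg)
    from mult_right_mono[OF eps(2) this] show ?thesis by (simp add: mult_ac)
  qed
  finally have y2: "(\<Sum>n\<in>L. (y n)\<^sup>2) \<le> 3 / 2 * s" by simp
  have "s\<^sup>2 \<le> (\<Sum>n\<in>L. (y n)\<^sup>2)"
    using member_le_sum[of k L "\<lambda>n. (y n)\<^sup>2"] k L yk by simp
  with y2 have "s * s \<le> 3 / 2 * s" by (simp add: power2_eq_square)
  then have "s \<le> 2"
  proof (cases "s \<le> 0")
    case False
    with \<open>s * s \<le> 3 / 2 * s\<close> have "s \<le> 3 / 2" by (simp only: mult_le_cancel_right)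
    then show ?thesis by simp
  qed simp
  then show ?thesis by (simp add: s_def c_def)
qed

text \<open>Sum Bessel's inequality over all coordinates: one side counts \<open>F\<close>, the
  other counts every site of \<open>L\<close> twice.\<close>

lemma card_near_orthonormal_le:
  fixes u :: "'a \<Rightarrow> 'b \<Rightarrow> real"
  assumes L: "finite L" and F: "finite F"
    and norm1: "\<And>i. i \<in> F \<Longrightarrow> (\<Sum>n\<in>L. (u i n)\<^sup>2) = 1"
    and off: "\<And>i j. i \<in> F \<Longrightarrow> j \<in> F \<Longrightarrow> i \<noteq> j \<Longrightarrow> \<bar>\<Sum>n\<in>L. u i n * u j n\<bar> \<le> \<epsilon>"
    and eps: "0 \<le> \<epsilon>" "real (card F) * \<epsilon> \<le> 1 / 2"
  shows "card F \<le> 2 * card L"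
proof -
  have "real (card F) = (\<Sum>i\<in>F. \<Sum>n\<in>L. (u i n)\<^sup>2)" using norm1 by simp
  also have "\<dots> = (\<Sum>n\<in>L. \<Sum>i\<in>F. (u i n)\<^sup>2)" by (rule sum.swap)
  also have "\<dots> \<le> (\<Sum>n\<in>L. 2)"
    by (intro sum_mono sum_squares_le_near_orthonormal[OF L F _ eq_refl[OF norm1] off eps]) auto
  also have "\<dots> = real (2 * card L)" by simp
  finally show ?thesis by (simp only: of_nat_le_iff)
qed

text \<open>A separated subset of maximal cardinality is a net; the bound \<open>m\<close> makes the
  maximum exist.\<close>

lemma finite_net_of_separated_bound:
  fixes S :: "real set"
  assumes "0 < s" and sep: "\<And>F. finite F \<Longrightarrow> F \<subseteq> S \<Longrightarrow> (\<And>x y. x \<in> F \<Longrightarrow> y \<in> F \<Longrightarrow> x \<noteq> y \<Longrightarrow> s \<le> \<bar>x - y\<bar>) \<Longrightarrow> card F \<le> m"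
  shows "\<exists>F\<subseteq>S. finite F \<and> card F \<le> m \<and> (\<forall>x\<in>S. \<exists>y\<in>F. \<bar>x - y\<bar> \<le> s)"
proof -
  define \<F> where "\<F> = {F. finite F \<and> F \<subseteq> S \<and> (\<forall>x\<in>F. \<forall>y\<in>F. x \<noteq> y \<longrightarrow> s \<le> \<bar>x - y\<bar>)}"
  have le: "card F \<le> m" if "F \<in> \<F>" for F using that sep[of F] by (auto simp: \<F>_def)
  have "{} \<in> \<F>" by (simp add: \<F>_def)
  moreover have "\<forall>F. F \<in> \<F> \<longrightarrow> card F < Suc m" using le by (auto simp: less_Suc_eq_le)
  ultimately have "\<exists>F. F \<in> \<F> \<and> (\<forall>F'. F' \<in> \<F> \<longrightarrow> card F' \<le> card F)"
    by (rule ex_has_greatest_nat)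
  then obtain F where F: "F \<in> \<F>" "\<And>F'. F' \<in> \<F> \<Longrightarrow> card F' \<le> card F"
    by blast
  have "\<exists>y\<in>F. \<bar>x - y\<bar> \<le> s" if "x \<in> S" for x
  proof (rule ccontr)
    assume "\<not> ?thesis"
    then have no: "\<And>y. y \<in> F \<Longrightarrow> s < \<bar>x - y\<bar>" by force
    then have "x \<notin> F" using \<open>0 < s\<close> by force
    moreover have "insert x F \<in> \<F>"
    proof -
      have "s \<le> \<bar>y - x\<bar>" "s \<le> \<bar>x - y\<bar>" if "y \<in> F" for y
        using no[OF that] by linarith+
      then show ?thesis using F(1) \<open>x \<in> S\<close> unfolding \<F>_def by blast
    qed
    moreover have "finite F" using F(1) by (simp add: \<F>_def)
    ultimately show False using F(2)[of "insert x F"] by simp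
  qed
  moreover have "F \<subseteq> S" "finite F" using F(1) by (simp_all add: \<F>_def)
  ultimately show ?thesis using le[OF F(1)] by blast
qed

lemma card_separated_interval:
  fixes F :: "real set"
  assumes "finite F" "0 < s" "0 \<le> B" "\<And>x. x \<in> F \<Longrightarrow> \<bar>x\<bar> \<le> B"
    and sep: "\<And>x y. x \<in> F \<Longrightarrow> y \<in> F \<Longrightarrow> x \<noteq> y \<Longrightarrow> s \<le> \<bar>x - y\<bar>"
  shows "real (card F) \<le> 2 * B / s + 2"
proof -
  let ?h = "\<lambda>x. nat \<lfloor>(x + B) / s\<rfloor>"
  have nn: "0 \<le> (x + B) / s" if "x \<in> F" for x using assms(2) assms(4)[OF that] by auto
  have "inj_on ?h F"
  proof (rule inj_onI, rule ccontr)
    fix x y assume xy: "x \<in> F" "y \<in> F" "?h x = ?h y" "x \<noteq> y"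
    then have "\<lfloor>(x + B) / s\<rfloor> = \<lfloor>(y + B) / s\<rfloor>" using nn[of x] nn[of y]
      by (simp add: eq_nat_nat_iff)
    then have "\<bar>(x + B) / s - (y + B) / s\<bar> < 1" by linarith
    moreover have "(x + B) / s - (y + B) / s = (x - y) / s" by (simp add: diff_divide_distrib add_divide_distrib)
    ultimately have "\<bar>x - y\<bar> < s" using assms(2) by (simp add: abs_divide)
    then show False using sep[of x y] xy by simp
  qed
  then have "card F = card (?h ` F)" by (simp add: card_image)
  also have "\<dots> \<le> card {..nat \<lfloor>2 * B / s\<rfloor>}"
  proof (rule card_mono)
    show "?h ` F \<subseteq> {..nat \<lfloor>2 * B / s\<rfloor>}"
      using assms(2,4) by (auto intro!: nat_mono floor_mono divide_right_mono simp: abs_le_iff)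
  qed simp
  finally have "real (card F) \<le> real (nat \<lfloor>2 * B / s\<rfloor>) + 1" by simp
  moreover have "real (nat \<lfloor>2 * B / s\<rfloor>) \<le> 2 * B / s" using assms by (simp add: of_nat_nat)
  ultimately show ?thesis by simp
qed

lemma sum_shift_swap:
  fixes u v :: "int \<Rightarrow> real"
  assumes "\<And>n. N < \<bar>n\<bar> \<Longrightarrow> u n = 0" "\<And>n. N < \<bar>n\<bar> \<Longrightarrow> v n = 0"
  shows "(\<Sum>n\<in>{-N..N}. u (n + 1) * v n) = (\<Sum>n\<in>{-N..N}. u n * v (n - 1))"
proof -
  have "(\<Sum>n\<in>{-N..N}. u (n + 1) * v n) = (\<Sum>n\<in>{-N+1..N+1}. u n * v (n - 1))"
    by (rule sum.reindex_bij_witness[of _ "\<lambda>n. n - 1" "\<lambda>n. n + 1"]) auto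
  also have "\<dots> = (\<Sum>n\<in>{-N..N+1}. u n * v (n - 1))"
    using assms(2) by (intro sum.mono_neutral_left) (auto simp: abs_if)
  also have "\<dots> = (\<Sum>n\<in>{-N..N}. u n * v (n - 1))"
    using assms(1) by (intro sum.mono_neutral_right) (auto simp: abs_if)
  finally show ?thesis .
qed

text \<open>Symmetry of the operator: when the two residuals are paired crosswise, the hopping terms
  cancel and only \<open>E - E'\<close> times the inner product survives. Entries of a unit vector
  are at most 1, so each pairing is bounded by \<eta> times the number of sites.\<close>

lemma approx_sol_almost_orthogonal:
  assumes u: "\<And>n. N < \<bar>n\<bar> \<Longrightarrow> u n = 0" "(\<Sum>n\<in>{-N..N}. (u n)\<^sup>2) = 1"
      "\<And>n. \<bar>u (n + 1) + u (n - 1) - (E - V n) * u n\<bar> \<le> \<eta>"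
    and v: "\<And>n. N < \<bar>n\<bar> \<Longrightarrow> v n = 0" "(\<Sum>n\<in>{-N..N}. (v n)\<^sup>2) = 1"
      "\<And>n. \<bar>v (n + 1) + v (n - 1) - (E' - V n) * v n\<bar> \<le> \<eta>"
    and N: "0 \<le> N"
  shows "\<bar>E - E'\<bar> * \<bar>\<Sum>n\<in>{-N..N}. u n * v n\<bar> \<le> 2 * \<eta> * real_of_int (2 * N + 1)"
proof -
  have bound: "\<bar>\<Sum>n\<in>{-N..N}. r n * z n\<bar> \<le> \<eta> * real_of_int (2 * N + 1)"
    if r: "\<And>n. \<bar>r n\<bar> \<le> \<eta>" and z: "(\<Sum>n\<in>{-N..N}. (z n)\<^sup>2) = 1" for r z :: "int \<Rightarrow> real"
  proof -
    have "\<bar>\<Sum>n\<in>{-N..N}. r n * z n\<bar> \<le> (\<Sum>n\<in>{-N..N}. \<bar>r n * z n\<bar>)" by (rule sum_abs)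
    also have "\<dots> \<le> (\<Sum>n\<in>{-N..N}. \<eta>)"
    proof (rule sum_mono)
      fix n assume "n \<in> {-N..N}"
      then have "(z n)\<^sup>2 \<le> 1" using member_le_sum[of n "{-N..N}" "\<lambda>n. (z n)\<^sup>2"] z by simp
      then have "\<bar>z n\<bar> \<le> 1" by (simp add: abs_square_le_1)
      then show "\<bar>r n * z n\<bar> \<le> \<eta>" using r[of n] mult_mono[of "\<bar>r n\<bar>" \<eta> "\<bar>z n\<bar>" 1]
        by (simp add: abs_mult)
    qed
    also have "\<dots> = \<eta> * real_of_int (2 * N + 1)" using N by (simp add: of_nat_nat)
    finally show ?thesis .
  qed
  let ?r = "\<lambda>n. u (n + 1) + u (n - 1) - (E - V n) * u n"
  let ?q = "\<lambda>n. v (n + 1) + v (n - 1) - (E' - V n) * v n"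
  have "(\<Sum>n\<in>{-N..N}. ?q n * u n) - (\<Sum>n\<in>{-N..N}. ?r n * v n)
     = (\<Sum>n\<in>{-N..N}. v (n + 1) * u n) - (\<Sum>n\<in>{-N..N}. v n * u (n - 1))
       - ((\<Sum>n\<in>{-N..N}. u (n + 1) * v n) - (\<Sum>n\<in>{-N..N}. u n * v (n - 1)))
       + (E - E') * (\<Sum>n\<in>{-N..N}. u n * v n)"
    unfolding sum_distrib_left sum_subtractf[symmetric] sum.distrib[symmetric]
    by (intro sum.cong refl) (simp add: algebra_simps)
  also have "\<dots> = (E - E') * (\<Sum>n\<in>{-N..N}. u n * v n)"
    using sum_shift_swap[of N u v, OF u(1) v(1)] sum_shift_swap[of N v u, OF v(1) u(1)] by simp
  finally have "\<bar>E - E'\<bar> * \<bar>\<Sum>n\<in>{-N..N}. u n * v n\<bar>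
      = \<bar>(\<Sum>n\<in>{-N..N}. ?q n * u n) - (\<Sum>n\<in>{-N..N}. ?r n * v n)\<bar>"
    by (simp add: abs_mult)
  then show ?thesis
    using bound[of ?r v, OF u(3) v(2)] bound[of ?q u, OF v(3) u(2)] by linarith
qed

text \<open>Normalized quasimodes at separated energies are nearly orthogonal, and
  \<open>2 * N + 1\<close> sites leave room for at most twice as many such vectors.\<close>

lemma approx_sol_net:
  fixes N :: nat
  assumes "0 < s" and s: "4 * \<eta> * (2 * real N + 1) * (4 * real N + 3) \<le> s"
  shows "\<exists>F\<subseteq>{E\<in>I. approx_sol (\<lambda>n. E - V n) (int N) \<eta>}. finite F \<and> card F \<le> 4 * N + 2 \<and>
    (\<forall>E\<in>I. approx_sol (\<lambda>n. E - V n) (int N) \<eta> \<longrightarrow> (\<exists>E'\<in>F. \<bar>E - E'\<bar> \<le> s))"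
proof -
  let ?S = "{E\<in>I. approx_sol (\<lambda>n. E - V n) (int N) \<eta>}"
  have "\<exists>F\<subseteq>?S. finite F \<and> card F \<le> 4 * N + 2 \<and> (\<forall>E\<in>?S. \<exists>E'\<in>F. \<bar>E - E'\<bar> \<le> s)"
  proof (rule finite_net_of_separated_bound[OF \<open>0 < s\<close>], rule ccontr)
    fix F0 assume F0: "finite F0" "F0 \<subseteq> ?S" "\<And>x y. x \<in> F0 \<Longrightarrow> y \<in> F0 \<Longrightarrow> x \<noteq> y \<Longrightarrow> s \<le> \<bar>x - y\<bar>"
      and "\<not> card F0 \<le> 4 * N + 2"
    \<comment> \<open>Selecting exactly \<open>4 * N + 3\<close> points fixes the cardinality that
      enters the near-orthogonality condition.\<close>
    then obtain F where F: "F \<subseteq> F0" "card F = 4 * N + 3" "finite F"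
      using obtain_subset_with_card_n[of "4 * N + 3" F0] by (metis Suc_le_eq not_le add_Suc_right numeral_3_eq_3 numeral_2_eq_2)
    let ?P = "\<lambda>E u. (\<forall>n. int N < \<bar>n\<bar> \<longrightarrow> u n = 0) \<and> (\<Sum>n\<in>{-int N..int N}. (u n)\<^sup>2) = 1 \<and>
          (\<forall>n. \<bar>u (n + 1) + u (n - 1) - (E - V n) * u n\<bar> \<le> \<eta>)"
    have "\<forall>E\<in>F. \<exists>u. ?P E u" using F(1) F0(2) unfolding approx_sol_def by blast
    then obtain U where U: "\<And>E. E \<in> F \<Longrightarrow> ?P E (U E)" by metis
    have "F \<noteq> {}" using F(2) by auto
    then obtain E0 where "E0 \<in> F" by blast
    then have "0 \<le> \<eta>" using U[of E0] by (meson abs_ge_zero order_trans)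
    let ?e = "2 * \<eta> * (2 * real N + 1) / s"
    have "card F \<le> 2 * card {-int N..int N}"
    proof (rule card_near_orthonormal_le[where u = U and \<epsilon> = ?e])
      fix E E' assume EE: "E \<in> F" "E' \<in> F" "E \<noteq> E'"
      let ?x = "\<bar>\<Sum>n\<in>{-int N..int N}. U E n * U E' n\<bar>"
      have "\<bar>E - E'\<bar> * ?x \<le> 2 * \<eta> * real_of_int (2 * int N + 1)"
        using U[OF EE(1)] U[OF EE(2)] by (intro approx_sol_almost_orthogonal[where V = V]) auto
      moreover have "s * ?x \<le> \<bar>E - E'\<bar> * ?x"
        using F0(3)[of E E'] EE F(1) by (intro mult_right_mono) auto
      ultimately have "s * ?x \<le> 2 * \<eta> * (2 * real N + 1)" by simp
      then show "?x \<le> ?e" using \<open>0 < s\<close> by (simp add: pos_le_divide_eq mult.commute)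
    next
      show "real (card F) * ?e \<le> 1 / 2" using s \<open>0 < s\<close> by (simp add: F(2) divide_le_eq algebra_simps)
    qed (use U F \<open>0 < s\<close> \<open>0 \<le> \<eta>\<close> in auto)
    then show False using F(2) by simp
  qed
  then show ?thesis by blast
qed

lemma approx_sol_perturb:
  assumes "approx_sol x N \<eta>" and d: "\<And>n. \<bar>n\<bar> \<le> N \<Longrightarrow> \<bar>x n - y n\<bar> \<le> \<delta>" and "0 \<le> \<delta>"
  shows "approx_sol y N (\<eta> + \<delta>)"
proof -
  obtain u where u: "\<And>n. N < \<bar>n\<bar> \<Longrightarrow> u n = 0" "(\<Sum>n\<in>{-N..N}. (u n)\<^sup>2) = 1"
    "\<And>n. \<bar>u (n + 1) + u (n - 1) - x n * u n\<bar> \<le> \<eta>"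
    using assms(1) unfolding approx_sol_def by blast
  have "\<bar>u (n + 1) + u (n - 1) - y n * u n\<bar> \<le> \<eta> + \<delta>" for n
  proof -
    have "\<bar>(x n - y n) * u n\<bar> \<le> \<delta>"
    proof (cases "\<bar>n\<bar> \<le> N")
      case True
      then have "(u n)\<^sup>2 \<le> 1" using member_le_sum[of n "{-N..N}" "\<lambda>n. (u n)\<^sup>2"] u(2) by (auto simp: abs_le_iff)
      then have "\<bar>u n\<bar> \<le> 1" by (simp add: abs_square_le_1)
      then show ?thesis using d[OF True] mult_mono[of "\<bar>x n - y n\<bar>" \<delta> "\<bar>u n\<bar>" 1]
        by (simp add: abs_mult)
    qed (use u(1) \<open>0 \<le> \<delta>\<close> in auto)
    moreover have "u (n + 1) + u (n - 1) - y n * u n = (u (n + 1) + u (n - 1) - x n * u n) + (x n - y n) * u n"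
      by (simp add: algebra_simps)
    ultimately show ?thesis using u(3)[of n] by linarith
  qed
  with u(1,2) show ?thesis unfolding approx_sol_def by blast
qed

section \<open>Square-summable sequences\<close>

lemma summable_on_real_comparison:
  fixes f g :: "'a \<Rightarrow> real"
  assumes "g summable_on A" "\<And>x. x \<in> A \<Longrightarrow> 0 \<le> f x" "\<And>x. x \<in> A \<Longrightarrow> f x \<le> g x"
  shows "f summable_on A"
  using summable_on_comparison_test[OF assms(1) assms(3) assms(2)] by blast

lemma l2_inner_summable:
  assumes "u \<in> l2" "v \<in> l2"
  shows "(\<lambda>n. cnj (u n) * v n) summable_on UNIV"
proof -
  have "(\<lambda>n. (cmod (u n))\<^sup>2 + (cmod (v n))\<^sup>2) summable_on UNIV"
    using assms by (intro summable_on_add) (auto simp: l2_def)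
  then have "(\<lambda>n. cmod (cnj (u n) * v n)) summable_on UNIV"
  proof (rule summable_on_real_comparison)
    fix n
    have "0 \<le> (cmod (u n) - cmod (v n))\<^sup>2" "0 \<le> cmod (u n) * cmod (v n)" by simp_all
    then have "cmod (u n) * cmod (v n) \<le> (cmod (u n))\<^sup>2 + (cmod (v n))\<^sup>2"
      unfolding power2_diff by linarith
    then show "cmod (cnj (u n) * v n) \<le> (cmod (u n))\<^sup>2 + (cmod (v n))\<^sup>2"
      by (simp add: norm_mult)
  qed simp
  then show ?thesis by (rule abs_summable_summable)
qed

lemma l2_scale: "u \<in> l2 \<Longrightarrow> (\<lambda>n. a * u n) \<in> l2"
  by (simp add: l2_def norm_mult power_mult_distrib summable_on_cmult_right)

lemma l2_add: assumes "u \<in> l2" "v \<in> l2" shows "(\<lambda>n. u n + v n) \<in> l2"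
  unfolding l2_def mem_Collect_eq
proof (rule summable_on_real_comparison)
  show "(\<lambda>n. 2 * (cmod (u n))\<^sup>2 + 2 * (cmod (v n))\<^sup>2) summable_on UNIV"
    using assms by (intro summable_on_add summable_on_cmult_right) (auto simp: l2_def)
  fix n
  have "(cmod (u n + v n))\<^sup>2 \<le> (cmod (u n) + cmod (v n))\<^sup>2"
    by (intro power_mono norm_triangle_ineq) simp
  moreover have "0 \<le> (cmod (u n) - cmod (v n))\<^sup>2" by simp
  ultimately show "(cmod (u n + v n))\<^sup>2 \<le> 2 * (cmod (u n))\<^sup>2 + 2 * (cmod (v n))\<^sup>2"
    unfolding power2_diff power2_sum by linarith
qed simp

lemma l2_lincomb: "u \<in> l2 \<Longrightarrow> v \<in> l2 \<Longrightarrow> (\<lambda>n. a * u n + b * v n) \<in> l2"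
  by (intro l2_add l2_scale)

lemma l2_shift:
  assumes "u \<in> l2" shows "(\<lambda>n. u (n + k)) \<in> l2"
proof -
  have "bij_betw (\<lambda>n::int. n + k) UNIV UNIV"
    by (rule bij_betw_byWitness[where f' = "\<lambda>n. n - k"]) auto
  from summable_on_reindex_bij_betw[OF this, of "\<lambda>n. (cmod (u n))\<^sup>2"] show ?thesis
    using assms by (simp add: l2_def)
qed

lemma l2_mult_bounded:
  assumes "u \<in> l2" "\<And>n. \<bar>V n\<bar> \<le> K"
  shows "(\<lambda>n. complex_of_real (V n) * u n) \<in> l2"
  unfolding l2_def mem_Collect_eq
proof (rule summable_on_real_comparison)
  show "(\<lambda>n. K\<^sup>2 * (cmod (u n))\<^sup>2) summable_on UNIV"
    using assms(1) by (intro summable_on_cmult_right) (auto simp: l2_def)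
  fix n
  have "\<bar>V n\<bar>\<^sup>2 \<le> K\<^sup>2" by (intro power_mono assms) simp
  then show "(cmod (complex_of_real (V n) * u n))\<^sup>2 \<le> K\<^sup>2 * (cmod (u n))\<^sup>2"
    by (simp add: norm_mult power_mult_distrib mult_right_mono)
qed simp

lemma l2_inner_add_right:
  assumes "u \<in> l2" "v \<in> l2" "w \<in> l2"
  shows "l2_inner u (\<lambda>n. a * v n + b * w n) = a * l2_inner u v + b * l2_inner u w"
proof -
  have "l2_inner u (\<lambda>n. a * v n + b * w n) = (\<Sum>\<^sub>\<infinity>n. a * (cnj (u n) * v n) + b * (cnj (u n) * w n))"
    by (simp add: l2_inner_def algebra_simps)
  also have "\<dots> = a * l2_inner u v + b * l2_inner u w"
    unfolding l2_inner_def using assms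
    by (subst infsum_add) (auto intro!: summable_on_cmult_right l2_inner_summable simp: infsum_cmult_right')
  finally show ?thesis .
qed

lemma l2_inner_cnj: "l2_inner u v = cnj (l2_inner v u)"
  by (simp add: l2_inner_def mult.commute flip: infsum_cnj)

lemma l2_inner_add_left:
  assumes "u \<in> l2" "v \<in> l2" "w \<in> l2"
  shows "l2_inner (\<lambda>n. a * v n + b * w n) u = cnj a * l2_inner v u + cnj b * l2_inner w u"
  using l2_inner_add_right[OF assms, of a b] l2_inner_cnj[of "\<lambda>n. a * v n + b * w n" u]
    l2_inner_cnj[of v u] l2_inner_cnj[of w u] by simp

lemma l2_inner_lincomb:
  assumes "u \<in> l2" "v \<in> l2" "u' \<in> l2" "v' \<in> l2"
  shows "l2_inner (\<lambda>n. a * u n + b * v n) (\<lambda>n. c * u' n + d * v' n) =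
    cnj a * (c * l2_inner u u' + d * l2_inner u v') + cnj b * (c * l2_inner v u' + d * l2_inner v v')"
  using assms by (simp add: l2_inner_add_left l2_inner_add_right l2_lincomb)

definition l2_delta :: "int \<Rightarrow> int \<Rightarrow> complex" where
  "l2_delta j n = (if n = j then 1 else 0)"

lemma l2_delta_in: "l2_delta j \<in> l2"
proof -
  have "(\<lambda>n. (cmod (l2_delta j n))\<^sup>2) summable_on {j}" by simp
  then show ?thesis unfolding l2_def mem_Collect_eq
    by (rule summable_on_cong_neutral[THEN iffD1, rotated -1]) (auto simp: l2_delta_def)
qed

lemma l2_inner_delta: "l2_inner (l2_delta j) v = v j"
proof -
  have "l2_inner (l2_delta j) v = (\<Sum>\<^sub>\<infinity>n\<in>{j}. v n)"
    unfolding l2_inner_def by (rule infsum_cong_neutral) (auto simp: l2_delta_def)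
  then show ?thesis by simp
qed

lemma l2_inner_self: "u \<in> l2 \<Longrightarrow> l2_inner u u = complex_of_real (\<Sum>\<^sub>\<infinity>n. (cmod (u n))\<^sup>2)"
  proof -
  assume "u \<in> l2"
  then have "((\<lambda>n. (cmod (u n))\<^sup>2) has_sum (\<Sum>\<^sub>\<infinity>n. (cmod (u n))\<^sup>2)) UNIV"
    by (simp add: l2_def)
  from has_sum_of_real[OF this, where ?'a = complex] show ?thesis
    unfolding l2_inner_def by (intro infsumI) (simp add: mult.commute flip: complex_norm_square)
qed

lemma l2_inner_self_nonneg: "u \<in> l2 \<Longrightarrow> 0 \<le> Re (l2_inner u u)"
  by (simp add: l2_inner_self infsum_nonneg)

lemma l2_inner_self_eq_0:
  assumes "u \<in> l2" "Re (l2_inner u u) = 0"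
  shows "u n = 0"
proof -
  have "(\<Sum>\<^sub>\<infinity>n. (cmod (u n))\<^sup>2) = 0" using assms by (simp add: l2_inner_self)
  then have "(cmod (u n))\<^sup>2 = 0"
    using assms(1) by (intro nonneg_infsum_le_0D[where A = UNIV]) (auto simp: l2_def)
  then show ?thesis by simp
qed

lemma l2_inner_shift: "l2_inner (\<lambda>n. u (n + k)) v = l2_inner u (\<lambda>n. v (n - k))"
proof -
  have "bij_betw (\<lambda>n::int. n + k) UNIV UNIV"
    by (rule bij_betw_byWitness[where f' = "\<lambda>n. n - k"]) auto
  from infsum_reindex_bij_betw[OF this, of "\<lambda>n. cnj (u n) * v (n - k)"] show ?thesis
    by (simp add: l2_inner_def)
qed

lemma schroedinger_operator_l2:
  assumes "u \<in> l2" "\<And>n. \<bar>V n\<bar> \<le> K"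
  shows "schroedinger_operator V u \<in> l2"
  unfolding schroedinger_operator_def
  using l2_shift[OF assms(1), of 1] l2_shift[OF assms(1), of "-1"] l2_mult_bounded[OF assms]
  by (intro l2_add) auto

lemma l2_inner_sum_right:
  assumes "u \<in> l2" "v \<in> l2" "w \<in> l2"
  shows "l2_inner u (\<lambda>n. v n + w n) = l2_inner u v + l2_inner u w"
  using l2_inner_add_right[OF assms, of 1 1] by simp

lemma schroedinger_operator_symmetric:
  assumes u: "u \<in> l2" and v: "v \<in> l2" and V: "\<And>n. \<bar>V n\<bar> \<le> K"
  shows "l2_inner u (schroedinger_operator V v) = l2_inner (schroedinger_operator V u) v"
proof -
  have *: "l2_inner u (schroedinger_operator V v) = l2_inner u (\<lambda>n. v (n + 1)) + l2_inner u (\<lambda>n. v (n - 1))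
      + l2_inner u (\<lambda>n. complex_of_real (V n) * v n)" if u: "u \<in> l2" and v: "v \<in> l2" for u v
    unfolding schroedinger_operator_def
    using l2_shift[OF v, of 1] l2_shift[OF v, of "-1"] l2_mult_bounded[OF v V] u
    by (simp add: l2_inner_sum_right l2_add)
  have "l2_inner (schroedinger_operator V u) v = cnj (l2_inner v (schroedinger_operator V u))"
    by (rule l2_inner_cnj)
  also have "\<dots> = l2_inner (\<lambda>n. u (n + 1)) v + l2_inner (\<lambda>n. u (n - 1)) v + l2_inner (\<lambda>n. complex_of_real (V n) * u n) v"
    unfolding *[OF v u] by (simp flip: l2_inner_cnj)
  also have "l2_inner (\<lambda>n. u (n + 1)) v = l2_inner u (\<lambda>n. v (n - 1))" by (rule l2_inner_shift)
  also have "l2_inner (\<lambda>n. u (n - 1)) v = l2_inner u (\<lambda>n. v (n + 1))" using l2_inner_shift[of u "-1" v] by simp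
  also have "l2_inner (\<lambda>n. complex_of_real (V n) * u n) v = l2_inner u (\<lambda>n. complex_of_real (V n) * v n)"
    by (simp add: l2_inner_def mult_ac)
  finally show ?thesis unfolding *[OF u v] by simp
qed

lemma summable_on_exp_int:
  assumes "0 < (\<gamma>::real)"
  shows "(\<lambda>n. exp (- \<gamma> * real_of_int \<bar>n\<bar>)) summable_on (UNIV :: int set)"
proof -
  have geo: "(\<lambda>k. exp (- \<gamma> * real k)) summable_on (UNIV :: nat set)"
  proof -
    have "summable (\<lambda>k. exp (- \<gamma>) ^ k)" using assms by (intro summable_geometric) simp
    then have "summable (\<lambda>k. exp (- \<gamma> * real k))" by (simp add: mult.commute flip: exp_of_nat_mult)
    then show ?thesis by (simp add: summable_on_UNIV_nonneg_real_iff)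
  qed
  have 1: "(\<lambda>n. exp (- \<gamma> * real_of_int \<bar>n\<bar>)) summable_on (range int)"
    by (subst summable_on_reindex) (use geo in \<open>auto simp: o_def\<close>)
  have 2: "(\<lambda>n. exp (- \<gamma> * real_of_int \<bar>n\<bar>)) summable_on (range (\<lambda>k. - int k))"
    by (subst summable_on_reindex) (use geo in \<open>auto simp: o_def inj_on_def\<close>)
  have 3: "(\<lambda>n. exp (- \<gamma> * real_of_int \<bar>n\<bar>)) summable_on (range (\<lambda>k. - int k) - range int)"
    by (rule summable_on_subset_banach[OF 2]) auto
  have "n \<in> range int \<union> (range (\<lambda>k. - int k) - range int)" for n :: int
    by (cases n rule: int_cases2) auto
  then have "UNIV = range int \<union> (range (\<lambda>k. - int k) - range int)" by blast
  then show ?thesis using summable_on_Un_disjoint[OF 1 3] by simp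
qed

lemma l2_of_exponential_decay:
  fixes u :: "int \<Rightarrow> real"
  assumes "0 < \<gamma>" "\<And>n. \<bar>u n\<bar> \<le> C * exp (- \<gamma> * real_of_int \<bar>n\<bar>)"
  shows "(\<lambda>n. complex_of_real (u n)) \<in> l2"
  unfolding l2_def mem_Collect_eq
proof (rule summable_on_real_comparison)
  show "(\<lambda>n. C\<^sup>2 * exp (- (2 * \<gamma>) * real_of_int \<bar>n\<bar>)) summable_on UNIV"
    using assms(1) by (intro summable_on_cmult_right summable_on_exp_int) simp
  fix n
  have "\<bar>u n\<bar>\<^sup>2 \<le> (C * exp (- \<gamma> * real_of_int \<bar>n\<bar>))\<^sup>2" by (intro power_mono assms) simp
  then show "(cmod (complex_of_real (u n)))\<^sup>2 \<le> C\<^sup>2 * exp (- (2 * \<gamma>) * real_of_int \<bar>n\<bar>)"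
    by (simp add: power_mult_distrib mult.assoc flip: exp_double)
qed simp

text \<open>Real solutions are used because the generalized eigenfunctions constructed later are
  real.\<close>

definition l2_eigenvalues :: "(int \<Rightarrow> real) \<Rightarrow> real set" where
  "l2_eigenvalues V = {E. \<exists>u. sol (\<lambda>n. E - V n) u \<and> (\<exists>n. u n \<noteq> 0) \<and> (\<lambda>n. complex_of_real (u n)) \<in> l2}"

lemma real_l2_has_sum:
  assumes "(\<lambda>n. complex_of_real (u n)) \<in> l2" "(\<lambda>n. complex_of_real (v n)) \<in> l2"
  shows "((\<lambda>n. u n * v n) has_sum Re (l2_inner (\<lambda>n. complex_of_real (u n)) (\<lambda>n. complex_of_real (v n)))) UNIV"
proof -
  have "((\<lambda>n. cnj (complex_of_real (u n)) * complex_of_real (v n)) has_sum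
      l2_inner (\<lambda>n. complex_of_real (u n)) (\<lambda>n. complex_of_real (v n))) UNIV"
    unfolding l2_inner_def by (intro has_sum_infsum l2_inner_summable assms)
  then show ?thesis by (drule_tac has_sum_Re) simp
qed

lemma l2_eigenvectors_orthogonal:
  assumes V: "\<And>n. \<bar>V n\<bar> \<le> K" and "E \<noteq> E'"
    and u: "sol (\<lambda>n. E - V n) u" "(\<lambda>n. complex_of_real (u n)) \<in> l2"
    and v: "sol (\<lambda>n. E' - V n) v" "(\<lambda>n. complex_of_real (v n)) \<in> l2"
  shows "((\<lambda>n. u n * v n) has_sum 0) UNIV"
proof -
  let ?u = "\<lambda>n. complex_of_real (u n)" and ?v = "\<lambda>n. complex_of_real (v n)"
  have H: "schroedinger_operator V (\<lambda>n. complex_of_real (w n)) = (\<lambda>n. complex_of_real e * complex_of_real (w n))"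
    if "sol (\<lambda>n. e - V n) w" for w e
  proof
    fix n
    have "w (n + 1) + w (n - 1) + V n * w n = e * w n"
      using that[unfolded sol_def, rule_format, of n] by (simp add: algebra_simps)
    then show "schroedinger_operator V (\<lambda>n. complex_of_real (w n)) n = complex_of_real e * complex_of_real (w n)"
      unfolding schroedinger_operator_def by (metis of_real_add of_real_mult)
  qed
  have "complex_of_real E' * l2_inner ?u ?v = l2_inner ?u (schroedinger_operator V ?v)"
    unfolding H[OF v(1)] using l2_inner_add_right[OF u(2) v(2) v(2), of E' 0] by simp
  also have "\<dots> = l2_inner (schroedinger_operator V ?u) ?v"
    by (rule schroedinger_operator_symmetric[OF u(2) v(2) V])
  also have "\<dots> = complex_of_real E * l2_inner ?u ?v"
    unfolding H[OF u(1)] using l2_inner_add_left[OF v(2) u(2) u(2), of E 0] by simp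
  finally have "l2_inner ?u ?v = 0" using \<open>E \<noteq> E'\<close> by auto
  then show ?thesis using real_l2_has_sum[OF u(2) v(2)] by simp
qed

text \<open>By Bessel's inequality only finitely many normalized eigenvectors exceed a given size at
  a given site, and each eigenvector exceeds some \<open>1 / (k + 1)\<close> at some site.\<close>

lemma countable_l2_eigenvalues:
  assumes V: "\<And>n. \<bar>V n\<bar> \<le> K"
  shows "countable (l2_eigenvalues V)"
proof -
  let ?S = "l2_eigenvalues V"
  have "\<exists>u. sol (\<lambda>n. E - V n) u \<and> (\<lambda>n. complex_of_real (u n)) \<in> l2 \<and> ((\<lambda>n. (u n)\<^sup>2) has_sum 1) UNIV"
    if ES: "E \<in> ?S" for E
  proof -
    obtain w n where w: "sol (\<lambda>n. E - V n) w" "w n \<noteq> 0" "(\<lambda>n. complex_of_real (w n)) \<in> l2"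
      using ES by (auto simp: l2_eigenvalues_def)
    let ?w = "\<lambda>n. complex_of_real (w n)"
    define c where "c = Re (l2_inner ?w ?w)"
    have "c \<noteq> 0" using l2_inner_self_eq_0[OF w(3), of n] w(2) by (auto simp: c_def)
    then have c: "0 < c" using l2_inner_self_nonneg[OF w(3)] by (simp add: c_def)
    let ?u = "\<lambda>n. 1 / sqrt c * w n"
    have "((\<lambda>n. 1 / c * (w n * w n)) has_sum 1 / c * c) UNIV"
      using real_l2_has_sum[OF w(3) w(3)] unfolding c_def[symmetric] by (rule has_sum_cmult_right)
    then have "((\<lambda>n. (?u n)\<^sup>2) has_sum 1) UNIV"
      using c by (simp add: power_mult_distrib power_divide power2_eq_square)
    moreover have "(\<lambda>n. complex_of_real (?u n)) \<in> l2"
      using l2_scale[OF w(3), of "complex_of_real (1 / sqrt c)"] by simp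
    moreover have "sol (\<lambda>n. E - V n) ?u"
      using w(1) by (simp add: sol_def mult.left_commute[of _ "1 / sqrt c"] flip: distrib_left add_divide_distrib)
    ultimately show ?thesis by blast
  qed
  then obtain U where U: "\<And>E. E \<in> ?S \<Longrightarrow> sol (\<lambda>n. E - V n) (U E)"
    "\<And>E. E \<in> ?S \<Longrightarrow> (\<lambda>n. complex_of_real (U E n)) \<in> l2"
    "\<And>E. E \<in> ?S \<Longrightarrow> ((\<lambda>n. (U E n)\<^sup>2) has_sum 1) UNIV" by metis
  have bessel: "(\<Sum>E\<in>F. (U E j)\<^sup>2) \<le> 2" if F: "finite F" "F \<subseteq> ?S" for F j
  proof -
    \<comment> \<open>Orthogonality concerns infinite sums. A finite set \<open>L\<close> is taken
      so large that the finitely many inner products over \<open>L\<close> fall below this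
      \<epsilon>, which Bessel's inequality tolerates.\<close>
    define \<epsilon> :: real where "\<epsilon> = 1 / (2 * (real (card F) + 1))"
    have \<epsilon>: "0 < \<epsilon>" "real (card F) * \<epsilon> \<le> 1 / 2" by (simp_all add: \<epsilon>_def field_simps)
    have "\<forall>\<^sub>F L in finite_subsets_at_top UNIV. \<forall>E\<in>F. \<forall>E'\<in>F. E \<noteq> E' \<longrightarrow> \<bar>\<Sum>n\<in>L. U E n * U E' n\<bar> \<le> \<epsilon>"
    proof (intro eventually_ball_finite F ballI)
      fix E E' assume EE: "E \<in> F" "E' \<in> F"
      show "\<forall>\<^sub>F L in finite_subsets_at_top UNIV. E \<noteq> E' \<longrightarrow> \<bar>\<Sum>n\<in>L. U E n * U E' n\<bar> \<le> \<epsilon>"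
      proof (cases "E = E'")
        case False
        have "((\<lambda>n. U E n * U E' n) has_sum 0) UNIV"
          using EE F(2) by (intro l2_eigenvectors_orthogonal[OF V False U(1) U(2) U(1) U(2)]) auto
        then have "((\<lambda>L. \<Sum>n\<in>L. U E n * U E' n) \<longlongrightarrow> 0) (finite_subsets_at_top UNIV)"
          by (simp add: has_sum_def)
        then have "\<forall>\<^sub>F L in finite_subsets_at_top UNIV. dist (\<Sum>n\<in>L. U E n * U E' n) 0 < \<epsilon>"
          using \<epsilon>(1) by (rule tendstoD)
        then show ?thesis by eventually_elim simp
      qed simp
    qed
    moreover have "\<forall>\<^sub>F L in finite_subsets_at_top UNIV. finite L \<and> {j} \<subseteq> L"
      by (rule eventually_finite_subsets_at_top_weakI[THEN eventually_conj])
        (auto simp: eventually_finite_subsets_at_top intro!: exI[of _ "{j}"])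
    ultimately have "\<forall>\<^sub>F L in finite_subsets_at_top UNIV. finite L \<and> j \<in> L \<and>
      (\<forall>E\<in>F. \<forall>E'\<in>F. E \<noteq> E' \<longrightarrow> \<bar>\<Sum>n\<in>L. U E n * U E' n\<bar> \<le> \<epsilon>)"
      by eventually_elim auto
    from eventually_happens'[OF finite_subsets_at_top_neq_bot this] obtain L where L: "finite L" "j \<in> L" "\<And>E E'. E \<in> F \<Longrightarrow> E' \<in> F \<Longrightarrow> E \<noteq> E' \<Longrightarrow> \<bar>\<Sum>n\<in>L. U E n * U E' n\<bar> \<le> \<epsilon>"
      by blast
    show ?thesis
    proof (rule sum_squares_le_near_orthonormal[OF L(1) F(1) L(2) _ L(3)])
      fix E assume "E \<in> F"
      then show "(\<Sum>n\<in>L. (U E n)\<^sup>2) \<le> 1"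
        using U(3)[of E] F(2) L(1)
        by (intro has_sum_mono_neutral[OF has_sum_finite[OF L(1)] U(3)]) auto
    qed (use \<epsilon> in auto)
  qed
  have fin: "finite {E\<in>?S. 1 / real (Suc k) < (U E j)\<^sup>2}" for k j
  proof (rule ccontr)
    assume "infinite {E\<in>?S. 1 / real (Suc k) < (U E j)\<^sup>2}"
    then obtain F where F: "finite F" "card F = 2 * Suc k" "F \<subseteq> {E\<in>?S. 1 / real (Suc k) < (U E j)\<^sup>2}"
      by (meson infinite_arbitrarily_large)
    have "F \<noteq> {}" using F(2) by auto
    then have "(\<Sum>E\<in>F. 1 / real (Suc k)) < (\<Sum>E\<in>F. (U E j)\<^sup>2)"
      using F by (intro sum_strict_mono) auto
    also have "\<dots> \<le> 2" using F by (intro bessel) auto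
    finally show False using F(2) by (simp add: field_simps)
  qed
  have "?S \<subseteq> (\<Union>j. \<Union>k. {E\<in>?S. 1 / real (Suc k) < (U E j)\<^sup>2})"
  proof
    fix E assume E: "E \<in> ?S"
    have "\<exists>j. U E j \<noteq> 0"
    proof (rule ccontr)
      assume "\<nexists>j. U E j \<noteq> 0"
      then have "((\<lambda>n::int. 0::real) has_sum 1) UNIV" using U(3)[OF E] by simp
      then show False using has_sum_unique has_sum_0 by (metis zero_neq_one)
    qed
    then obtain j where "U E j \<noteq> 0" ..
    then have "0 < (U E j)\<^sup>2" by simp
    then obtain k where "1 / real (Suc k) < (U E j)\<^sup>2" using nat_approx_posE by blast
    then show "E \<in> (\<Union>j. \<Union>k. {E\<in>?S. 1 / real (Suc k) < (U E j)\<^sup>2})" using E by blast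
  qed
  then show ?thesis
    by (rule countable_subset) (intro countable_UN countableI_type countable_finite[OF fin])
qed

section \<open>Spectral measures\<close>

locale schroedinger_resolution =
  fixes V :: "int \<Rightarrow> real" and K :: real and P :: "real set \<Rightarrow> seq_operator"
  assumes V: "\<And>n. \<bar>V n\<bar> \<le> K"
    and resolution: "spectral_resolution (schroedinger_operator V) P"
begin

abbreviation "H \<equiv> schroedinger_operator V"
abbreviation "\<nu> \<equiv> spectral_measure P"

definition qf :: "(int \<Rightarrow> complex) \<Rightarrow> real set \<Rightarrow> real" where
  "qf u B = Re (l2_inner u (P B u))"

lemma pvm: "projection_valued_measure P"
  using resolution by (simp add: spectral_resolution_def)

lemma P_l2: "B \<in> sets borel \<Longrightarrow> u \<in> l2 \<Longrightarrow> P B u \<in> l2"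
  using pvm by (simp add: projection_valued_measure_def orthogonal_projection_def)

lemma orthogonal_projection_P: "B \<in> sets borel \<Longrightarrow> orthogonal_projection (P B)"
  using pvm by (simp add: projection_valued_measure_def)

lemma P_linear: "B \<in> sets borel \<Longrightarrow> u \<in> l2 \<Longrightarrow> v \<in> l2 \<Longrightarrow>
    P B (\<lambda>n. a * u n + b * v n) = (\<lambda>n. a * P B u n + b * P B v n)"
  by (drule orthogonal_projection_P, unfold orthogonal_projection_def, elim conjE) blast

lemma P_symmetric: "B \<in> sets borel \<Longrightarrow> u \<in> l2 \<Longrightarrow> v \<in> l2 \<Longrightarrow> l2_inner (P B u) v = l2_inner u (P B v)"
  by (drule orthogonal_projection_P, unfold orthogonal_projection_def, elim conjE) blast

lemma P_Int: "A \<in> sets borel \<Longrightarrow> B \<in> sets borel \<Longrightarrow> u \<in> l2 \<Longrightarrow> P A (P B u) = P (A \<inter> B) u"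
  using pvm unfolding projection_valued_measure_def by simp

lemma P_UNIV: "u \<in> l2 \<Longrightarrow> P UNIV u = u"
  using pvm unfolding projection_valued_measure_def by simp

lemma P_sums:
  assumes "range B \<subseteq> sets borel" "disjoint_family B" "u \<in> l2" "v \<in> l2"
  shows "(\<lambda>i. l2_inner u (P (B i) v)) sums l2_inner u (P (\<Union>i::nat. B i) v)"
proof -
  have "\<forall>B :: nat \<Rightarrow> real set. range B \<subseteq> sets borel \<and> disjoint_family B \<longrightarrow>
      (\<forall>u\<in>l2. \<forall>v\<in>l2. (\<lambda>i. l2_inner u (P (B i) v)) sums l2_inner u (P (\<Union>i. B i) v))"
    using pvm unfolding projection_valued_measure_def by (elim conjE)
  from this[rule_format, OF conjI[OF assms(1,2)] assms(3,4)] show ?thesis .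
qed

text \<open>Additivity over a sequence of empty sets is a convergent series with constant
  terms.\<close>

lemma P_empty_inner: "u \<in> l2 \<Longrightarrow> v \<in> l2 \<Longrightarrow> l2_inner u (P {} v) = 0"
  using P_sums[of "\<lambda>_. {}" u v]
  by (auto simp: disjoint_family_on_def summable_const_iff dest!: sums_summable)

lemma P_Compl:
  assumes B: "B \<in> sets borel" and u: "u \<in> l2"
  shows "u n = P B u n + P (- B) u n"
proof -
  let ?B = "\<lambda>i::nat. if i = 0 then B else if i = 1 then - B else {}"
  have B': "- B \<in> sets borel" using borel_comp[OF B] .
  have "(\<lambda>i. l2_inner (l2_delta n) (P (?B i) u)) sums l2_inner (l2_delta n) (P (\<Union>i. ?B i) u)"
    by (rule P_sums) (use B B' u in \<open>auto simp: disjoint_family_on_def l2_delta_in\<close>)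
  moreover have "(\<lambda>i. l2_inner (l2_delta n) (P (?B i) u)) sums (\<Sum>i\<in>{0,1}. l2_inner (l2_delta n) (P (?B i) u))"
    by (rule sums_finite) (auto simp: P_empty_inner l2_delta_in u)
  moreover have "(\<Union>i. ?B i) = UNIV" by (auto split: if_splits)
  ultimately have "l2_inner (l2_delta n) (P UNIV u) = l2_inner (l2_delta n) (P B u) + l2_inner (l2_delta n) (P (- B) u)"
    by (auto dest: sums_unique2)
  then show ?thesis using u by (simp add: l2_inner_delta P_UNIV)
qed

lemma qf_eq_norm: "B \<in> sets borel \<Longrightarrow> u \<in> l2 \<Longrightarrow> qf u B = Re (l2_inner (P B u) (P B u))"
  by (simp add: qf_def P_symmetric P_l2 P_Int)

lemma qf_nonneg: "B \<in> sets borel \<Longrightarrow> u \<in> l2 \<Longrightarrow> 0 \<le> qf u B"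
  by (simp add: qf_eq_norm l2_inner_self_nonneg P_l2)

lemma qf_eq_0D: "qf u B = 0 \<Longrightarrow> B \<in> sets borel \<Longrightarrow> u \<in> l2 \<Longrightarrow> P B u n = 0"
  by (simp add: qf_eq_norm l2_inner_self_eq_0 P_l2)

section \<open>Scalar spectral measures\<close>

lemma sets_\<nu>: "sets (\<nu> u) = sets borel"
  by (simp add: spectral_measure_def)
     (metis sets.sigma_sets_eq space_borel)

lemma space_\<nu>: "space (\<nu> u) = UNIV"
  by (simp add: spectral_measure_def space_measure_of_conv)

lemma emeasure_\<nu>:
  assumes u: "u \<in> l2" and B: "B \<in> sets borel"
  shows "emeasure (\<nu> u) B = ennreal (qf u B)"
proof (rule emeasure_measure_of[where \<Omega> = UNIV and A = "sets borel"])
  show "\<nu> u = measure_of UNIV (sets borel) (\<lambda>B. ennreal (qf u B))"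
    by (simp add: spectral_measure_def qf_def)
  show "positive (sets (\<nu> u)) (\<lambda>B. ennreal (qf u B))"
    using P_empty_inner[OF u u] by (simp add: positive_def qf_def)
  show "countably_additive (sets (\<nu> u)) (\<lambda>B. ennreal (qf u B))"
  proof (rule countably_additiveI)
    fix A :: "nat \<Rightarrow> real set"
    assume A: "range A \<subseteq> sets (\<nu> u)" "disjoint_family A" "\<Union> (range A) \<in> sets (\<nu> u)"
    then have "(\<lambda>i. l2_inner u (P (A i) u)) sums l2_inner u (P (\<Union>i. A i) u)"
      by (intro P_sums u) (simp_all add: sets_\<nu>)
    then have "(\<lambda>i. qf u (A i)) sums qf u (\<Union>i. A i)"
      unfolding qf_def by (rule sums_Re)
    then show "(\<Sum>i. ennreal (qf u (A i))) = ennreal (qf u (\<Union> (range A)))"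
      using A u by (intro suminf_ennreal_eq qf_nonneg) (auto simp: sets_\<nu>)
  qed
  show "B \<in> sets (\<nu> u)" using B by (simp add: sets_\<nu>)
qed auto

lemma measure_\<nu>: "u \<in> l2 \<Longrightarrow> B \<in> sets borel \<Longrightarrow> measure (\<nu> u) B = qf u B"
  by (simp add: measure_def emeasure_\<nu> qf_nonneg)

lemma finite_measure_\<nu>: "u \<in> l2 \<Longrightarrow> finite_measure (\<nu> u)"
  by (rule finite_measureI) (simp add: space_\<nu> emeasure_\<nu>)

text \<open>Multiplicativity of \<open>P\<close> makes passing from \<open>u\<close> to
  \<open>P B u\<close> a restriction of the measure to \<open>B\<close>. Applied to such vectors,
  the resolution of \<open>H\<close> over the whole line yields integrals over
  \<open>B\<close>.\<close>

lemma \<nu>_P: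
  assumes u: "u \<in> l2" and B: "B \<in> sets borel"
  shows "\<nu> (P B u) = density (\<nu> u) (indicator B)"
proof (rule measure_eqI)
  fix A assume "A \<in> sets (\<nu> (P B u))"
  then have A: "A \<in> sets borel" by (simp add: sets_\<nu>)
  have "qf (P B u) A = qf u (A \<inter> B)"
    using A B u by (simp add: qf_def P_symmetric P_l2 P_Int sets.Int Int_assoc Int_left_commute)
  then have "emeasure (\<nu> (P B u)) A = emeasure (\<nu> u) (A \<inter> B)"
    using A B u by (simp add: emeasure_\<nu> P_l2)
  also have "\<dots> = emeasure (density (\<nu> u) (indicator B)) A"
  proof -
    have "emeasure (density (\<nu> u) (indicator B)) A = (\<integral>\<^sup>+x. indicator B x * indicator A x \<partial>\<nu> u)"
      using A B by (intro emeasure_density borel_measurable_indicator) (simp_all add: sets_\<nu>)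
    also have "\<dots> = (\<integral>\<^sup>+x. indicator (A \<inter> B) x \<partial>\<nu> u)"
      by (rule nn_integral_cong) (simp add: indicator_inter_arith mult.commute)
    also have "\<dots> = emeasure (\<nu> u) (A \<inter> B)"
      using A B by (intro nn_integral_indicator) (simp add: sets_\<nu>)
    finally show ?thesis ..
  qed
  finally show "emeasure (\<nu> (P B u)) A = emeasure (density (\<nu> u) (indicator B)) A" .
qed (simp add: sets_\<nu>)

lemma inner_H: "u \<in> l2 \<Longrightarrow> Re (l2_inner u (H u)) = (\<integral>x. x \<partial>\<nu> u)"
  using resolution by (simp add: spectral_resolution_def)

lemma integrable_\<nu>: "u \<in> l2 \<Longrightarrow> integrable (\<nu> u) (\<lambda>x. x)"
  using resolution by (simp add: spectral_resolution_def)

lemma inner_H_P: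
  assumes u: "u \<in> l2" and B: "B \<in> sets borel"
  shows "Re (l2_inner (P B u) (H (P B u))) = (\<integral>x. indicator B x * x \<partial>\<nu> u)"
proof -
  have "Re (l2_inner (P B u) (H (P B u))) = (\<integral>x. x \<partial>density (\<nu> u) (\<lambda>x. ennreal (indicator B x)))"
    using inner_H[OF P_l2[OF B u]] \<nu>_P[OF u B] by (simp add: ennreal_indicator)
  also have "\<dots> = (\<integral>x. indicator B x * x \<partial>\<nu> u)"
    using B by (subst integral_density) (auto simp: sets_\<nu> cong: measurable_cong_sets)
  finally show ?thesis .
qed

lemma H_l2: "u \<in> l2 \<Longrightarrow> H u \<in> l2"
  by (rule schroedinger_operator_l2[OF _ V])

lemma H_add: "H (\<lambda>n. a * u n + b * v n) = (\<lambda>n. a * H u n + b * H v n)"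
  by (simp add: schroedinger_operator_def fun_eq_iff algebra_simps)

text \<open>The trivial factor \<open>1\<close> keeps sums in the shape \<open>a u + b v\<close> of \<open>l2_inner_lincomb\<close> and \<open>P_linear\<close>.\<close>

lemma inner_H_lincomb:
  assumes "u \<in> l2" "v \<in> l2" and s: "s = 1 \<or> s = (-1 :: real)"
  defines "w \<equiv> \<lambda>n. 1 * u n + complex_of_real s * v n"
  shows "Re (l2_inner w (H w)) = Re (l2_inner u (H u)) + Re (l2_inner v (H v)) + 2 * s * Re (l2_inner u (H v))"
proof -
  have "l2_inner v (H u) = cnj (l2_inner u (H v))"
    using schroedinger_operator_symmetric[OF assms(2,1) V] l2_inner_cnj[of "H v" u] by simp
  then show ?thesis
    unfolding w_def H_add l2_inner_lincomb[OF assms(1,2) H_l2[OF assms(1)] H_l2[OF assms(2)]]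
    using s by auto
qed

text \<open>\<open>H\<close> does not couple the ranges of \<open>P B\<close> and
  \<open>P (- B)\<close>. Only diagonal forms are given, so the form of the sum \<open>w\<close> is
  computed twice: as an integral it splits over \<open>B\<close> and \<open>- B\<close>, whereas
  direct expansion adds twice the cross term.\<close>

lemma inner_H_P_orthogonal:
  assumes u: "u \<in> l2" and v: "v \<in> l2" and B: "B \<in> sets borel"
  shows "Re (l2_inner (P (- B) u) (H (P B v))) = 0"
proof -
  have B': "- B \<in> sets borel" using borel_comp[OF B] .
  let ?a = "P (- B) u" and ?b = "P B v"
  have ab: "?a \<in> l2" "?b \<in> l2" using P_l2 B B' u v by blast+
  define w where "w = (\<lambda>n. 1 * ?a n + complex_of_real 1 * ?b n)"
  have w: "w \<in> l2" unfolding w_def using ab by (rule l2_lincomb)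
  have e0: "P {} x n = 0" if "x \<in> l2" for x n
    using P_empty_inner[OF l2_delta_in that, of n] by (simp add: l2_inner_delta)
  have PBw: "P B w = ?b"
    unfolding w_def using P_linear[OF B ab, of 1 "complex_of_real 1"] u v B B' by (simp add: P_Int e0 fun_eq_iff)
  have PBw': "P (- B) w = ?a"
    unfolding w_def using P_linear[OF B' ab, of 1 "complex_of_real 1"] u v B B' by (simp add: P_Int e0 fun_eq_iff)
  have "Re (l2_inner w (H w)) = (\<integral>x. indicator B x * x + indicator (- B) x * x \<partial>\<nu> w)"
    unfolding inner_H[OF w] by (intro Bochner_Integration.integral_cong refl) (simp add: indicator_def)
  also have "\<dots> = (\<integral>x. indicator B x * x \<partial>\<nu> w) + (\<integral>x. indicator (- B) x * x \<partial>\<nu> w)"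
    using integrable_mult_indicator[OF _ integrable_\<nu>[OF w], of B]
      integrable_mult_indicator[OF _ integrable_\<nu>[OF w], of "- B"] B B'
    by (intro Bochner_Integration.integral_add) (simp_all add: sets_\<nu>)
  also have "\<dots> = Re (l2_inner ?b (H ?b)) + Re (l2_inner ?a (H ?a))"
    using inner_H_P[OF w B] inner_H_P[OF w B'] by (simp add: PBw PBw')
  finally show ?thesis
    using inner_H_lincomb[OF ab, of 1] by (simp add: w_def)
qed

text \<open>The part \<open>P (- B) u\<close> drops out by the previous lemma, and the form of
  \<open>H\<close> at \<open>P B\<close> applied to the sum or difference is an integral over
  \<open>B\<close>. This expresses off-diagonal elements of \<open>H (P B)\<close> through scalar
  measures.\<close>

lemma inner_H_P_polarization:
  assumes u: "u \<in> l2" and v: "v \<in> l2" and B: "B \<in> sets borel"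
  shows "Re (l2_inner u (H (P B v))) =
    ((\<integral>x. indicator B x * x \<partial>\<nu> (\<lambda>n. 1 * u n + complex_of_real 1 * v n)) -
     (\<integral>x. indicator B x * x \<partial>\<nu> (\<lambda>n. 1 * u n + complex_of_real (- 1) * v n))) / 4"
proof -
  have B': "- B \<in> sets borel" using borel_comp[OF B] .
  have l2: "P B u \<in> l2" "P B v \<in> l2" "P (- B) u \<in> l2" "H (P B v) \<in> l2"
    using u v B B' by (simp_all add: P_l2 H_l2)
  have "(\<lambda>n. 1 * P B u n + 1 * P (- B) u n) = u"
    using P_Compl[OF B u] by (simp add: fun_eq_iff)
  then have "l2_inner u (H (P B v)) = l2_inner (P B u) (H (P B v)) + l2_inner (P (- B) u) (H (P B v))"
    using l2_inner_add_left[OF l2(4,1,3), of 1 1] by simp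
  then have 1: "Re (l2_inner u (H (P B v))) = Re (l2_inner (P B u) (H (P B v)))"
    using inner_H_P_orthogonal[OF u v B] by simp
  have 2: "(\<integral>x. indicator B x * x \<partial>\<nu> (\<lambda>n. 1 * u n + complex_of_real s * v n)) =
     Re (l2_inner (P B u) (H (P B u))) + Re (l2_inner (P B v) (H (P B v))) + 2 * s * Re (l2_inner (P B u) (H (P B v)))"
    if s: "s = 1 \<or> s = -1" for s
    unfolding inner_H_P[OF l2_lincomb[OF u v] B, symmetric] P_linear[OF B u v]
    by (rule inner_H_lincomb[OF l2(1,2) s])
  show ?thesis unfolding 1 using 2[of 1] 2[of "-1"] by simp
qed

lemma qf_lincomb:
  assumes u: "u \<in> l2" and v: "v \<in> l2" and B: "B \<in> sets borel"
  shows "qf (\<lambda>n. 1 * u n + complex_of_real s * v n) B = qf u B + s * s * qf v B + 2 * s * Re (l2_inner u (P B v))"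
proof -
  have "l2_inner v (P B u) = cnj (l2_inner u (P B v))"
    using P_symmetric[OF B v u] l2_inner_cnj[of "P B v" u] by simp
  then show ?thesis
    unfolding qf_def P_linear[OF B u v] l2_inner_lincomb[OF u v P_l2[OF B u] P_l2[OF B v]]
    by (simp add: algebra_simps)
qed

lemma inner_P_polarization:
  assumes u: "u \<in> l2" and v: "v \<in> l2" and B: "B \<in> sets borel"
  shows "Re (l2_inner u (P B v)) =
    (qf (\<lambda>n. 1 * u n + complex_of_real 1 * v n) B - qf (\<lambda>n. 1 * u n + complex_of_real (- 1) * v n) B) / 4"
  unfolding qf_lincomb[OF assms] by simp

text \<open>Each entry of \<open>P B u\<close> is an inner product of \<open>u\<close> with
  \<open>P B (l2_delta j)\<close>.\<close>

lemma P_eq_0_of_delta: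
  assumes B: "B \<in> sets borel" and u: "u \<in> l2" and 0: "\<And>j. qf (l2_delta j) B = 0"
  shows "P B u = (\<lambda>n. 0)"
proof
  fix j
  have "P B u j = l2_inner (l2_delta j) (P B u)" by (simp add: l2_inner_delta)
  also have "\<dots> = l2_inner (P B (l2_delta j)) u" by (simp add: P_symmetric B u l2_delta_in)
  also have "P B (l2_delta j) = (\<lambda>n. 0)" using qf_eq_0D[OF 0 B l2_delta_in] by blast
  finally show "P B u j = 0" by (simp add: l2_inner_def)
qed

end

section \<open>Generalized eigenfunctions\<close>

text \<open>The weights \<open>1 / (1 + k)\<^sup>2\<close> are summable, so the weighted series has
  finite integral and is finite almost everywhere; its value bounds every term. This is the origin
  of the quadratic growth condition on solutions.\<close>

lemma AE_quadratic_growth: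
  fixes g :: "nat \<Rightarrow> 'a \<Rightarrow> real"
  assumes int: "\<And>k. integrable M (g k)" and nn: "\<And>k x. 0 \<le> g k x" and le: "\<And>k. (\<integral>x. g k x \<partial>M) \<le> c"
  shows "AE x in M. \<exists>C. \<forall>k. g k x \<le> C * (1 + real k)\<^sup>2"
proof -
  let ?h = "\<lambda>k x. ennreal (g k x / (1 + real k)\<^sup>2)"
  have meas: "?h k \<in> borel_measurable M" for k using int[of k] by measurable
  have c: "0 \<le> c" using le[of 0] Bochner_Integration.integral_nonneg[of M "g 0", OF nn] by linarith
  have "summable (\<lambda>n. inverse (real (Suc n) ^ 2))"
    using inverse_power_summable[of 2, where 'a = real] by (subst summable_Suc_iff) simp
  then have "summable (\<lambda>k. c * inverse (real (Suc k) ^ 2))" by (rule summable_mult)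
  then have sm: "(\<Sum>k. ennreal (c * inverse (real (Suc k) ^ 2))) \<noteq> top"
    using c by (intro ennreal_suminf_neq_top) auto
  have "(\<integral>\<^sup>+x. (\<Sum>k. ?h k x) \<partial>M) = (\<Sum>k. \<integral>\<^sup>+x. ?h k x \<partial>M)"
    by (rule nn_integral_suminf) (rule meas)
  also have "\<dots> \<le> (\<Sum>k. ennreal (c * inverse (real (Suc k) ^ 2)))"
  proof (intro suminf_le summableI)
    fix k
    have "(\<integral>\<^sup>+x. ?h k x \<partial>M) = ennreal (\<integral>x. g k x / (1 + real k)\<^sup>2 \<partial>M)"
      using int[of k] nn by (intro nn_integral_eq_integral) auto
    also have "(\<integral>x. g k x / (1 + real k)\<^sup>2 \<partial>M) = (\<integral>x. g k x \<partial>M) / (1 + real k)\<^sup>2" by simp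
    also have "\<dots> \<le> c / (1 + real k)\<^sup>2" by (intro divide_right_mono le) simp
    finally show "(\<integral>\<^sup>+x. ?h k x \<partial>M) \<le> ennreal (c * inverse (real (Suc k) ^ 2))"
      by (simp add: divide_inverse ennreal_leI)
  qed
  also have "\<dots> < top" using sm by (simp add: less_top)
  finally have "(\<integral>\<^sup>+x. (\<Sum>k. ?h k x) \<partial>M) \<noteq> \<infinity>" by simp
  then have "AE x in M. (\<Sum>k. ?h k x) \<noteq> \<infinity>"
    by (intro nn_integral_PInf_AE borel_measurable_suminf_order meas)
  then show ?thesis
  proof (rule AE_mp, intro AE_I2 impI)
    fix x assume fin: "(\<Sum>k. ?h k x) \<noteq> \<infinity>"
    have "g k x \<le> enn2real (\<Sum>k. ?h k x) * (1 + real k)\<^sup>2" for k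
    proof -
      have "?h k x \<le> (\<Sum>k. ?h k x)" using sum_le_suminf[OF summableI, of "{k}" "\<lambda>k. ?h k x"] by simp
      then have "g k x / (1 + real k)\<^sup>2 \<le> enn2real (\<Sum>k. ?h k x)"
        using fin by (metis enn2real_ennreal enn2real_mono infinity_ennreal_def less_top nn divide_nonneg_nonneg zero_le_power2)
      then show ?thesis by (simp add: pos_divide_le_eq)
    qed
    then show "\<exists>C. \<forall>k. g k x \<le> C * (1 + real k)\<^sup>2" by blast
  qed
qed

context schroedinger_resolution
begin

text \<open>All that matters about \<open>base_pmf\<close> is its full support: every spectral measure is then
  absolutely continuous with respect to the mixture \<open>\<rho>\<close>.\<close>

definition base_pmf :: "int pmf" where
  "base_pmf = map_pmf int_decode (geometric_pmf (1 / 2))"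

definition \<rho> :: "real measure" where
  "\<rho> = measure_pmf base_pmf \<bind> (\<lambda>j. \<nu> (l2_delta j))"

lemma set_base_pmf: "set_pmf base_pmf = UNIV"
  by (simp add: base_pmf_def set_pmf_geometric surj_int_decode)

lemma qf_delta_UNIV: "qf (l2_delta j) UNIV = 1"
  by (simp add: qf_def P_UNIV l2_delta_in l2_inner_delta) (simp add: l2_delta_def)

lemma prob_space_\<nu>_delta: "prob_space (\<nu> (l2_delta j))"
  by (rule prob_spaceI) (simp add: space_\<nu> emeasure_\<nu> l2_delta_in qf_delta_UNIV)

lemma kernel_\<nu>: "(\<lambda>j. \<nu> (l2_delta j)) \<in> measure_pmf base_pmf \<rightarrow>\<^sub>M subprob_algebra borel"
  by (simp add: measurable_pmf_measure1 space_subprob_algebra sets_\<nu>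
      prob_space_imp_subprob_space prob_space_\<nu>_delta)

lemma sets_\<rho>: "sets \<rho> = sets borel"
  unfolding \<rho>_def by (rule sets_bind_measurable[OF kernel_\<nu>]) simp

lemma space_\<rho>: "space \<rho> = UNIV"
  using sets_eq_imp_space_eq[OF sets_\<rho>] by simp

lemma emeasure_\<rho>: "B \<in> sets borel \<Longrightarrow> emeasure \<rho> B = (\<integral>\<^sup>+j. emeasure (\<nu> (l2_delta j)) B \<partial>measure_pmf base_pmf)"
  unfolding \<rho>_def by (rule emeasure_bind[OF _ kernel_\<nu>]) simp_all

lemma finite_measure_\<rho>: "finite_measure \<rho>"
  by (rule finite_measureI)
    (simp add: space_\<rho> emeasure_\<rho> emeasure_\<nu> l2_delta_in qf_delta_UNIV)

lemma \<rho>_null: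
  assumes B: "B \<in> sets borel" and "emeasure \<rho> B = 0"
  shows "qf (l2_delta j) B = 0"
proof -
  have "AE j in measure_pmf base_pmf. emeasure (\<nu> (l2_delta j)) B = 0"
    using assms by (simp add: emeasure_\<rho> nn_integral_0_iff_AE)
  then have "emeasure (\<nu> (l2_delta j)) B = 0"
    by (simp add: AE_measure_pmf_iff set_base_pmf)
  then show ?thesis using qf_nonneg[OF B l2_delta_in, of j]
    by (simp add: emeasure_\<nu>[OF l2_delta_in B])
qed

lemma density_exists:
  assumes u: "u \<in> l2"
  shows "\<exists>D. D \<in> borel_measurable borel \<and> (\<forall>x. 0 \<le> D x) \<and> \<nu> u = density \<rho> (\<lambda>x. ennreal (D x))"
proof -
  interpret \<rho>: finite_measure \<rho> by (rule finite_measure_\<rho>)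
  have ac: "absolutely_continuous \<rho> (\<nu> u)"
    unfolding absolutely_continuous_def
  proof
    fix B assume "B \<in> null_sets \<rho>"
    then have B: "B \<in> sets borel" "emeasure \<rho> B = 0" by (auto simp: null_sets_def sets_\<rho>)
    have "P B u = (\<lambda>n. 0)" by (rule P_eq_0_of_delta[OF B(1) u \<rho>_null[OF B]])
    then have "qf u B = 0" by (simp add: qf_def l2_inner_def)
    then show "B \<in> null_sets (\<nu> u)" using B(1) u by (simp add: null_sets_def sets_\<nu> emeasure_\<nu>)
  qed
  have sets: "sets (\<nu> u) = sets \<rho>" by (simp add: sets_\<nu> sets_\<rho>)
  obtain D where D: "D \<in> borel_measurable \<rho>" "AE x in \<rho>. RN_deriv \<rho> (\<nu> u) x = ennreal (D x)"
    "\<And>x. 0 \<le> D x"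
    using \<rho>.real_RN_deriv[OF finite_measure_\<nu>[OF u] ac sets] by blast
  have "\<nu> u = density \<rho> (RN_deriv \<rho> (\<nu> u))" using \<rho>.density_RN_deriv[OF ac sets] by simp
  also have "\<dots> = density \<rho> (\<lambda>x. ennreal (D x))"
    using D by (intro density_cong) auto
  finally show ?thesis using D by (auto simp: measurable_cong_sets[OF sets_\<rho> refl])
qed

text \<open>One version of the density, finite and nonnegative at every point, is fixed so that it
  can be evaluated at an individual energy.\<close>

definition Dens :: "(int \<Rightarrow> complex) \<Rightarrow> real \<Rightarrow> real" where
  "Dens u = (SOME D. D \<in> borel_measurable borel \<and> (\<forall>x. 0 \<le> D x) \<and> \<nu> u = density \<rho> (\<lambda>x. ennreal (D x)))"

lemma Dens:
  assumes u: "u \<in> l2"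
  shows "Dens u \<in> borel_measurable borel" "0 \<le> Dens u x" "\<nu> u = density \<rho> (\<lambda>x. ennreal (Dens u x))"
  using someI_ex[OF density_exists[OF u], folded Dens_def] by auto

lemma measurable_\<rho>: "borel_measurable \<rho> = borel_measurable borel"
  by (rule measurable_cong_sets[OF sets_\<rho> refl])

lemma integral_Dens:
  assumes u: "u \<in> l2" and f: "f \<in> borel_measurable borel"
  shows "integrable \<rho> (\<lambda>x. Dens u x * f x) \<longleftrightarrow> integrable (\<nu> u) f"
    and "(\<integral>x. Dens u x * f x \<partial>\<rho>) = (\<integral>x. f x \<partial>\<nu> u)"
  unfolding Dens(3)[OF u]
  using integrable_density[of f \<rho> "Dens u"] integral_density[of f \<rho> "Dens u"] f Dens(1,2)[OF u]
  by (simp_all add: measurable_\<rho>)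

lemma integrable_Dens:
  assumes u: "u \<in> l2"
  shows "integrable \<rho> (Dens u)"
proof -
  have "integrable (\<nu> u) (\<lambda>_. 1 :: real)" by (rule finite_measure.integrable_const[OF finite_measure_\<nu>[OF u]])
  from integral_Dens(1)[OF u _, THEN iffD2, OF _ this] show ?thesis unfolding mult_1_right by simp
qed

lemma integrable_mult_Dens: "u \<in> l2 \<Longrightarrow> integrable \<rho> (\<lambda>x. x * Dens u x)"
  using integral_Dens(1)[of u "\<lambda>x. x", THEN iffD2, OF _ measurable_ident_sets[OF refl] integrable_\<nu>]
  unfolding mult.commute[of _ "Dens u _"] by blast

lemma integral_indicator_Dens:
  assumes "u \<in> l2" "B \<in> sets borel"
  shows "(\<integral>x. indicator B x * Dens u x \<partial>\<rho>) = qf u B"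
  using integral_Dens(2)[of u "indicator B"] assms
  by (simp add: mult.commute sets_\<nu> measure_\<nu> space_\<nu>)

lemma integral_indicator_mult_Dens:
  assumes "u \<in> l2" "B \<in> sets borel"
  shows "(\<integral>x. indicator B x * (x * Dens u x) \<partial>\<rho>) = (\<integral>x. indicator B x * x \<partial>\<nu> u)"
  using integral_Dens(2)[of u "\<lambda>x. indicator B x * x"] assms
  by (simp add: mult_ac)

text \<open>The generalized eigenfunction with source \<open>n\<close>, as a function of the site
  \<open>m\<close>. The measure \<open>Re (P B (l2_delta n) m)\<close> is signed, so its density is
  obtained by polarization from two nonnegative ones.\<close>

definition gef :: "int \<Rightarrow> int \<Rightarrow> real \<Rightarrow> real" where
  "gef n m x = (Dens (\<lambda>i. 1 * l2_delta m i + complex_of_real 1 * l2_delta n i) x -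
               Dens (\<lambda>i. 1 * l2_delta m i + complex_of_real (- 1) * l2_delta n i) x) / 4"

lemma delta_lincomb_l2: "(\<lambda>i. a * l2_delta m i + b * l2_delta n i) \<in> l2"
  by (intro l2_lincomb l2_delta_in)

lemma integrable_gef: "integrable \<rho> (gef n m)" "integrable \<rho> (\<lambda>x. x * gef n m x)"
proof -
  show "integrable \<rho> (gef n m)" unfolding gef_def[abs_def]
    by (intro integrable_divide Bochner_Integration.integrable_diff integrable_Dens delta_lincomb_l2)
  have "integrable \<rho> (\<lambda>x. (x * Dens (\<lambda>i. 1 * l2_delta m i + complex_of_real 1 * l2_delta n i) x -
               x * Dens (\<lambda>i. 1 * l2_delta m i + complex_of_real (- 1) * l2_delta n i) x) / 4)"
    by (intro integrable_divide Bochner_Integration.integrable_diff integrable_mult_Dens delta_lincomb_l2)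
  then show "integrable \<rho> (\<lambda>x. x * gef n m x)" by (simp add: gef_def right_diff_distrib)
qed

lemma set_integrable_\<rho>:
  assumes "integrable \<rho> (f :: real \<Rightarrow> real)" "B \<in> sets borel"
  shows "integrable \<rho> (\<lambda>x. indicator B x * f x)"
  using integrable_mult_indicator[of B \<rho> f] assms by (simp add: sets_\<rho>)

lemma integral_gef:
  assumes B: "B \<in> sets borel"
  shows "(\<integral>x. indicator B x * gef n m x \<partial>\<rho>) = Re (P B (l2_delta n) m)"
proof -
  let ?p = "\<lambda>i. 1 * l2_delta m i + complex_of_real 1 * l2_delta n i"
  let ?q = "\<lambda>i. 1 * l2_delta m i + complex_of_real (- 1) * l2_delta n i"
  have "(\<integral>x. indicator B x * gef n m x \<partial>\<rho>) =
      (\<integral>x. (indicator B x * Dens ?p x - indicator B x * Dens ?q x) / 4 \<partial>\<rho>)"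
    by (simp add: gef_def right_diff_distrib)
  also have "\<dots> = ((\<integral>x. indicator B x * Dens ?p x \<partial>\<rho>) - (\<integral>x. indicator B x * Dens ?q x \<partial>\<rho>)) / 4"
  proof -
    have "integrable \<rho> (\<lambda>x. indicator B x * Dens ?p x)" "integrable \<rho> (\<lambda>x. indicator B x * Dens ?q x)"
      by (intro set_integrable_\<rho> integrable_Dens delta_lincomb_l2 B)+
    then show ?thesis by (simp only: integral_divide_zero Bochner_Integration.integral_diff)
  qed
  also have "\<dots> = Re (l2_inner (l2_delta m) (P B (l2_delta n)))"
    unfolding integral_indicator_Dens[OF delta_lincomb_l2 B]
    by (rule inner_P_polarization[OF l2_delta_in l2_delta_in B, symmetric])
  finally show ?thesis by (simp add: l2_inner_delta)
qed

lemma integral_mult_gef: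
  assumes B: "B \<in> sets borel"
  shows "(\<integral>x. indicator B x * (x * gef n m x) \<partial>\<rho>) = Re (H (P B (l2_delta n)) m)"
proof -
  let ?p = "\<lambda>i. 1 * l2_delta m i + complex_of_real 1 * l2_delta n i"
  let ?q = "\<lambda>i. 1 * l2_delta m i + complex_of_real (- 1) * l2_delta n i"
  have "(\<integral>x. indicator B x * (x * gef n m x) \<partial>\<rho>) =
      (\<integral>x. (indicator B x * (x * Dens ?p x) - indicator B x * (x * Dens ?q x)) / 4 \<partial>\<rho>)"
    by (simp add: gef_def right_diff_distrib)
  also have "\<dots> = ((\<integral>x. indicator B x * (x * Dens ?p x) \<partial>\<rho>) - (\<integral>x. indicator B x * (x * Dens ?q x) \<partial>\<rho>)) / 4"
  proof -
    have "integrable \<rho> (\<lambda>x. indicator B x * (x * Dens ?p x))" "integrable \<rho> (\<lambda>x. indicator B x * (x * Dens ?q x))"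
      by (intro set_integrable_\<rho> integrable_mult_Dens delta_lincomb_l2 B)+
    then show ?thesis by (simp only: integral_divide_zero Bochner_Integration.integral_diff)
  qed
  also have "\<dots> = Re (l2_inner (l2_delta m) (H (P B (l2_delta n))))"
    unfolding integral_indicator_mult_Dens[OF delta_lincomb_l2 B]
    by (rule inner_H_P_polarization[OF l2_delta_in l2_delta_in B, symmetric])
  finally show ?thesis by (simp add: l2_inner_delta)
qed

text \<open>Over every Borel set \<open>B\<close> both sides of the equation integrate to the real
  part of \<open>H (P B (l2_delta n))\<close> at \<open>m\<close>. There are countably many sites,
  so one null set serves for all.\<close>

lemma AE_sol_gef: "AE x in \<rho>. sol (\<lambda>m. x - V m) (\<lambda>m. gef n m x)"
proof -
  have "AE x in \<rho>. x * gef n m x = gef n (m + 1) x + gef n (m - 1) x + V m * gef n m x" for m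
  proof (rule density_unique_real)
    show "integrable \<rho> (\<lambda>x. gef n (m + 1) x + gef n (m - 1) x + V m * gef n m x)"
      by (intro Bochner_Integration.integrable_add integrable_mult_right integrable_gef)
    fix B assume "B \<in> sets \<rho>"
    then have B: "B \<in> sets borel" by (simp add: sets_\<rho>)
    have "(\<integral>x\<in>B. gef n (m + 1) x + gef n (m - 1) x + V m * gef n m x \<partial>\<rho>) =
      (\<integral>x. indicator B x * gef n (m + 1) x + indicator B x * gef n (m - 1) x + V m * (indicator B x * gef n m x) \<partial>\<rho>)"
      unfolding set_lebesgue_integral_def by (simp add: algebra_simps)
    also have "\<dots> = (\<integral>x. indicator B x * gef n (m + 1) x \<partial>\<rho>) + (\<integral>x. indicator B x * gef n (m - 1) x \<partial>\<rho>)
        + V m * (\<integral>x. indicator B x * gef n m x \<partial>\<rho>)"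
      using set_integrable_\<rho>[OF integrable_gef(1) B] by simp
    also have "\<dots> = Re (H (P B (l2_delta n)) m)"
      unfolding integral_gef[OF B] by (simp add: schroedinger_operator_def)
    also have "\<dots> = (\<integral>x\<in>B. x * gef n m x \<partial>\<rho>)"
      using integral_mult_gef[OF B] by (simp add: set_lebesgue_integral_def)
    finally show "(\<integral>x\<in>B. x * gef n m x \<partial>\<rho>) = (\<integral>x\<in>B. gef n (m + 1) x + gef n (m - 1) x + V m * gef n m x \<partial>\<rho>)" ..
  qed (rule integrable_gef)
  then have "AE x in \<rho>. \<forall>m. x * gef n m x = gef n (m + 1) x + gef n (m - 1) x + V m * gef n m x"
    by (simp add: AE_all_countable)
  then show ?thesis by eventually_elim (simp add: sol_def left_diff_distrib)
qed

text \<open>The dominating function \<open>G\<close> has integral 4 at every site, by the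
  parallelogram law for two unit vectors.\<close>

lemma AE_growth_gef: "AE x in \<rho>. \<exists>C. \<forall>m. \<bar>gef n m x\<bar> \<le> C * (1 + \<bar>real_of_int m\<bar>)\<^sup>2"
proof -
  let ?p = "\<lambda>m i. 1 * l2_delta m i + complex_of_real 1 * l2_delta n i"
  let ?q = "\<lambda>m i. 1 * l2_delta m i + complex_of_real (- 1) * l2_delta n i"
  define G where "G = (\<lambda>m x. Dens (?p m) x + Dens (?q m) x)"
  have intG: "integrable \<rho> (G m)" for m
    unfolding G_def by (intro Bochner_Integration.integrable_add integrable_Dens delta_lincomb_l2)
  have nnG: "0 \<le> G m x" for m x
    unfolding G_def by (intro add_nonneg_nonneg Dens delta_lincomb_l2)
  have int_one: "(\<integral>x. Dens u x \<partial>\<rho>) = qf u UNIV" if "u \<in> l2" for u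
    using integral_indicator_Dens[OF that, of UNIV] by simp
  have valG: "(\<integral>x. G m x \<partial>\<rho>) = 4" for m
  proof -
    have "(\<integral>x. G m x \<partial>\<rho>) = qf (?p m) UNIV + qf (?q m) UNIV"
      unfolding G_def
      by (subst Bochner_Integration.integral_add) (simp_all only: integrable_Dens delta_lincomb_l2 int_one)
    also have "\<dots> = 4"
      by (simp only: qf_lincomb[OF l2_delta_in l2_delta_in sets.top[of borel, unfolded space_borel]] qf_delta_UNIV)
    finally show ?thesis .
  qed
  have bd: "\<bar>gef n m x\<bar> \<le> G m x" for m x
  proof -
    have "\<bar>(a - b) / 4\<bar> \<le> a + b" if "0 \<le> a" "0 \<le> b" for a b :: real
      using that by (simp add: abs_le_iff)
    then show ?thesis unfolding gef_def G_def by (blast intro: Dens(2) delta_lincomb_l2)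
  qed
  \<comment> \<open>The sites \<open>k\<close> and \<open>- k\<close> are paired to index by natural
    numbers, hence the bound 8.\<close>
  have "AE x in \<rho>. \<exists>C. \<forall>k. G (int k) x + G (- int k) x \<le> C * (1 + real k)\<^sup>2"
    by (rule AE_quadratic_growth[where c = 8])
      (use intG nnG in \<open>auto simp: valG intro!: Bochner_Integration.integrable_add add_nonneg_nonneg\<close>)
  then show ?thesis
  proof eventually_elim
    case (elim x)
    then obtain C where C: "\<And>k. G (int k) x + G (- int k) x \<le> C * (1 + real k)\<^sup>2" by blast
    have "\<bar>gef n m x\<bar> \<le> C * (1 + \<bar>real_of_int m\<bar>)\<^sup>2" for m
    proof (cases m rule: int_cases2)
      case (nonneg k)
      then show ?thesis using C[of k] bd[of m x] nnG[of "- int k" x] by simp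
    next
      case (nonpos k)
      then show ?thesis using C[of k] bd[of m x] nnG[of "int k" x] by simp
    qed
    then show ?case by blast
  qed
qed

end

text \<open>The interface between the probabilistic and the spectral half. Quadratic growth is what
  \<open>AE_growth_gef\<close> supplies, and square-summable eigenfunctions, being bounded, satisfy
  it too.\<close>

definition decaying_solutions :: "(int \<Rightarrow> real) \<Rightarrow> real set \<Rightarrow> bool" where
  "decaying_solutions V I \<longleftrightarrow> (\<forall>E\<in>I. \<forall>u C. sol (\<lambda>n. E - V n) u \<longrightarrow>
     (\<forall>n. \<bar>u n\<bar> \<le> C * (1 + \<bar>real_of_int n\<bar>)\<^sup>2) \<longrightarrow>
     (\<exists>C>0. \<exists>\<gamma>>0. \<forall>n. \<bar>u n\<bar> \<le> C * exp (- \<gamma> * real_of_int \<bar>n\<bar>)))"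

text \<open>Where the diagonal density \<open>gef n n x\<close> is nonzero, the generalized
  eigenfunction is nontrivial; for almost every such \<open>x\<close> in \<open>I\<close> it decays,
  so \<open>x\<close> is an eigenvalue. Off the eigenvalues the density therefore vanishes almost
  everywhere.\<close>

lemma (in schroedinger_resolution) qf_delta_non_eigenvalues:
  assumes I: "I \<in> sets borel" and dec: "decaying_solutions V I"
  shows "qf (l2_delta n) (I - l2_eigenvalues V) = 0"
proof -
  have "countable (l2_eigenvalues V)" using V by (rule countable_l2_eigenvalues)
  then have S: "l2_eigenvalues V \<in> sets borel" by (rule sets.countable[rotated]) auto
  let ?B = "I - l2_eigenvalues V"
  have B: "?B \<in> sets borel" using I S by auto
  have "AE x in \<rho>. indicator ?B x * gef n n x = 0"
    using AE_sol_gef[of n] AE_growth_gef[of n]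
  proof eventually_elim
    case (elim x)
    show ?case
    proof (cases "x \<in> ?B \<and> gef n n x \<noteq> 0")
      case True
      with elim dec obtain C \<gamma> where "0 < \<gamma>" "\<And>m. \<bar>gef n m x\<bar> \<le> C * exp (- \<gamma> * real_of_int \<bar>m\<bar>)"
        unfolding decaying_solutions_def by blast
      then have "(\<lambda>m. complex_of_real (gef n m x)) \<in> l2" by (rule l2_of_exponential_decay)
      with elim(1) True have "x \<in> l2_eigenvalues V" by (auto simp: l2_eigenvalues_def)
      with True show ?thesis by blast
    qed auto
  qed
  then have "(\<integral>x. indicator ?B x * gef n n x \<partial>\<rho>) = 0"
    by (rule integral_eq_zero_AE)
  then have "Re (P ?B (l2_delta n) n) = 0" by (simp only: integral_gef[OF B])
  then show ?thesis by (simp add: qf_def l2_inner_delta)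
qed

text \<open>The point masses sit on the countable set of eigenvalues. Complex eigenfunctions are
  handled through their real and imaginary parts, each a bounded real solution.\<close>

lemma spectral_localization_of_decaying_solutions:
  assumes V: "\<And>n. \<bar>V n\<bar> \<le> K" and I: "I \<in> sets borel" and dec: "decaying_solutions V I"
  shows "spectral_localization (schroedinger_operator V) I"
  unfolding spectral_localization_def
proof (intro conjI ballI allI impI)
  show "pure_point_spectrum_on (schroedinger_operator V) I"
    unfolding pure_point_spectrum_on_def
  proof (intro allI impI ballI)
    fix P u assume "spectral_resolution (schroedinger_operator V) P" and u: "u \<in> l2"
    then interpret schroedinger_resolution V K P using V by unfold_locales
    have c: "countable (l2_eigenvalues V)" using V by (rule countable_l2_eigenvalues)
    then have S: "l2_eigenvalues V \<in> sets borel" by (rule sets.countable[rotated]) auto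
    let ?B = "I - l2_eigenvalues V"
    have B: "?B \<in> sets borel" using I S by auto
    have "P ?B u = (\<lambda>n. 0)"
      by (rule P_eq_0_of_delta[OF B u qf_delta_non_eigenvalues[OF I dec]])
    then have "emeasure (\<nu> u) ?B = 0" by (simp add: emeasure_\<nu>[OF u B] qf_def l2_inner_def)
    then have "AE x in \<nu> u. x \<notin> ?B" using B by (intro AE_not_in) (simp add: null_sets_def sets_\<nu>)
    then have "AE x in restrict_space (\<nu> u) I. x \<in> l2_eigenvalues V"
      using I by (subst AE_restrict_space_iff) (auto simp: sets_\<nu> space_\<nu>)
    with c show "pure_point_measure (restrict_space (\<nu> u) I)"
      unfolding pure_point_measure_def by blast
  qed
next
  fix E u assume E: "E \<in> I" and ef: "eigenfunction (schroedinger_operator V) E u"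
  let ?r = "\<lambda>n. Re (u n)" and ?i = "\<lambda>n. Im (u n)"
  have eq: "u (n + 1) + u (n - 1) + complex_of_real (V n) * u n = complex_of_real E * u n" for n
    using ef by (simp add: eigenfunction_def schroedinger_operator_def fun_eq_iff)
  have sol: "sol (\<lambda>n. E - V n) ?r" "sol (\<lambda>n. E - V n) ?i"
    unfolding sol_def using arg_cong[OF eq, of Re] arg_cong[OF eq, of Im]
    by (simp_all add: algebra_simps)
  have l2: "u \<in> l2" using ef by (simp add: eigenfunction_def)
  define c where "c = sqrt (\<Sum>\<^sub>\<infinity>n. (cmod (u n))\<^sup>2)"
  have bd: "cmod (u n) \<le> c" for n
  proof -
    have "(\<Sum>\<^sub>\<infinity>n\<in>{n}. (cmod (u n))\<^sup>2) \<le> (\<Sum>\<^sub>\<infinity>n. (cmod (u n))\<^sup>2)"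
      using l2 by (intro infsum_mono2) (auto simp: l2_def)
    then show ?thesis unfolding c_def by (intro real_le_rsqrt) simp
  qed
  have "0 \<le> c" using bd[of 0] norm_ge_zero order_trans by blast
  have gr: "\<bar>?r n\<bar> \<le> c * (1 + \<bar>real_of_int n\<bar>)\<^sup>2" "\<bar>?i n\<bar> \<le> c * (1 + \<bar>real_of_int n\<bar>)\<^sup>2" for n
  proof -
    have "c * 1 \<le> c * (1 + \<bar>real_of_int n\<bar>)\<^sup>2" using \<open>0 \<le> c\<close> by (intro mult_left_mono one_le_power) auto
    then show "\<bar>?r n\<bar> \<le> c * (1 + \<bar>real_of_int n\<bar>)\<^sup>2" "\<bar>?i n\<bar> \<le> c * (1 + \<bar>real_of_int n\<bar>)\<^sup>2"
      using abs_Re_le_cmod[of "u n"] abs_Im_le_cmod[of "u n"] bd[of n] by linarith+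
  qed
  obtain C1 \<gamma>1 where 1: "0 < C1" "0 < \<gamma>1" "\<And>n. \<bar>?r n\<bar> \<le> C1 * exp (- \<gamma>1 * real_of_int \<bar>n\<bar>)"
    using dec E sol(1) gr(1) unfolding decaying_solutions_def by blast
  obtain C2 \<gamma>2 where 2: "0 < C2" "0 < \<gamma>2" "\<And>n. \<bar>?i n\<bar> \<le> C2 * exp (- \<gamma>2 * real_of_int \<bar>n\<bar>)"
    using dec E sol(2) gr(2) unfolding decaying_solutions_def by blast
  have "cmod (u n) \<le> (C1 + C2) * exp (- min \<gamma>1 \<gamma>2 * real_of_int \<bar>n\<bar>)" for n
  proof -
    have "cmod (u n) \<le> \<bar>?r n\<bar> + \<bar>?i n\<bar>" by (rule cmod_le)
    also have "\<dots> \<le> C1 * exp (- \<gamma>1 * real_of_int \<bar>n\<bar>) + C2 * exp (- \<gamma>2 * real_of_int \<bar>n\<bar>)"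
      using 1(3)[of n] 2(3)[of n] by linarith
    also have "\<dots> \<le> C1 * exp (- min \<gamma>1 \<gamma>2 * real_of_int \<bar>n\<bar>) + C2 * exp (- min \<gamma>1 \<gamma>2 * real_of_int \<bar>n\<bar>)"
      using 1(1) 2(1) by (intro add_mono mult_left_mono) (auto intro!: mult_right_mono)
    finally show ?thesis by (simp add: distrib_right)
  qed
  then show "exponentially_decaying u"
    unfolding exponentially_decaying_def using 1 2
    by (intro exI[of _ "C1 + C2"] exI[of _ "min \<gamma>1 \<gamma>2"] conjI) auto
qed

section \<open>Window events and bounded distortion\<close>

definition agree :: "int \<Rightarrow> int \<Rightarrow> (int \<Rightarrow> nat) \<Rightarrow> (int \<Rightarrow> nat) \<Rightarrow> bool" where
  "agree a b \<omega> \<omega>' \<longleftrightarrow> (\<forall>i\<in>{a..b}. \<omega> i = \<omega>' i)"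

definition word :: "int \<Rightarrow> int \<Rightarrow> (int \<Rightarrow> nat) \<Rightarrow> nat list" where
  "word a b \<omega> = map (\<lambda>i. \<omega> (a + int i)) [0..<nat (b - a + 1)]"

lemma agree_mono: "agree a b \<omega> \<omega>' \<Longrightarrow> a \<le> a' \<Longrightarrow> b' \<le> b \<Longrightarrow> agree a' b' \<omega> \<omega>'"
  by (auto simp: agree_def)

lemma agree_sym: "agree a b \<omega> \<omega>' \<Longrightarrow> agree a b \<omega>' \<omega>"
  by (auto simp: agree_def)

lemma agree_trans: "agree a b \<omega> \<omega>' \<Longrightarrow> agree a b \<omega>' \<omega>'' \<Longrightarrow> agree a b \<omega> \<omega>''"
  by (auto simp: agree_def)

lemma length_word: "length (word a b \<omega>) = nat (b - a + 1)"
  by (simp add: word_def)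

lemma agree_iff_nth:
  "agree a b \<omega> \<omega>' \<longleftrightarrow> (\<forall>i<nat (b - a + 1). \<omega>' (a + int i) = word a b \<omega> ! i)"
proof
  assume "agree a b \<omega> \<omega>'"
  then show "\<forall>i<nat (b - a + 1). \<omega>' (a + int i) = word a b \<omega> ! i"
    by (auto simp: agree_def word_def)
next
  assume *: "\<forall>i<nat (b - a + 1). \<omega>' (a + int i) = word a b \<omega> ! i"
  show "agree a b \<omega> \<omega>'" unfolding agree_def
  proof
    fix i assume "i \<in> {a..b}"
    then show "\<omega> i = \<omega>' i" using *[rule_format, of "nat (i - a)"] by (simp add: word_def)
  qed
qed

lemma word_eq_iff: "word a b \<omega> = word a b \<omega>' \<longleftrightarrow> agree a b \<omega> \<omega>'"
  by (auto simp: agree_iff_nth list_eq_iff_nth_eq length_word) (auto simp: word_def)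

lemma open_agree: "open {\<omega>'. agree a b \<omega> \<omega>'}"
proof -
  have "{\<omega>'. agree a b \<omega> \<omega>'} = (\<Inter>i\<in>{a..b}. (\<lambda>\<omega>'. \<omega>' i) -` {\<omega> i})"
    by (auto simp: agree_def)
  moreover have "open ((\<lambda>\<omega>' :: int \<Rightarrow> nat. \<omega>' i) -` {\<omega> i})" for i
    by (intro open_vimage continuous_on_product_coordinates) (rule Topological_Spaces.open_discrete)
  ultimately show ?thesis by (simp add: open_INT)
qed

text \<open>The distortion bound is put in product form, which avoids quotients and also covers
  empty intersections.\<close>

locale sft_measure = prob_space \<mu> for \<mu> :: "(int \<Rightarrow> nat) measure" +
  fixes l :: nat and \<Omega> :: "(int \<Rightarrow> nat) set" and Cd :: real
  assumes letters: "\<omega> \<in> \<Omega> \<Longrightarrow> \<omega> n \<in> {1..l}"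
    and sets_\<mu>: "sets \<mu> = sets (restrict_space borel \<Omega>)"
    and shift_\<Omega>: "\<omega> \<in> \<Omega> \<Longrightarrow> seq_shift k \<omega> \<in> \<Omega>"
    and invariant: "distr \<mu> \<mu> (seq_shift 1) = \<mu>"
    and Cd: "1 \<le> Cd"
    and distortion: "js \<noteq> [] \<Longrightarrow> is \<noteq> [] \<Longrightarrow> n + int (length js) \<le> m \<Longrightarrow>
      prob (cylinder \<Omega> n js \<inter> cylinder \<Omega> m is) \<le> Cd * (prob (cylinder \<Omega> n js) * prob (cylinder \<Omega> m is))"
begin

text \<open>Events decided by the letters at \<open>a..b\<close>. They are finite unions of
  cylinders, so measurability follows.\<close>

definition window :: "int \<Rightarrow> int \<Rightarrow> (int \<Rightarrow> nat) set \<Rightarrow> bool" where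
  "window a b X \<longleftrightarrow> a \<le> b \<and> X \<subseteq> \<Omega> \<and> (\<forall>\<omega>\<in>X. \<forall>\<omega>'\<in>\<Omega>. agree a b \<omega> \<omega>' \<longrightarrow> \<omega>' \<in> X)"

text \<open>The smallest subset of \<Omega> decided by the letters at \<open>a..b\<close> that
  contains \<open>X \<inter> \<Omega>\<close>.\<close>

definition saturate :: "int \<Rightarrow> int \<Rightarrow> (int \<Rightarrow> nat) set \<Rightarrow> (int \<Rightarrow> nat) set" where
  "saturate a b X = {\<omega>\<in>\<Omega>. \<exists>\<omega>'\<in>X \<inter> \<Omega>. agree a b \<omega>' \<omega>}"

lemma space_\<mu>: "space \<mu> = \<Omega>"
  using sets_eq_imp_space_eq[OF sets_\<mu>] by (simp add: space_restrict_space)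

lemma window_saturate: "a \<le> b \<Longrightarrow> window a b (saturate a b X)"
  unfolding window_def saturate_def by simp (meson agree_trans)

lemma window_mono: "window a b X \<Longrightarrow> a' \<le> a \<Longrightarrow> b \<le> b' \<Longrightarrow> window a' b' X"
  unfolding window_def using agree_mono by (meson order_trans)

lemma window_Int: "window a b X \<Longrightarrow> window a b Y \<Longrightarrow> window a b (X \<inter> Y)"
  unfolding window_def by blast

lemma cylinder_word: "\<omega> \<in> \<Omega> \<Longrightarrow> cylinder \<Omega> a (word a b \<omega>) = {\<omega>'\<in>\<Omega>. agree a b \<omega> \<omega>'}"
  by (auto simp: cylinder_def agree_iff_nth length_word)

lemma sets_agree: "{\<omega>'\<in>\<Omega>. agree a b \<omega> \<omega>'} \<in> events"
proof -
  have "{\<omega>'. agree a b \<omega> \<omega>'} \<inter> \<Omega> \<in> sets (restrict_space borel \<Omega>)"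
    using open_agree by (auto simp: sets_restrict_space)
  moreover have "{\<omega>'. agree a b \<omega> \<omega>'} \<inter> \<Omega> = {\<omega>'\<in>\<Omega>. agree a b \<omega> \<omega>'}" by auto
  ultimately show ?thesis by (simp add: sets_\<mu>)
qed

lemma finite_words: "finite (word a b ` X)" if "X \<subseteq> \<Omega>"
proof (rule finite_subset)
  show "word a b ` X \<subseteq> {js. set js \<subseteq> {1..l} \<and> length js = nat (b - a + 1)}"
    using letters that unfolding word_def by fastforce
qed (rule finite_lists_length_eq, simp)

lemma window_eq_Union: "window a b X \<Longrightarrow> X = (\<Union>js\<in>word a b ` X. cylinder \<Omega> a js)"
proof -
  assume *: "window a b X"
  then have "cylinder \<Omega> a (word a b \<omega>) \<subseteq> X" if "\<omega> \<in> X" for \<omega>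
    using that by (subst cylinder_word) (auto simp: window_def)
  moreover have "\<omega> \<in> cylinder \<Omega> a (word a b \<omega>)" if "\<omega> \<in> X" for \<omega>
    using that * by (subst cylinder_word) (auto simp: window_def agree_def)
  ultimately show ?thesis by blast
qed

lemma disjoint_cylinders:
  assumes "X \<subseteq> \<Omega>"
  shows "disjoint_family_on (cylinder \<Omega> a) (word a b ` X)"
  unfolding disjoint_family_on_def
proof (intro ballI impI)
  fix js "is" assume "js \<in> word a b ` X" "is \<in> word a b ` X" "js \<noteq> is"
  then obtain \<omega> \<omega>' where *: "js = word a b \<omega>" "is = word a b \<omega>'" "\<omega> \<in> X" "\<omega>' \<in> X"
    by blast
  with \<open>js \<noteq> is\<close> have "\<not> agree a b \<omega> \<omega>'" by (simp add: word_eq_iff)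
  with * assms show "cylinder \<Omega> a js \<inter> cylinder \<Omega> a is = {}"
    by (auto simp: cylinder_word subset_iff) (meson agree_sym agree_trans)
qed

lemma cylinder_word_sets: "js \<in> word a b ` X \<Longrightarrow> X \<subseteq> \<Omega> \<Longrightarrow> cylinder \<Omega> a js \<in> events"
  by (auto simp: cylinder_word subset_iff sets_agree)

lemma window_sets:
  assumes "window a b X"
  shows "X \<in> events"
proof -
  have X: "X \<subseteq> \<Omega>" using assms by (simp add: window_def)
  have "(\<Union>js\<in>word a b ` X. cylinder \<Omega> a js) \<in> events"
    using X by (intro sets.finite_UN finite_words) (auto intro: cylinder_word_sets[OF imageI])
  then show ?thesis using window_eq_Union[OF assms] by simp
qed

lemma prob_window:
  assumes "window a b X"
  shows "prob X = (\<Sum>js\<in>word a b ` X. prob (cylinder \<Omega> a js))"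
proof -
  have X: "X \<subseteq> \<Omega>" using assms by (simp add: window_def)
  have "prob X = prob (\<Union>js\<in>word a b ` X. cylinder \<Omega> a js)"
    using window_eq_Union[OF assms] by simp
  also have "\<dots> = (\<Sum>js\<in>word a b ` X. prob (cylinder \<Omega> a js))"
    using X by (intro finite_measure_finite_Union finite_words disjoint_cylinders)
      (auto intro: cylinder_word_sets)
  finally show ?thesis .
qed

text \<open>Both events are split into cylinders; distortion applies to each pair, and the double
  sum factors.\<close>

lemma prob_window_Int_le:
  assumes X: "window a b X" and Y: "window c d Y" and bc: "b < c"
  shows "prob (X \<inter> Y) \<le> Cd * prob X * prob Y"
proof -
  let ?J = "word a b ` X" and ?I = "word c d ` Y"
  have sub: "X \<subseteq> \<Omega>" "Y \<subseteq> \<Omega>" and ab: "a \<le> b" and cd: "c \<le> d" using X Y by (auto simp: window_def)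
  have fin: "finite (?J \<times> ?I)" using finite_words sub by blast
  have "X \<inter> Y = (\<Union>js\<in>?J. cylinder \<Omega> a js) \<inter> (\<Union>is\<in>?I. cylinder \<Omega> c is)"
    using window_eq_Union[OF X] window_eq_Union[OF Y] by simp
  also have "\<dots> = (\<Union>(js, is)\<in>?J \<times> ?I. cylinder \<Omega> a js \<inter> cylinder \<Omega> c is)" by blast
  finally have "prob (X \<inter> Y) = prob (\<Union>(js, is)\<in>?J \<times> ?I. cylinder \<Omega> a js \<inter> cylinder \<Omega> c is)" by simp
  also have "\<dots> \<le> (\<Sum>(js, is)\<in>?J \<times> ?I. prob (cylinder \<Omega> a js \<inter> cylinder \<Omega> c is))"
  proof -
    have "(\<lambda>(js, is). cylinder \<Omega> a js \<inter> cylinder \<Omega> c is) ` (?J \<times> ?I) \<subseteq> events"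
      using sub by (auto intro!: sets.Int intro: cylinder_word_sets[OF imageI])
    from finite_measure_subadditive_finite[OF fin this] show ?thesis
      by (simp add: case_prod_beta)
  qed
  also have "\<dots> \<le> (\<Sum>(js, is)\<in>?J \<times> ?I. Cd * (prob (cylinder \<Omega> a js) * prob (cylinder \<Omega> c is)))"
  proof (intro sum_mono, clarify)
    fix \<omega> \<omega>' assume "\<omega> \<in> X" "\<omega>' \<in> Y"
    have len: "length (word a b \<omega>) = nat (b - a + 1)" "length (word c d \<omega>') = nat (d - c + 1)"
      by (simp_all add: length_word)
    then have "word a b \<omega> \<noteq> []" "word c d \<omega>' \<noteq> []" using ab cd by auto
    then show "prob (cylinder \<Omega> a (word a b \<omega>) \<inter> cylinder \<Omega> c (word c d \<omega>'))
       \<le> Cd * (prob (cylinder \<Omega> a (word a b \<omega>)) * prob (cylinder \<Omega> c (word c d \<omega>')))"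
      using ab bc by (intro distortion) (auto simp: length_word)
  qed
  also have "\<dots> = Cd * (prob X * prob Y)"
    unfolding prob_window[OF X] prob_window[OF Y] sum_product sum.cartesian_product
    by (simp add: case_prod_beta sum_distrib_left)
  finally show ?thesis by (simp add: mult.assoc)
qed

text \<open>The intersection of the first events is again decided by a window, which ends before the
  next one starts. Each new event thus costs one factor \<open>Cd\<close>.\<close>

lemma prob_INT_windows_le:
  assumes win: "\<And>j. window (a j) (b j) (X j)" and sep: "\<And>j. b j < a (Suc j)"
    and p: "\<And>j. prob (X j) \<le> p"
  shows "window (a 0) (b r) (\<Inter>j\<le>r. X j) \<and> prob (\<Inter>j\<le>r. X j) \<le> (Cd * p) ^ Suc r"
proof (induction r)
  case 0
  have "prob (X 0) \<le> 1 * p" using p[of 0] by simp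
  also have "\<dots> \<le> Cd * p" using Cd order_trans[OF measure_nonneg p[of 0]] by (intro mult_right_mono) auto
  finally show ?case using win[of 0] by simp
next
  case (Suc r)
  let ?Y = "\<Inter>j\<le>r. X j"
  have eq: "(\<Inter>j\<le>Suc r. X j) = ?Y \<inter> X (Suc r)" by (auto simp: atMost_Suc)
  have w: "window (a 0) (b r) ?Y" using Suc by blast
  have le: "a 0 \<le> a (Suc r)" "b r \<le> b (Suc r)"
    using w sep[of r] win[of "Suc r"] by (auto simp: window_def)
  have p0: "0 \<le> p" using p[of 0] measure_nonneg[of \<mu> "X 0"] by linarith
  have "window (a 0) (b (Suc r)) (?Y \<inter> X (Suc r))"
    using window_mono[OF w order_refl le(2)] window_mono[OF win[of "Suc r"] le(1) order_refl]
    by (rule window_Int)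
  moreover have "prob (?Y \<inter> X (Suc r)) \<le> Cd * prob ?Y * prob (X (Suc r))"
    by (rule prob_window_Int_le[OF w win sep])
  moreover have "Cd * prob ?Y * prob (X (Suc r)) \<le> Cd * (Cd * p) ^ Suc r * p"
    using Suc Cd p p0 by (intro mult_mono) auto
  ultimately show ?case unfolding eq by (simp add: mult_ac)
qed

section \<open>Stationarity and measurability\<close>

lemma seq_shift_measurable: "seq_shift k \<in> \<mu> \<rightarrow>\<^sub>M \<mu>"
proof -
  have "continuous_on UNIV (seq_shift k)"
    unfolding seq_shift_def by (intro continuous_on_coordinatewise_then_product continuous_on_product_coordinates)
  then have "seq_shift k \<in> borel \<rightarrow>\<^sub>M borel" by (rule borel_measurable_continuous_onI)
  then have "seq_shift k \<in> restrict_space borel \<Omega> \<rightarrow>\<^sub>M restrict_space borel \<Omega>"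
    using shift_\<Omega> by (intro measurable_restrict_space3) auto
  then show ?thesis by (simp add: measurable_cong_sets[OF sets_\<mu> sets_\<mu>])
qed

lemma prob_shift:
  assumes U: "U \<in> events"
  shows "{\<omega>\<in>\<Omega>. seq_shift k \<omega> \<in> U} \<in> events" "prob {\<omega>\<in>\<Omega>. seq_shift k \<omega> \<in> U} = prob U"
proof -
  have vim: "{\<omega>\<in>\<Omega>. seq_shift k \<omega> \<in> U} = seq_shift k -` U \<inter> space \<mu>" for k U
    by (auto simp: space_\<mu>)
  have sets: "{\<omega>\<in>\<Omega>. seq_shift k \<omega> \<in> U} \<in> events" if "U \<in> events" for k U
    unfolding vim using seq_shift_measurable that by (rule measurable_sets)
  show "{\<omega>\<in>\<Omega>. seq_shift k \<omega> \<in> U} \<in> events" using U by (rule sets)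
  have one: "prob {\<omega>\<in>\<Omega>. seq_shift 1 \<omega> \<in> U} = prob U" if "U \<in> events" for U
    using measure_distr[OF seq_shift_measurable that, of 1] invariant by (simp add: vim)
  have nat: "prob {\<omega>\<in>\<Omega>. seq_shift (int n) \<omega> \<in> U} = prob U" if "U \<in> events" for n U
  proof (induction n)
    case 0
    have "{\<omega>\<in>\<Omega>. seq_shift (int 0) \<omega> \<in> U} = U"
      using sets.sets_into_space[OF that] by (auto simp: seq_shift_def space_\<mu>)
    then show ?case by simp
  next
    case (Suc n)
    have "{\<omega>\<in>\<Omega>. seq_shift (int (Suc n)) \<omega> \<in> U} = {\<omega>\<in>\<Omega>. seq_shift 1 \<omega> \<in> {\<omega>\<in>\<Omega>. seq_shift (int n) \<omega> \<in> U}}"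
      using shift_\<Omega> by (auto simp: add.commute)
    then show ?case using Suc one[OF sets[OF that, of "int n"]] by simp
  qed
  show "prob {\<omega>\<in>\<Omega>. seq_shift k \<omega> \<in> U} = prob U"
  proof (cases k rule: int_cases2)
    case (nonneg n)
    then show ?thesis using nat[OF U] by simp
  next
    case (nonpos n)
    \<comment> \<open>For a backward shift, the preimage under the forward shift of the set in
      question is \<open>U\<close> itself, so the forward case applies to that set.\<close>
    have "{\<omega>\<in>\<Omega>. seq_shift (int n) \<omega> \<in> {\<omega>\<in>\<Omega>. seq_shift k \<omega> \<in> U}} = U"
      using shift_\<Omega> sets.sets_into_space[OF U] nonpos by (auto simp: seq_shift_def space_\<mu>)
    then show ?thesis using nat[OF sets[OF U, of k], of n] by simp
  qed
qed

lemma borel_measurable_of_local: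
  fixes h :: "(int \<Rightarrow> nat) \<Rightarrow> real"
  assumes "\<And>e. 0 < e \<Longrightarrow> \<exists>a b. \<forall>\<omega>\<in>\<Omega>. \<forall>\<omega>'\<in>\<Omega>. agree a b \<omega> \<omega>' \<longrightarrow> \<bar>h \<omega> - h \<omega>'\<bar> < e"
  shows "h \<in> borel_measurable \<mu>"
proof -
  have "continuous_on \<Omega> h"
    unfolding continuous_on_def
  proof (intro ballI tendstoI)
    fix \<omega> and e :: real assume \<omega>: "\<omega> \<in> \<Omega>" and "0 < e"
    then obtain a b where ab: "\<And>\<omega> \<omega>'. \<omega> \<in> \<Omega> \<Longrightarrow> \<omega>' \<in> \<Omega> \<Longrightarrow> agree a b \<omega> \<omega>' \<Longrightarrow> \<bar>h \<omega> - h \<omega>'\<bar> < e"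
      using assms by meson
    show "\<forall>\<^sub>F \<omega>' in at \<omega> within \<Omega>. dist (h \<omega>') (h \<omega>) < e"
      unfolding eventually_at_topological
      using open_agree[of a b \<omega>] ab[OF \<omega>]
      by (intro exI[of _ "{\<omega>'. agree a b \<omega> \<omega>'}"]) (auto simp: agree_def dist_real_def abs_minus_commute)
  qed
  then have "h \<in> borel_measurable (restrict_space borel \<Omega>)"
    by (rule borel_measurable_continuous_on_restrict)
  then show ?thesis by (simp add: measurable_cong_sets[OF sets_\<mu> refl])
qed

end

section \<open>Exceptional events\<close>

definition pot :: "((int \<Rightarrow> nat) \<Rightarrow> real) \<Rightarrow> (int \<Rightarrow> nat) \<Rightarrow> int \<Rightarrow> real" where
  "pot f \<omega> = (\<lambda>n. f (seq_shift n \<omega>))"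

text \<open>Hoelder continuity in the form used below: letters within distance \<open>N\<close>
  determine \<open>f\<close> up to an error exponential in \<open>N\<close>.\<close>

locale local_potential = sft_measure +
  fixes f :: "(int \<Rightarrow> nat) \<Rightarrow> real" and K \<alpha> S\<^sub>0 :: real
  assumes f_local: "\<And>\<omega> \<omega>' N. \<omega> \<in> \<Omega> \<Longrightarrow> \<omega>' \<in> \<Omega> \<Longrightarrow> agree (- int N) (int N) \<omega> \<omega>' \<Longrightarrow>
      \<bar>f \<omega> - f \<omega>'\<bar> \<le> K * exp (- \<alpha> * real N)"
    and f_bounded: "\<omega> \<in> \<Omega> \<Longrightarrow> \<bar>f \<omega>\<bar> \<le> S\<^sub>0"
    and K: "0 \<le> K" and \<alpha>: "0 < \<alpha>"
begin

lemma pot_bounded: "\<omega> \<in> \<Omega> \<Longrightarrow> \<bar>pot f \<omega> n\<bar> \<le> S\<^sub>0"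
  by (simp add: pot_def f_bounded shift_\<Omega>)

lemma pot_local:
  assumes "\<omega> \<in> \<Omega>" "\<omega>' \<in> \<Omega>" "agree (n - int N) (n + int N) \<omega> \<omega>'"
  shows "\<bar>pot f \<omega> n - pot f \<omega>' n\<bar> \<le> K * exp (- \<alpha> * real N)"
proof -
  have "agree (- int N) (int N) (seq_shift n \<omega>) (seq_shift n \<omega>')"
    using assms(3) by (auto simp: agree_def seq_shift_def)
  from f_local[OF shift_\<Omega>[OF assms(1)] shift_\<Omega>[OF assms(2)] this] show ?thesis by (simp add: pot_def)
qed

lemma mnorm_tm_measurable:
  "(\<lambda>\<omega>. mnorm (tm (\<lambda>n. E - pot f \<omega> n) 0 n)) \<in> borel_measurable \<mu>"
proof (rule borel_measurable_of_local)
  fix e :: real assume e: "0 < e"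
  let ?S = "\<bar>E\<bar> + S\<^sub>0"
  let ?c = "real n * (?S + 2) ^ n * K"
  have "((\<lambda>N. ?c * exp (- \<alpha> * real N)) \<longlongrightarrow> ?c * 0) sequentially"
    by (intro tendsto_mult tendsto_const) (use \<alpha> in real_asymp)
  then have "\<forall>\<^sub>F N in sequentially. ?c * exp (- \<alpha> * real N) < e"
    using e by (intro order_tendstoD) auto
  then obtain N where N: "?c * exp (- \<alpha> * real N) < e"
    by (auto simp: eventually_sequentially)
  have "\<bar>mnorm (tm (\<lambda>n. E - pot f \<omega> n) 0 n) - mnorm (tm (\<lambda>n. E - pot f \<omega>' n) 0 n)\<bar> < e"
    if \<omega>: "\<omega> \<in> \<Omega>" "\<omega>' \<in> \<Omega>" and ag: "agree (- int N) (int (n + N)) \<omega> \<omega>'" for \<omega> \<omega>'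
  proof -
    let ?x = "tm (\<lambda>n. E - pot f \<omega> n) 0 n" and ?y = "tm (\<lambda>n. E - pot f \<omega>' n) 0 n"
    have "mnorm (?x - ?y) \<le> real n * (?S + 2) ^ n * (K * exp (- \<alpha> * real N))"
    proof (rule mnorm_tm_diff_le)
      show "\<bar>E - pot f \<omega> j\<bar> \<le> ?S" "\<bar>E - pot f \<omega>' j\<bar> \<le> ?S" for j
        using pot_bounded[OF \<omega>(1), of j] pot_bounded[OF \<omega>(2), of j] by linarith+
      fix j :: int assume "0 \<le> j" "j < 0 + int n"
      then have "agree (j - int N) (j + int N) \<omega> \<omega>'" using agree_mono[OF ag] by simp
      from pot_local[OF \<omega> this] show "\<bar>E - pot f \<omega> j - (E - pot f \<omega>' j)\<bar> \<le> K * exp (- \<alpha> * real N)" by linarith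
    qed (use K in simp)
    also have "\<dots> < e" using N by (simp add: mult.assoc)
    finally show ?thesis
      using mnorm_diff_le[of ?x ?y] mnorm_diff_le[of ?y ?x] mnorm_minus_commute[of ?x ?y] by linarith
  qed
  then show "\<exists>a b. \<forall>\<omega>\<in>\<Omega>. \<forall>\<omega>'\<in>\<Omega>. agree a b \<omega> \<omega>' \<longrightarrow>
      \<bar>mnorm (tm (\<lambda>n. E - pot f \<omega> n) 0 n) - mnorm (tm (\<lambda>n. E - pot f \<omega>' n) 0 n)\<bar> < e"
    by blast
qed

definition Bad :: "real \<Rightarrow> int \<Rightarrow> nat \<Rightarrow> real \<Rightarrow> (int \<Rightarrow> nat) set" where
  "Bad E b k \<gamma> = {\<omega>\<in>\<Omega>. \<not> good_block (\<lambda>n. E - pot f \<omega> n) b k \<gamma>}"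

text \<open>\<open>Bad\<close> may depend on all letters, so the bound is stated for events
  contained in it. A block is good unless one of three norms, those of its two halves and of the
  whole, deviates from its typical size; by stationarity each deviation is as rare as at the
  origin.\<close>

lemma prob_Bad_le:
  assumes dev: "\<And>n. 1 \<le> n \<Longrightarrow> prob {\<omega>\<in>\<Omega>. \<epsilon> < \<bar>log_norm_avg f E n \<omega> - L\<bar>} \<le> C * exp (- c * real n)"
    and "0 \<le> C" "0 < c" "\<gamma> \<le> L - 3 * \<epsilon>" and k: "1 \<le> k" and X: "X \<in> events" "X \<subseteq> Bad E b k \<gamma>"
  shows "prob X \<le> 3 * C * exp (- c * real k)"
proof -
  define U where "U = (\<lambda>n. {\<omega>\<in>\<Omega>. \<epsilon> < \<bar>log_norm_avg f E n \<omega> - L\<bar>})"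
  have cocycle: "cocycle f E n (seq_shift a \<omega>) = tm (\<lambda>n. E - pot f \<omega> n) a n" for n a \<omega>
    using cocycle_eq_tm[of f E n a \<omega>] by (simp add: pot_def)
  have U: "U n \<in> events" for n
  proof -
    have eq: "log_norm_avg f E n \<omega> = 1 / real n * ln (mnorm (tm (\<lambda>n. E - pot f \<omega> n) 0 n))" for \<omega>
      using cocycle[of n 0 \<omega>] by (simp add: log_norm_avg_def seq_shift_def)
    have [measurable]: "(\<lambda>\<omega>. log_norm_avg f E n \<omega>) \<in> borel_measurable \<mu>"
      unfolding eq using mnorm_tm_measurable[of E n] by measurable
    have "{\<omega>\<in>space \<mu>. \<epsilon> < \<bar>log_norm_avg f E n \<omega> - L\<bar>} \<in> events" by measurable
    then show ?thesis by (simp add: U_def space_\<mu>)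
  qed
  define W where "W = (\<lambda>a n. {\<omega>\<in>\<Omega>. seq_shift a \<omega> \<in> U n})"
  have W: "W a n \<in> events" "prob (W a n) \<le> C * exp (- c * real n)" if "1 \<le> n" for a n
    using prob_shift[OF U[of n], of a] dev[OF that] by (simp_all add: W_def U_def)
  have sub: "X \<subseteq> W (b - int k) k \<union> W b k \<union> W (b - int k) (2 * k)"
  proof
    fix \<omega> assume "\<omega> \<in> X"
    then have \<omega>: "\<omega> \<in> \<Omega>" and bad: "\<not> good_block (\<lambda>n. E - pot f \<omega> n) b k \<gamma>" using X(2) by (auto simp: Bad_def)
    let ?t = "\<lambda>a n. mnorm (tm (\<lambda>n. E - pot f \<omega> n) a n)"
    have good: "real n * (L - \<epsilon>) \<le> ln (?t a n) \<and> ln (?t a n) \<le> real n * (L + \<epsilon>)"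
      if n: "1 \<le> n" and nW: "\<omega> \<notin> W a n" for a n
    proof -
      have "\<bar>log_norm_avg f E n (seq_shift a \<omega>) - L\<bar> \<le> \<epsilon>"
        using nW \<omega> shift_\<Omega> by (auto simp: W_def U_def not_less)
      then have "\<bar>ln (?t a n) / real n - L\<bar> \<le> \<epsilon>" by (simp add: log_norm_avg_def cocycle)
      then have "L - \<epsilon> \<le> ln (?t a n) / real n" "ln (?t a n) / real n \<le> L + \<epsilon>" by linarith+
      then show ?thesis using n by (simp add: field_simps)
    qed
    have pos: "0 < ?t a n" for a n using mnorm_tm_ge_1[of "\<lambda>n. E - pot f \<omega> n" a n] by linarith
    show "\<omega> \<in> W (b - int k) k \<union> W b k \<union> W (b - int k) (2 * k)"
    proof (rule ccontr)
      assume "\<not> ?thesis"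
      then have nW: "\<omega> \<notin> W (b - int k) k" "\<omega> \<notin> W b k" "\<omega> \<notin> W (b - int k) (2 * k)" by auto
      have g3: "real (2 * k) * (L - \<epsilon>) \<le> ln (?t (b - int k) (2 * k))"
        using good[OF _ nW(3)] k by simp
      have *: "?t a k \<le> exp (- \<gamma> * real k) * ?t (b - int k) (2 * k)" if "\<omega> \<notin> W a k" for a
      proof -
        have "ln (?t a k) \<le> real k * (L + \<epsilon>)" using good[OF k that] by blast
        \<comment> \<open>The upper bound for a half contributes one \<epsilon> and the lower bound
          at double length two.\<close>
        also have "\<dots> = real (2 * k) * (L - \<epsilon>) - real k * (L - 3 * \<epsilon>)" by (simp add: algebra_simps)
        also have "\<dots> \<le> ln (?t (b - int k) (2 * k)) - real k * \<gamma>"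
          using g3 mult_left_mono[OF \<open>\<gamma> \<le> L - 3 * \<epsilon>\<close>, of "real k"] by linarith
        finally have "exp (ln (?t a k)) \<le> exp (- \<gamma> * real k + ln (?t (b - int k) (2 * k)))"
          by (simp add: mult.commute)
        then show ?thesis using pos by (simp add: exp_diff exp_minus field_simps)
      qed
      have "good_block (\<lambda>n. E - pot f \<omega> n) b k \<gamma>"
        unfolding good_block_def using *[OF nW(1)] *[OF nW(2)] by blast
      with bad show False ..
    qed
  qed
  have k2: "1 \<le> 2 * k" using k by simp
  have "prob X \<le> prob (W (b - int k) k \<union> W b k \<union> W (b - int k) (2 * k))"
    using sub W(1)[OF k] W(1)[OF k2] by (intro finite_measure_mono) auto
  also have "\<dots> \<le> prob (W (b - int k) k) + prob (W b k) + prob (W (b - int k) (2 * k))"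
    by (intro order_trans[OF measure_Un_le add_right_mono[OF measure_Un_le]] sets.Un W k k2)
  also have "\<dots> \<le> C * exp (- c * real k) + C * exp (- c * real k) + C * exp (- c * real (2 * k))"
    by (intro add_mono W k k2)
  also have "C * exp (- c * real (2 * k)) \<le> C * exp (- c * real k)"
    using \<open>0 \<le> C\<close> \<open>0 < c\<close> by (intro mult_left_mono) auto
  finally show ?thesis by simp
qed

end

text \<open>The constants: \<open>5 g\<close> is the contraction rate supplied by large deviations, \<open>D k\<close> is the
  scale of the blocks which pin down the energy near the origin, and \<open>q\<close> is the relative size of the
  collar outside of which the potential is changed.\<close>

locale elimination = local_potential +
  fixes I :: "real set" and B g C c :: real and D r q :: nat
  assumes I_bounded: "E \<in> I \<Longrightarrow> \<bar>E\<bar> \<le> B" and B: "0 \<le> B" and g: "0 < g" and C: "0 \<le> C" and c: "0 < c"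
    and prob_Bad: "\<And>E b k X. E \<in> I \<Longrightarrow> 1 \<le> k \<Longrightarrow> X \<in> events \<Longrightarrow> X \<subseteq> Bad E b k (5 * g) \<Longrightarrow>
      prob X \<le> C * exp (- c * real k)"
    and D: "2 * ln (B + S\<^sub>0 + 2) + 5 * g + 2 \<le> g * real D"
    and r: "2 * ln (B + S\<^sub>0 + 2) + 5 * g + 2 \<le> c * real (Suc r)"
    and q: "g * real D + 1 \<le> \<alpha> * real q"
begin

text \<open>The precision exponent of \<open>good_block_perturb\<close> at rate
  \<open>5 * g\<close>. In terms of it the assumptions on \<open>D\<close> and \<open>r\<close> read
  \<open>A + 1 \<le> g * D\<close> and \<open>A + 1 \<le> c * (r + 1)\<close>.\<close>

definition A :: real where "A = 2 * ln (B + S\<^sub>0 + 2) + 5 * g + 1"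

lemma energy_bounded: "\<omega> \<in> \<Omega> \<Longrightarrow> E \<in> I \<Longrightarrow> \<bar>E - pot f \<omega> j\<bar> \<le> B + S\<^sub>0"
  using I_bounded[of E] pot_bounded[of \<omega> j] by linarith

text \<open>A finite-window event between two bad events: it contains \<open>Bad\<close> at rate
  \<open>4 * g\<close> and, at large scales and for energies of \<open>I\<close>, lies in
  \<open>Bad\<close> at rate \<open>5 * g\<close>. Of the half-width, \<open>k\<close> covers the
  block and \<open>q * k\<close> is the collar that fixes the potential at its edge.\<close>

definition Res :: "real \<Rightarrow> int \<Rightarrow> nat \<Rightarrow> (int \<Rightarrow> nat) set" where
  "Res E b k = saturate (b - int ((1 + q) * k)) (b + int ((1 + q) * k)) (Bad E b k (4 * g))"

text \<open>The condition with 3 pays for one loss of \<open>g\<close> in the rate; the condition on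
  \<open>K\<close> absorbs the Hoelder constant into one unit of exponent.\<close>

definition large :: "nat \<Rightarrow> bool" where
  "large k \<longleftrightarrow> 1 \<le> k \<and> 3 \<le> exp (g * real k) \<and> K \<le> exp (real k)"

lemma window_Res: "window (b - int ((1 + q) * k)) (b + int ((1 + q) * k)) (Res E b k)"
  unfolding Res_def by (rule window_saturate) simp

lemma pot_close:
  assumes "large k" "\<omega> \<in> \<Omega>" "\<omega>' \<in> \<Omega>" "agree (j - int (q * k)) (j + int (q * k)) \<omega> \<omega>'"
  shows "\<bar>pot f \<omega> j - pot f \<omega>' j\<bar> \<le> exp (- (g * real D) * real k)"
proof -
  have "\<bar>pot f \<omega> j - pot f \<omega>' j\<bar> \<le> K * exp (- \<alpha> * real (q * k))"
    by (rule pot_local[OF assms(2-4)])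
  also have "\<dots> \<le> exp (real k) * exp (- \<alpha> * real (q * k))"
    using assms(1) by (intro mult_right_mono) (auto simp: large_def)
  also have "\<dots> = exp ((1 - \<alpha> * real q) * real k)" by (simp add: algebra_simps flip: exp_add)
  also have "\<dots> \<le> exp (- (g * real D) * real k)"
    using q unfolding exp_le_cancel_iff by (intro mult_right_mono) auto
  finally show ?thesis .
qed

lemma A_le: "A + 1 \<le> g * real D"
  using D by (simp add: A_def)

text \<open>Letters outside the window move the potential on the block by at most
  \<open>exp (- g * D * k)\<close>, which is finer than the precision \<open>exp (- A * k)\<close>
  that preserves goodness.\<close>

lemma Res_subset_Bad:
  assumes k: "large k" and E: "E \<in> I"
  shows "Res E b k \<subseteq> Bad E b k (5 * g)"
proof
  fix \<omega> assume "\<omega> \<in> Res E b k"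
  then obtain \<omega>' where \<omega>: "\<omega> \<in> \<Omega>" "\<omega>' \<in> \<Omega>" and bad: "\<not> good_block (\<lambda>n. E - pot f \<omega>' n) b k (4 * g)"
    and ag: "agree (b - int ((1 + q) * k)) (b + int ((1 + q) * k)) \<omega>' \<omega>"
    by (auto simp: Res_def saturate_def Bad_def)
  have "\<not> good_block (\<lambda>n. E - pot f \<omega> n) b k (5 * g)"
  proof
    assume "good_block (\<lambda>n. E - pot f \<omega> n) b k (5 * g)"
    then have "good_block (\<lambda>n. E - pot f \<omega>' n) b k (4 * g)"
    proof (rule good_block_perturb)
      show "\<bar>E - pot f \<omega> j\<bar> \<le> B + S\<^sub>0" "\<bar>E - pot f \<omega>' j\<bar> \<le> B + S\<^sub>0" for j
        using energy_bounded \<omega> E by blast+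
      show "2 * ln (B + S\<^sub>0 + 2) + 5 * g + 1 \<le> A" by (simp add: A_def)
      show "3 \<le> exp ((5 * g - 4 * g) * real k)" using k by (simp add: large_def)
      fix j assume "b - int k \<le> j" "j \<le> b + int k"
      then have "agree (j - int (q * k)) (j + int (q * k)) \<omega>' \<omega>"
        by (intro agree_mono[OF ag]) (auto simp: algebra_simps)
      from pot_close[OF k \<omega>(2,1) this]
      have "\<bar>pot f \<omega>' j - pot f \<omega> j\<bar> \<le> exp (- (g * real D) * real k)" .
      also have "\<dots> \<le> exp (- A * real k)" using A_le unfolding exp_le_cancel_iff by (intro mult_right_mono) auto
      finally show "\<bar>E - pot f \<omega> j - (E - pot f \<omega>' j)\<bar> \<le> exp (- A * real k)" by linarith
    qed (use g in simp)
    with bad show False ..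
  qed
  then show "\<omega> \<in> Bad E b k (5 * g)" using \<omega> by (simp add: Bad_def)
qed

lemma prob_Res:
  assumes "large k" "E \<in> I"
  shows "prob (Res E b k) \<le> C * exp (- c * real k)"
  using assms by (intro prob_Bad[OF _ _ window_sets[OF window_Res] Res_subset_Bad]) (auto simp: large_def)

lemma good_of_not_Res:
  assumes k: "large k" and \<omega>: "\<omega> \<in> \<Omega>" "\<omega> \<notin> Res E' b k" and E: "E \<in> I" "E' \<in> I"
    and close: "\<bar>E - E'\<bar> \<le> exp (- A * real k)"
  shows "good_block (\<lambda>n. E - pot f \<omega> n) b k (3 * g)"
proof -
  have "\<omega> \<notin> Bad E' b k (4 * g)"
    using \<omega> by (auto simp: Res_def saturate_def agree_def)
  then have "good_block (\<lambda>n. E' - pot f \<omega> n) b k (4 * g)" using \<omega> by (simp add: Bad_def)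
  then show ?thesis
  proof (rule good_block_perturb)
    show "\<bar>E' - pot f \<omega> j\<bar> \<le> B + S\<^sub>0" "\<bar>E - pot f \<omega> j\<bar> \<le> B + S\<^sub>0" for j
      using energy_bounded \<omega> E by blast+
    show "2 * ln (B + S\<^sub>0 + 2) + 4 * g + 1 \<le> A" using g by (simp add: A_def)
    show "3 \<le> exp ((4 * g - 3 * g) * real k)" using k by (simp add: large_def)
    show "\<bar>E' - pot f \<omega> j - (E - pot f \<omega> j)\<bar> \<le> exp (- A * real k)" for j using close by linarith
  qed (use g in simp)
qed

end

section \<open>Elimination of double resonances\<close>

context elimination
begin

lemma A_nonneg: "0 \<le> A"
proof -
  obtain \<omega> where "\<omega> \<in> \<Omega>" using not_empty space_\<mu> by auto
  from f_bounded[OF this] have "0 \<le> S\<^sub>0" by linarith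
  then have "0 \<le> ln (B + S\<^sub>0 + 2)" using B by simp
  then show ?thesis using g by (simp add: A_def)
qed

lemma D_pos: "1 \<le> D"
proof (rule ccontr)
  assume "\<not> 1 \<le> D"
  then have "D = 0" by simp
  then show False using A_le A_nonneg by simp
qed

lemma energy_net:
  "\<exists>F\<subseteq>I. finite F \<and> real (card F) \<le> (2 * B + 2) * exp (A * real n) \<and>
     (\<forall>E\<in>I. \<exists>E'\<in>F. \<bar>E - E'\<bar> \<le> exp (- A * real n))"
proof -
  let ?s = "exp (- A * real n)"
  have "\<exists>F\<subseteq>I. finite F \<and> card F \<le> nat \<lfloor>2 * B / ?s + 2\<rfloor> \<and> (\<forall>E\<in>I. \<exists>E'\<in>F. \<bar>E - E'\<bar> \<le> ?s)"
  proof (rule finite_net_of_separated_bound)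
    fix F assume "finite F" "F \<subseteq> I" "\<And>x y. x \<in> F \<Longrightarrow> y \<in> F \<Longrightarrow> x \<noteq> y \<Longrightarrow> ?s \<le> \<bar>x - y\<bar>"
    then have "real (card F) \<le> 2 * B / ?s + 2"
      using I_bounded B by (intro card_separated_interval) auto
    then show "card F \<le> nat \<lfloor>2 * B / ?s + 2\<rfloor>" by (rule le_nat_floor)
  qed simp
  then obtain F where F: "F \<subseteq> I" "finite F" "card F \<le> nat \<lfloor>2 * B / ?s + 2\<rfloor>"
    "\<forall>E\<in>I. \<exists>E'\<in>F. \<bar>E - E'\<bar> \<le> ?s" by blast
  have "real (card F) \<le> real (nat \<lfloor>2 * B / ?s + 2\<rfloor>)" using F(3) by simp
  also have "\<dots> \<le> 2 * B / ?s + 2" using B by (intro of_nat_floor) simp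
  also have "2 * B / ?s = 2 * B * exp (A * real n)" by (simp add: exp_minus divide_inverse)
  also have "2 * B * exp (A * real n) + 2 \<le> (2 * B + 2) * exp (A * real n)"
    using A_nonneg by (simp add: distrib_right)
  finally show ?thesis using F by blast
qed

text \<open>The balance, with \<open>n = D * k\<close>: a net has about \<open>exp (A * n)\<close>
  energies, and for each of them all \<open>r + 1\<close> blocks fail with probability of order
  \<open>exp (- c * (r + 1) * n)\<close>. The starting site \<open>a\<close> is free so that both
  sides of the origin can be served.\<close>

lemma exists_good_block:
  assumes large: "large (D * k)" and w: "2 * (1 + q) < w"
  shows "\<exists>F\<in>events. prob F \<le> (2 * B + 2) * (Cd * C) ^ Suc r * exp (- real k) \<and>
    (\<forall>\<omega>\<in>\<Omega> - F. \<forall>E\<in>I. \<exists>j\<le>r. good_block (\<lambda>n. E - pot f \<omega> n) (a + int (j * (w * (D * k)))) (D * k) (3 * g))"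
proof -
  define n where "n = D * k"
  have n: "1 \<le> n" using large by (simp add: large_def n_def)
  obtain Net where Net: "Net \<subseteq> I" "finite Net" "real (card Net) \<le> (2 * B + 2) * exp (A * real n)"
    "\<And>E. E \<in> I \<Longrightarrow> \<exists>E'\<in>Net. \<bar>E - E'\<bar> \<le> exp (- A * real n)"
    using energy_net by metis
  define b where "b = (\<lambda>j. a + int (j * (w * n)))"
  define Y where "Y = (\<lambda>E. \<Inter>j\<le>r. Res E (b j) n)"
  have Y: "Y E \<in> events \<and> prob (Y E) \<le> (Cd * (C * exp (- c * real n))) ^ Suc r" if E: "E \<in> I" for E
  proof -
    have "window (b 0 - int ((1 + q) * n)) (b r + int ((1 + q) * n)) (Y E) \<and>
        prob (Y E) \<le> (Cd * (C * exp (- c * real n))) ^ Suc r"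
      unfolding Y_def
    proof (rule prob_INT_windows_le)
      show "window (b j - int ((1 + q) * n)) (b j + int ((1 + q) * n)) (Res E (b j) n)" for j
        by (rule window_Res)
      show "b j + int ((1 + q) * n) < b (Suc j) - int ((1 + q) * n)" for j
      proof -
        \<comment> \<open>Centres are \<open>w * n\<close> apart and each window has half-width
          \<open>(1 + q) * n\<close>.\<close>
        have "2 * (1 + q) * n < w * n" using w n by (intro mult_less_mono1) auto
        then have "2 * int ((1 + q) * n) < int (w * n)" by (metis mult.assoc of_nat_less_iff of_nat_mult of_nat_numeral)
        then show ?thesis by (simp add: b_def algebra_simps)
      qed
      show "prob (Res E (b j) n) \<le> C * exp (- c * real n)" for j
        using large E by (intro prob_Res) (simp_all add: n_def)
    qed
    then show ?thesis using window_sets by blast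
  qed
  define F where "F = (\<Union>E\<in>Net. Y E)"
  have "F \<in> events" unfolding F_def using Net Y by (intro sets.finite_UN) auto
  moreover have "prob F \<le> (2 * B + 2) * (Cd * C) ^ Suc r * exp (- real k)"
  proof -
    have "prob F \<le> (\<Sum>E\<in>Net. prob (Y E))"
      unfolding F_def using Net Y by (intro finite_measure_subadditive_finite) auto
    also have "\<dots> \<le> (\<Sum>E\<in>Net. (Cd * (C * exp (- c * real n))) ^ Suc r)"
      using Net Y by (intro sum_mono) auto
    also have "\<dots> = real (card Net) * ((Cd * C) ^ Suc r * exp (- c * real n) ^ Suc r)"
      by (simp only: sum_constant power_mult_distrib mult.assoc)
    also have "exp (- c * real n) ^ Suc r = exp (- (c * real (Suc r)) * real n)"
      unfolding exp_of_nat_mult[symmetric] by (simp only: mult_ac mult_minus_left mult_minus_right)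
    also have "\<dots> \<le> exp (- (A + 1) * real n)"
      using r unfolding exp_le_cancel_iff by (intro mult_right_mono) (auto simp: A_def)
    also have "real (card Net) * ((Cd * C) ^ Suc r * exp (- (A + 1) * real n))
        \<le> (2 * B + 2) * exp (A * real n) * ((Cd * C) ^ Suc r * exp (- (A + 1) * real n))"
      using Cd C by (intro mult_right_mono Net) auto
    also have "\<dots> = (2 * B + 2) * (Cd * C) ^ Suc r * (exp (A * real n) * exp (- (A + 1) * real n))" by simp
    also have "exp (A * real n) * exp (- (A + 1) * real n) = exp (- real n)"
      by (simp add: algebra_simps flip: exp_add)
    also have "\<dots> \<le> exp (- real k)"
      using D_pos mult_right_mono[of 1 "real D" "real k"] by (simp add: n_def)
    finally show ?thesis using B C Cd by (simp add: mult_left_mono)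
  qed
  moreover have "\<exists>j\<le>r. good_block (\<lambda>n. E - pot f \<omega> n) (b j) n (3 * g)" if \<omega>: "\<omega> \<in> \<Omega> - F" and E: "E \<in> I" for \<omega> E
  proof -
    obtain E' where E': "E' \<in> Net" "\<bar>E - E'\<bar> \<le> exp (- A * real n)" using Net(4)[OF E] by blast
    then have "\<omega> \<notin> Y E'" using \<omega> by (auto simp: F_def)
    then obtain j where j: "j \<le> r" "\<omega> \<notin> Res E' (b j) n" by (auto simp: Y_def)
    have "good_block (\<lambda>n. E - pot f \<omega> n) (b j) n (3 * g)"
      using large j(2) \<omega> E E' Net(1) by (intro good_of_not_Res[of n \<omega> E']) (auto simp: n_def)
    with j(1) show ?thesis by blast
  qed
  ultimately show ?thesis unfolding b_def n_def by blast
qed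

text \<open>The approximate eigenvalues near the origin are random, so they are frozen by
  conditioning on the word in \<open>[-W, W]\<close>: one representative \<open>rep\<close> per
  cylinder supplies the net. Distant blocks are decided by letters outside \<open>[-W, W]\<close>,
  so for each energy of this net resonance there has conditional probability at most
  \<open>Cd * C * exp (- c * k)\<close>.\<close>

lemma no_double_resonance:
  assumes large: "large k" and poly: "8 * (2 * real (R * k) + 1) * (4 * real (R * k) + 3) \<le> exp (real k)"
  shows "\<exists>F\<in>events. prob F \<le> real (4 * (R * k) + 2) * real (2 * k ^ 3 + 1) * (Cd * C * exp (- c * real k)) \<and>
    (\<forall>\<omega>\<in>\<Omega> - F. \<forall>E\<in>I. approx_sol (\<lambda>n. E - pot f \<omega> n) (int (R * k)) (exp (- g * real (D * k))) \<longrightarrow>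
      (\<forall>b. int ((R + 2 * q + 3) * k) \<le> \<bar>b\<bar> \<and> \<bar>b\<bar> \<le> int (k ^ 3) \<longrightarrow> good_block (\<lambda>n. E - pot f \<omega> n) b k (3 * g)))"
proof -
  have k: "1 \<le> k" using large by (simp add: large_def)
  define \<eta> where "\<eta> = exp (- g * real (D * k))"
  define W where "W = int ((R + q) * k)"
  define rep where "rep = (\<lambda>js. SOME \<omega>. \<omega> \<in> \<Omega> \<and> word (- W) W \<omega> = js)"
  let ?J = "word (- W) W ` \<Omega>"
  have rep: "rep js \<in> \<Omega>" "word (- W) W (rep js) = js" if "js \<in> ?J" for js
    using that someI_ex[of "\<lambda>\<omega>. \<omega> \<in> \<Omega> \<and> word (- W) W \<omega> = js"] unfolding rep_def by blast+
  have net: "\<exists>F\<subseteq>I. finite F \<and> card F \<le> 4 * (R * k) + 2 \<and>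
      (\<forall>E\<in>I. approx_sol (\<lambda>n. E - pot f (rep js) n) (int (R * k)) (2 * \<eta>) \<longrightarrow> (\<exists>E'\<in>F. \<bar>E - E'\<bar> \<le> exp (- A * real k)))"
    for js
  proof -
    \<comment> \<open>The residual \<open>2 * \<eta>\<close> leaves room for replacing a point by
      its representative. The polynomial factor uses up the spare unit in
      \<open>A + 1 \<le> g * D\<close>.\<close>
    have "4 * (2 * \<eta>) * (2 * real (R * k) + 1) * (4 * real (R * k) + 3)
        = (8 * (2 * real (R * k) + 1) * (4 * real (R * k) + 3)) * \<eta>" by simp
    also have "\<dots> \<le> exp (real k) * \<eta>" using poly by (intro mult_right_mono) (auto simp: \<eta>_def)
    also have "\<dots> = exp ((1 - g * real D) * real k)" by (simp add: \<eta>_def algebra_simps flip: exp_add)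
    also have "\<dots> \<le> exp (- A * real k)" using A_le unfolding exp_le_cancel_iff by (intro mult_right_mono) auto
    finally have "4 * (2 * \<eta>) * (2 * real (R * k) + 1) * (4 * real (R * k) + 3) \<le> exp (- A * real k)" .
    from approx_sol_net[OF _ this, of I "pot f (rep js)"] show ?thesis by auto
  qed
  obtain Net where Net: "\<And>js. Net js \<subseteq> I" "\<And>js. finite (Net js)" "\<And>js. card (Net js) \<le> 4 * (R * k) + 2"
    "\<And>js E. E \<in> I \<Longrightarrow> approx_sol (\<lambda>n. E - pot f (rep js) n) (int (R * k)) (2 * \<eta>) \<Longrightarrow>
       \<exists>E'\<in>Net js. \<bar>E - E'\<bar> \<le> exp (- A * real k)"
    using net by metis
  define Rng where "Rng = {b :: int. int ((R + 2 * q + 3) * k) \<le> \<bar>b\<bar> \<and> \<bar>b\<bar> \<le> int (k ^ 3)}"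
  have Rng_sub: "Rng \<subseteq> {- int (k ^ 3)..int (k ^ 3)}" by (auto simp: Rng_def)
  have finR: "finite Rng" by (rule finite_subset[OF Rng_sub]) simp
  have "card Rng \<le> card {- int (k ^ 3)..int (k ^ 3)}" by (rule card_mono[OF _ Rng_sub]) simp
  then have cardR: "card Rng \<le> 2 * k ^ 3 + 1" by (simp del: of_nat_power)
  define cyl where "cyl = cylinder \<Omega> (- W)"
  define Z where "Z = (\<lambda>js p. cyl js \<inter> Res (fst p) (snd p) k)"
  define F where "F = (\<Union>js\<in>?J. \<Union>p\<in>Net js \<times> Rng. Z js p)"
  have W0: "- W \<le> W" by (simp add: W_def)
  have cylw: "window (- W) W (cyl js)" "cyl js \<in> events" if js: "js \<in> ?J" for js
  proof -
    from js obtain \<omega> where \<omega>: "\<omega> \<in> \<Omega>" "js = word (- W) W \<omega>" by blast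
    then show "window (- W) W (cyl js)"
      using W0 by (simp add: cyl_def window_def cylinder_word) (meson agree_trans)
    then show "cyl js \<in> events" by (rule window_sets)
  qed
  have Z: "Z js p \<in> events \<and> prob (Z js p) \<le> Cd * C * exp (- c * real k) * prob (cyl js)"
    if js: "js \<in> ?J" and p: "p \<in> Net js \<times> Rng" for js p
  proof -
    let ?X = "Res (fst p) (snd p) k" and ?u = "int ((1 + q) * k)"
    have Xw: "window (snd p - ?u) (snd p + ?u) ?X" by (rule window_Res)
    have Xp: "prob ?X \<le> C * exp (- c * real k)" using p Net(1)[of js] large by (intro prob_Res) auto
    have b: "int ((R + 2 * q + 3) * k) \<le> \<bar>snd p\<bar>" using p by (auto simp: Rng_def)
    \<comment> \<open>The left side is \<open>(R + 2 * q + 1) * k\<close>, so windows around sites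
      of \<open>Rng\<close> are disjoint from \<open>[-W, W]\<close>.\<close>
    have sep: "W + ?u < int ((R + 2 * q + 3) * k)"
      using k by (simp add: W_def algebra_simps flip: of_nat_mult of_nat_add)
    have "prob (Z js p) \<le> Cd * prob (cyl js) * prob ?X"
    proof (cases "0 \<le> snd p")
      case True
      then show ?thesis unfolding Z_def
        using b sep by (intro prob_window_Int_le[OF cylw(1)[OF js] Xw]) linarith
    next
      case False
      have "prob (?X \<inter> cyl js) \<le> Cd * prob ?X * prob (cyl js)"
        using b sep False by (intro prob_window_Int_le[OF Xw cylw(1)[OF js]]) linarith
      then show ?thesis unfolding Z_def by (simp add: Int_commute mult_ac)
    qed
    also have "\<dots> \<le> Cd * prob (cyl js) * (C * exp (- c * real k))"
      using Cd by (intro mult_left_mono Xp) auto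
    finally show ?thesis
      using cylw(2)[OF js] window_sets[OF Xw] by (auto simp: Z_def mult_ac)
  qed
  have finJ: "finite ?J" by (rule finite_words) simp
  have Zev: "(\<Union>p\<in>Net js \<times> Rng. Z js p) \<in> events" if "js \<in> ?J" for js
    using Z[OF that] Net(2) finR by (intro sets.finite_UN) auto
  have Fev: "F \<in> events" unfolding F_def by (rule sets.finite_UN[OF finJ Zev])
  define e where "e = Cd * C * exp (- c * real k)"
  have e: "0 \<le> e" using Cd C by (simp add: e_def)
  have "prob F \<le> (\<Sum>js\<in>?J. prob (\<Union>p\<in>Net js \<times> Rng. Z js p))"
    unfolding F_def using finJ Zev by (intro finite_measure_subadditive_finite) auto
  also have "\<dots> \<le> (\<Sum>js\<in>?J. real (4 * (R * k) + 2) * real (2 * k ^ 3 + 1) * e * prob (cyl js))"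
  proof (rule sum_mono)
    fix js assume js: "js \<in> ?J"
    have "prob (\<Union>p\<in>Net js \<times> Rng. Z js p) \<le> (\<Sum>p\<in>Net js \<times> Rng. prob (Z js p))"
      using Z[OF js] Net(2) finR by (intro finite_measure_subadditive_finite) auto
    also have "\<dots> \<le> (\<Sum>p\<in>Net js \<times> Rng. e * prob (cyl js))"
      using Z[OF js] by (intro sum_mono) (simp add: e_def)
    also have "\<dots> = (real (card (Net js)) * real (card Rng)) * (e * prob (cyl js))"
      by (simp add: card_cartesian_product)
    also have "\<dots> \<le> (real (4 * (R * k) + 2) * real (2 * k ^ 3 + 1)) * (e * prob (cyl js))"
      using Net(3)[of js] cardR e by (intro mult_right_mono mult_mono) (simp_all only: of_nat_le_iff of_nat_0_le_iff mult_nonneg_nonneg measure_nonneg)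
    finally show "prob (\<Union>p\<in>Net js \<times> Rng. Z js p) \<le> real (4 * (R * k) + 2) * real (2 * k ^ 3 + 1) * e * prob (cyl js)"
      by (simp only: mult.assoc)
  qed
  also have "\<dots> = real (4 * (R * k) + 2) * real (2 * k ^ 3 + 1) * e * (\<Sum>js\<in>?J. prob (cyl js))"
    by (simp only: sum_distrib_left)
  \<comment> \<open>The cylinders partition \<Omega>, so the number of words does not enter the
    bound.\<close>
  also have "(\<Sum>js\<in>?J. prob (cyl js)) = 1"
  proof -
    have "window (- W) W \<Omega>" using W0 by (simp add: window_def)
    from prob_window[OF this] show ?thesis using prob_space space_\<mu> by (simp add: cyl_def)
  qed
  finally have Fp: "prob F \<le> real (4 * (R * k) + 2) * real (2 * k ^ 3 + 1) * e" by simp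
  have "good_block (\<lambda>n. E - pot f \<omega> n) b k (3 * g)"
    if \<omega>: "\<omega> \<in> \<Omega> - F" and E: "E \<in> I" and as: "approx_sol (\<lambda>n. E - pot f \<omega> n) (int (R * k)) \<eta>" and b: "b \<in> Rng"
    for \<omega> E b
  proof -
    let ?js = "word (- W) W \<omega>"
    have js: "?js \<in> ?J" using \<omega> by blast
    have ag: "agree (- W) W \<omega> (rep ?js)" using rep(2)[OF js] by (simp flip: word_eq_iff)
    have "approx_sol (\<lambda>n. E - pot f (rep ?js) n) (int (R * k)) (\<eta> + \<eta>)"
    proof (rule approx_sol_perturb[OF as])
      fix n assume "\<bar>n\<bar> \<le> int (R * k)"
      then have "agree (n - int (q * k)) (n + int (q * k)) \<omega> (rep ?js)"
        by (intro agree_mono[OF ag]) (auto simp: W_def distrib_right)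
      from pot_close[OF large _ rep(1)[OF js] this] \<omega>
      have "\<bar>pot f \<omega> n - pot f (rep ?js) n\<bar> \<le> \<eta>" by (simp add: \<eta>_def mult.assoc)
      then show "\<bar>E - pot f \<omega> n - (E - pot f (rep ?js) n)\<bar> \<le> \<eta>" by linarith
    qed (simp add: \<eta>_def)
    then have "approx_sol (\<lambda>n. E - pot f (rep ?js) n) (int (R * k)) (2 * \<eta>)" by simp
    from Net(4)[OF E this] obtain E' where E': "E' \<in> Net ?js" "\<bar>E - E'\<bar> \<le> exp (- A * real k)" by blast
    have "\<omega> \<in> cyl ?js" using \<omega> by (simp add: cyl_def cylinder_word agree_def)
    moreover have "\<omega> \<notin> Z ?js (E', b)" using \<omega> E'(1) b js unfolding F_def by blast
    ultimately have "\<omega> \<notin> Res E' b k" by (simp add: Z_def)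
    then show ?thesis using \<omega> E E' Net(1)[of ?js] by (intro good_of_not_Res[OF large, of \<omega> E']) auto
  qed
  with Fev Fp show ?thesis unfolding Rng_def \<eta>_def e_def by blast
qed

lemma AE_decaying_solutions: "AE \<omega> in \<mu>. decaying_solutions (pot f \<omega>) I"
proof -
  define w where "w = 2 * (1 + q) + 1"
  \<comment> \<open>\<open>R * k\<close> is the length of \<open>r + 1\<close> steps of size
    \<open>w * D * k\<close>, so both families of centres lie within \<open>R * k\<close> of the
    origin.\<close>
  define R where "R = Suc r * w * D"
  have w: "2 * (1 + q) < w" by (simp add: w_def)
  have R1: "1 \<le> R" using D_pos by (simp add: R_def w_def)
  have ev: "\<forall>\<^sub>F k in sequentially. large k \<and> large (D * k) \<and>
      8 * (2 * real (R * k) + 1) * (4 * real (R * k) + 3) \<le> exp (real k)"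
  proof -
    have "\<forall>\<^sub>F k in sequentially. 1 \<le> k" by (rule eventually_ge_at_top)
    moreover have "\<forall>\<^sub>F k in sequentially. 3 \<le> exp (g * real k)" using g by real_asymp
    moreover have "\<forall>\<^sub>F k in sequentially. K \<le> exp (real k)" by real_asymp
    ultimately have l: "\<forall>\<^sub>F k in sequentially. large k" unfolding large_def by eventually_elim simp
    have "filterlim (\<lambda>k. D * k) sequentially sequentially"
      using D_pos by (intro mult_nat_left_at_top) simp
    from eventually_compose_filterlim[OF l this] have lD: "\<forall>\<^sub>F k in sequentially. large (D * k)" .
    have "\<forall>\<^sub>F k in sequentially. 8 * (2 * (R' * real k) + 1) * (4 * (R' * real k) + 3) \<le> exp (real k)" if "0 < R'" for R'
      using that by real_asymp
    from this[of "real R"] R1 have "\<forall>\<^sub>F k in sequentially. 8 * (2 * real (R * k) + 1) * (4 * real (R * k) + 3) \<le> exp (real k)"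
      by simp
    with l lD show ?thesis by eventually_elim blast
  qed
  then obtain k0 where k0: "\<And>k. k0 \<le> k \<Longrightarrow> large k \<and> large (D * k) \<and>
      8 * (2 * real (R * k) + 1) * (4 * real (R * k) + 3) \<le> exp (real k)"
    unfolding eventually_sequentially by blast
  define C1 where "C1 = (2 * B + 2) * (Cd * C) ^ Suc r"
  define p where "p = (\<lambda>k. real (4 * (R * k) + 2) * real (2 * k ^ 3 + 1) * (Cd * C * exp (- c * real k)))"
  let ?right = "\<lambda>k \<omega>. \<forall>E\<in>I. \<exists>t. 1 \<le> t \<and> t \<le> int (R * k) \<and> good_block (\<lambda>n. E - pot f \<omega> n) t (D * k) (3 * g)"
  let ?left = "\<lambda>k \<omega>. \<forall>E\<in>I. \<exists>s. - int (R * k) \<le> s \<and> s \<le> - 1 \<and> good_block (\<lambda>n. E - pot f \<omega> n) s (D * k) (3 * g)"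
  let ?res = "\<lambda>k \<omega>. \<forall>E\<in>I. approx_sol (\<lambda>n. E - pot f \<omega> n) (int (R * k)) (exp (- g * real (D * k))) \<longrightarrow>
      (\<forall>b. int ((R + 2 * q + 3) * k) \<le> \<bar>b\<bar> \<and> \<bar>b\<bar> \<le> int (k ^ 3) \<longrightarrow> good_block (\<lambda>n. E - pot f \<omega> n) b k (3 * g))"
  \<comment> \<open>The failure sets involve all energies of \<open>I\<close> at once, so the
    estimate is made for an event that covers them.\<close>
  define Q where "Q = (\<lambda>k F. F \<in> events \<and> prob F \<le> 2 * C1 * exp (- real k) + p k \<and>
      (\<forall>\<omega>\<in>\<Omega> - F. ?right k \<omega> \<and> ?left k \<omega> \<and> ?res k \<omega>))"
  have "\<exists>F. Q k F" if k: "k0 \<le> k" for k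
  proof -
    define u where "u = w * (D * k)"
    have u: "1 \<le> u"
    proof -
      have "1 \<le> D * k" using k0[OF k] by (simp add: large_def)
      then show ?thesis using mult_le_mono[of 1 w 1 "D * k"] by (simp add: u_def w_def)
    qed
    have Ru: "R * k = Suc r * u" by (simp add: R_def u_def algebra_simps)
    have lk: "large (D * k)" using k0[OF k] by blast
    obtain F1 where F1: "F1 \<in> events" "prob F1 \<le> C1 * exp (- real k)"
      "\<And>\<omega> E. \<omega> \<in> \<Omega> - F1 \<Longrightarrow> E \<in> I \<Longrightarrow> \<exists>j\<le>r. good_block (\<lambda>n. E - pot f \<omega> n) (int u + int (j * u)) (D * k) (3 * g)"
      using exists_good_block[OF lk w, of "int u"] unfolding C1_def u_def by blast
    \<comment> \<open>Starting at \<open>- (r + 1) * u\<close>, the last centre is at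
      \<open>- u\<close>, still to the left of the origin.\<close>
    obtain F2 where F2: "F2 \<in> events" "prob F2 \<le> C1 * exp (- real k)"
      "\<And>\<omega> E. \<omega> \<in> \<Omega> - F2 \<Longrightarrow> E \<in> I \<Longrightarrow> \<exists>j\<le>r. good_block (\<lambda>n. E - pot f \<omega> n) (- int (Suc r * u) + int (j * u)) (D * k) (3 * g)"
      using exists_good_block[OF lk w, of "- int (Suc r * u)"] unfolding C1_def u_def by blast
    obtain F3 where F3: "F3 \<in> events" "prob F3 \<le> p k" "\<And>\<omega>. \<omega> \<in> \<Omega> - F3 \<Longrightarrow> ?res k \<omega>"
      using no_double_resonance[of k R] k0[OF k] unfolding p_def by blast
    have ju: "j * u \<le> r * u" if "j \<le> r" for j using that by (rule mult_le_mono1)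
    let ?F = "F1 \<union> F2 \<union> F3"
    have "?F \<in> events" using F1 F2 F3 by auto
    moreover have "prob ?F \<le> 2 * C1 * exp (- real k) + p k"
    proof -
      have "prob ?F \<le> prob F1 + prob F2 + prob F3"
        by (intro order_trans[OF measure_Un_le add_right_mono[OF measure_Un_le]] sets.Un F1 F2 F3)
      then show ?thesis using F1 F2 F3 by linarith
    qed
    moreover have "?right k \<omega> \<and> ?left k \<omega> \<and> ?res k \<omega>" if \<omega>: "\<omega> \<in> \<Omega> - ?F" for \<omega>
    proof (intro conjI ballI)
      fix E assume E: "E \<in> I"
      obtain j where j: "j \<le> r" "good_block (\<lambda>n. E - pot f \<omega> n) (int u + int (j * u)) (D * k) (3 * g)"
        using F1(3)[of \<omega> E] \<omega> E by blast
      have "1 \<le> int u + int (j * u) \<and> int u + int (j * u) \<le> int (R * k)"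
        using u ju[OF j(1)] unfolding Ru mult_Suc of_nat_add by linarith
      then show "\<exists>t. 1 \<le> t \<and> t \<le> int (R * k) \<and> good_block (\<lambda>n. E - pot f \<omega> n) t (D * k) (3 * g)"
        using j(2) by blast
    next
      fix E assume E: "E \<in> I"
      obtain j where j: "j \<le> r" "good_block (\<lambda>n. E - pot f \<omega> n) (- int (Suc r * u) + int (j * u)) (D * k) (3 * g)"
        using F2(3)[of \<omega> E] \<omega> E by blast
      have "- int (R * k) \<le> - int (Suc r * u) + int (j * u) \<and> - int (Suc r * u) + int (j * u) \<le> - 1"
        using u ju[OF j(1)] unfolding Ru mult_Suc of_nat_add by linarith
      then show "\<exists>s. - int (R * k) \<le> s \<and> s \<le> - 1 \<and> good_block (\<lambda>n. E - pot f \<omega> n) s (D * k) (3 * g)"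
        using j(2) by blast
    qed (use F3(3)[of \<omega>] \<omega> in blast)
    ultimately have "Q k ?F" unfolding Q_def by blast
    then show ?thesis ..
  qed
  then obtain F where Q: "\<And>k. k0 \<le> k \<Longrightarrow> Q k (F k)" by metis
  have F: "F k \<in> events" "prob (F k) \<le> 2 * C1 * exp (- real k) + p k"
    "\<And>\<omega>. \<omega> \<in> \<Omega> - F k \<Longrightarrow> ?right k \<omega> \<and> ?left k \<omega> \<and> ?res k \<omega>" if "k0 \<le> k" for k
    using Q[OF that] unfolding Q_def by (blast+)
  define G where "G = (\<lambda>k. if k0 \<le> k then F k else {})"
  have "summable (\<lambda>k. exp (- real k))"
  proof (rule summable_comparison_test_bigo)
    show "summable (\<lambda>k. norm (1 / real k ^ 2))" using inverse_power_summable[of 2, where 'a = real] by (simp add: divide_inverse)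
    show "(\<lambda>k. exp (- real k)) \<in> O(\<lambda>k. 1 / real k ^ 2)" by real_asymp
  qed
  moreover have "summable (\<lambda>k. (4 * (R' * real k) + 2) * (2 * real k ^ 3 + 1) * exp (- c * real k))" if "0 < R'" for R'
  proof (rule summable_comparison_test_bigo)
    show "summable (\<lambda>k. norm (1 / real k ^ 2))" using inverse_power_summable[of 2, where 'a = real] by (simp add: divide_inverse)
    show "(\<lambda>k. (4 * (R' * real k) + 2) * (2 * real k ^ 3 + 1) * exp (- c * real k)) \<in> O(\<lambda>k. 1 / real k ^ 2)"
      using that c by real_asymp
  qed
  ultimately have "summable (\<lambda>k. 2 * C1 * exp (- real k) + (Cd * C) * ((4 * (real R * real k) + 2) * (2 * real k ^ 3 + 1) * exp (- c * real k)))"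
    using R1 by (intro summable_add summable_mult) auto
  then have sum: "summable (\<lambda>k. 2 * C1 * exp (- real k) + p k)" by (simp add: p_def mult_ac add_ac)
  have Gev: "G k \<in> events" for k using F(1) by (simp add: G_def)
  have "summable (\<lambda>k. prob (G k))"
  proof (rule summable_comparison_test_ev[OF _ sum])
    show "\<forall>\<^sub>F k in sequentially. norm (prob (G k)) \<le> 2 * C1 * exp (- real k) + p k"
      using eventually_ge_at_top[of k0] by eventually_elim (simp add: G_def F(2))
  qed
  then have "AE \<omega> in \<mu>. \<forall>\<^sub>F k in sequentially. \<omega> \<in> space \<mu> - G k"
    by (intro borel_cantelli_AE1 Gev) (auto simp: emeasure_eq_measure)
  then show ?thesis
  proof (rule AE_mp, intro AE_I2 impI)
    fix \<omega> assume \<omega>: "\<omega> \<in> space \<mu>" and ev: "\<forall>\<^sub>F k in sequentially. \<omega> \<in> space \<mu> - G k"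
    have ev': "\<forall>\<^sub>F k in sequentially. ?right k \<omega> \<and> ?left k \<omega> \<and> ?res k \<omega>"
      using ev eventually_ge_at_top[of k0]
    proof eventually_elim
      case (elim k)
      then show ?case by (intro F(3)) (auto simp: G_def space_\<mu>)
    qed
    show "decaying_solutions (pot f \<omega>) I"
      unfolding decaying_solutions_def
    proof (intro ballI allI impI)
      fix E u C' assume E: "E \<in> I" and u: "sol (\<lambda>n. E - pot f \<omega> n) u"
        and gr: "\<forall>n. \<bar>u n\<bar> \<le> C' * (1 + \<bar>real_of_int n\<bar>)\<^sup>2"
      show "\<exists>C>0. \<exists>\<gamma>>0. \<forall>n. \<bar>u n\<bar> \<le> C * exp (- \<gamma> * real_of_int \<bar>n\<bar>)"
      proof (rule exp_decay_of_good_blocks[OF u _ g D_pos, of C' R "R + 2 * q + 3"])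
        show "\<bar>u n\<bar> \<le> C' * (1 + \<bar>real_of_int n\<bar>)\<^sup>2" for n using gr by blast
        show "\<forall>\<^sub>F k in sequentially.
          (\<exists>t. 1 \<le> t \<and> t \<le> int (R * k) \<and> good_block (\<lambda>n. E - pot f \<omega> n) t (D * k) (3 * g)) \<and>
          (\<exists>s. - int (R * k) \<le> s \<and> s \<le> - 1 \<and> good_block (\<lambda>n. E - pot f \<omega> n) s (D * k) (3 * g))"
          using ev' by eventually_elim (use E in blast)
        show "\<forall>\<^sub>F k in sequentially. approx_sol (\<lambda>n. E - pot f \<omega> n) (int (R * k)) (exp (- g * real (D * k))) \<longrightarrow>
          (\<forall>b. int ((R + 2 * q + 3) * k) \<le> \<bar>b\<bar> \<and> \<bar>b\<bar> \<le> int (k ^ 3) \<longrightarrow> good_block (\<lambda>n. E - pot f \<omega> n) b k (3 * g))"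
          using ev' by eventually_elim (use E in blast)
      qed
    qed
  qed
qed

end

section \<open>Localization\<close>

lemma hoelder_on_local:
  assumes "0 < \<alpha>" "hoelder_on \<alpha> \<Omega> f"
  shows "\<exists>K\<ge>0. \<forall>\<omega>\<in>\<Omega>. \<forall>\<omega>'\<in>\<Omega>. \<forall>N. agree (- int N) (int N) \<omega> \<omega>' \<longrightarrow>
    \<bar>f \<omega> - f \<omega>'\<bar> \<le> K * exp (- \<alpha> * real N)"
    and "\<exists>S. \<forall>\<omega>\<in>\<Omega>. \<bar>f \<omega>\<bar> \<le> S"
proof -
  obtain K where K: "\<And>\<omega> \<omega>'. \<omega> \<in> \<Omega> \<Longrightarrow> \<omega>' \<in> \<Omega> \<Longrightarrow> \<bar>f \<omega> - f \<omega>'\<bar> \<le> K * sft_dist \<omega> \<omega>' powr \<alpha>"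
    using assms(2) unfolding hoelder_on_def by blast
  have dist0: "0 \<le> sft_dist \<omega> \<omega>'" for \<omega> \<omega>' by (simp add: sft_dist_def)
  have le: "\<bar>f \<omega> - f \<omega>'\<bar> \<le> \<bar>K\<bar> * exp (- \<alpha> * real N)"
    if \<omega>: "\<omega> \<in> \<Omega>" "\<omega>' \<in> \<Omega>" and ag: "\<And>n. \<bar>n\<bar> < int N \<Longrightarrow> \<omega> n = \<omega>' n" for \<omega> \<omega>' N
  proof -
    have "sft_dist \<omega> \<omega>' \<le> exp (- real N)" using ag by (simp add: sft_dist_le_iff)
    then have "sft_dist \<omega> \<omega>' powr \<alpha> \<le> exp (- real N) powr \<alpha>"
      using dist0 \<open>0 < \<alpha>\<close> by (intro powr_mono2) auto
    also have "\<dots> = exp (- \<alpha> * real N)" by (simp add: powr_def mult.commute)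
    finally have *: "sft_dist \<omega> \<omega>' powr \<alpha> \<le> exp (- \<alpha> * real N)" .
    have "\<bar>f \<omega> - f \<omega>'\<bar> \<le> K * sft_dist \<omega> \<omega>' powr \<alpha>" by (rule K[OF \<omega>])
    also have "\<dots> \<le> \<bar>K\<bar> * sft_dist \<omega> \<omega>' powr \<alpha>" by (intro mult_right_mono) auto
    also have "\<dots> \<le> \<bar>K\<bar> * exp (- \<alpha> * real N)" using * by (intro mult_left_mono) auto
    finally show ?thesis .
  qed
  then show "\<exists>K\<ge>0. \<forall>\<omega>\<in>\<Omega>. \<forall>\<omega>'\<in>\<Omega>. \<forall>N. agree (- int N) (int N) \<omega> \<omega>' \<longrightarrow>
    \<bar>f \<omega> - f \<omega>'\<bar> \<le> K * exp (- \<alpha> * real N)"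
    by (intro exI[of _ "\<bar>K\<bar>"]) (auto simp: agree_def abs_less_iff)
  show "\<exists>S. \<forall>\<omega>\<in>\<Omega>. \<bar>f \<omega>\<bar> \<le> S"
  proof (cases "\<Omega> = {}")
    case False
    then obtain \<omega>0 where \<omega>0: "\<omega>0 \<in> \<Omega>" by blast
    \<comment> \<open>For \<open>N = 0\<close> the agreement condition is empty, so \<open>f\<close>
      oscillates by at most \<open>\<bar>K\<bar>\<close>.\<close>
    have "\<bar>f \<omega>\<bar> \<le> \<bar>f \<omega>0\<bar> + \<bar>K\<bar>" if "\<omega> \<in> \<Omega>" for \<omega>
      using le[OF that \<omega>0, of 0] by simp
    then show ?thesis by blast
  qed simp
qed

lemma PLE_positive_bound:
  assumes "PLE M f I"
  shows "\<exists>L>0. \<forall>E\<in>I. L \<le> lyapunov_exponent M f E"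
proof -
  obtain L :: ereal where "0 < L" "L < (INF E\<in>I. ereal (lyapunov_exponent M f E))"
    using assms dense unfolding PLE_def by blast
  then obtain x where x: "0 < x" "ereal x < (INF E\<in>I. ereal (lyapunov_exponent M f E))"
    by (cases L) auto
  have "x \<le> lyapunov_exponent M f E" if "E \<in> I" for E
    using less_le_trans[OF x(2) INF_lower[OF that]] by simp
  with x(1) show ?thesis by blast
qed

lemma sft_measureI:
  assumes "subshift_of_finite_type l \<Omega>" "prob_space \<mu>" "sets \<mu> = sets (restrict_space borel \<Omega>)"
    "ergodic_wrt \<mu> (seq_shift 1)" "bounded_distortion \<Omega> \<mu>"
  shows "\<exists>Cd. sft_measure \<mu> l \<Omega> Cd"
proof -
  interpret prob_space \<mu> by fact
  obtain T where T: "\<Omega> = {\<omega>. \<forall>n. \<omega> n \<in> {1..l} \<and> T (\<omega> n) (\<omega> (n + 1)) = (1::nat)}"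
    using assms(1) unfolding subshift_of_finite_type_def by blast
  obtain C where C: "1 \<le> C" and dist: "\<forall>n m js is. js \<noteq> [] \<and> is \<noteq> [] \<and> m \<ge> n + int (length js) \<and>
        cylinder \<Omega> n js \<inter> cylinder \<Omega> m is \<noteq> {} \<longrightarrow>
        (let q = prob (cylinder \<Omega> n js \<inter> cylinder \<Omega> m is) / (prob (cylinder \<Omega> n js) * prob (cylinder \<Omega> m is))
         in 1 / C \<le> q \<and> q \<le> C)"
    using assms(5) unfolding bounded_distortion_def by (elim exE conjE) (rule that)
  have "sft_measure \<mu> l \<Omega> C"
  proof
    show "\<omega> n \<in> {1..l}" if "\<omega> \<in> \<Omega>" for \<omega> n using that by (simp add: T)
    show "sets \<mu> = sets (restrict_space borel \<Omega>)" by fact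
    show "seq_shift k \<omega> \<in> \<Omega>" if "\<omega> \<in> \<Omega>" for \<omega> k
    proof -
      have "\<omega> m \<in> {1..l} \<and> T (\<omega> m) (\<omega> (m + 1)) = 1" for m using that by (simp add: T)
      from this[of "n + k" for n] show ?thesis by (simp add: T seq_shift_def add_ac)
    qed
    show "distr \<mu> \<mu> (seq_shift 1) = \<mu>" using assms(4) by (simp add: ergodic_wrt_def)
    show "1 \<le> C" by fact
    fix js "is" :: "nat list" and n m :: int assume ne: "js \<noteq> []" "is \<noteq> []" "n + int (length js) \<le> m"
    show "prob (cylinder \<Omega> n js \<inter> cylinder \<Omega> m is) \<le> C * (prob (cylinder \<Omega> n js) * prob (cylinder \<Omega> m is))"
    proof (cases "cylinder \<Omega> n js \<inter> cylinder \<Omega> m is = {}")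
      case True
      then show ?thesis using C by simp
    next
      case False
      have b: "1 / C \<le> prob (cylinder \<Omega> n js \<inter> cylinder \<Omega> m is) / (prob (cylinder \<Omega> n js) * prob (cylinder \<Omega> m is))"
        "prob (cylinder \<Omega> n js \<inter> cylinder \<Omega> m is) / (prob (cylinder \<Omega> n js) * prob (cylinder \<Omega> m is)) \<le> C"
        using dist[rule_format, OF conjI[OF ne(1) conjI[OF ne(2) conjI[OF ne(3) False]]]] by (simp_all add: Let_def)
      \<comment> \<open>A quotient with zero denominator has the value 0, which the lower distortion
        bound \<open>1 / C\<close> excludes.\<close>
      have "prob (cylinder \<Omega> n js) * prob (cylinder \<Omega> m is) \<noteq> 0"
      proof
        assume z: "prob (cylinder \<Omega> n js) * prob (cylinder \<Omega> m is) = 0"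
        have "1 / C \<le> 0" using b(1) unfolding z by simp
        then show False using C by (simp add: divide_le_0_iff)
      qed
      then have "0 < prob (cylinder \<Omega> n js) * prob (cylinder \<Omega> m is)"
        by (simp add: less_le)
      then show ?thesis using b by (simp add: pos_divide_le_eq)
    qed
  qed
  then show ?thesis ..
qed

text \<open>The constants \<open>D\<close>, \<open>r\<close> and \<open>q\<close> are chosen in
  terms of the bound \<open>B\<close> on the energies, which is why a bounded part of
  \<open>I\<close> is treated.\<close>

lemma (in local_potential) AE_decaying_solutions_bounded:
  assumes PLE: "PLE \<mu> f I" and ULD: "ULD \<mu> f I" and J: "J \<subseteq> I" "\<And>E. E \<in> J \<Longrightarrow> \<bar>E\<bar> \<le> B" "0 \<le> B"
  shows "AE \<omega> in \<mu>. decaying_solutions (pot f \<omega>) J"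
proof -
  obtain L where L: "0 < L" "\<And>E. E \<in> I \<Longrightarrow> L \<le> lyapunov_exponent \<mu> f E"
    using PLE_positive_bound[OF PLE] by blast
  \<comment> \<open>Allowing deviations up to \<open>g\<close> costs \<open>3 * g\<close>, so the
    rate \<open>5 * g\<close> requires an exponent of at least \<open>8 * g\<close>.\<close>
  define g where "g = L / 8"
  have g: "0 < g" using L by (simp add: g_def)
  obtain C c where Cc: "0 < C" "0 < c" "\<And>E n. E \<in> I \<Longrightarrow> 1 \<le> n \<Longrightarrow>
      prob {\<omega>\<in>space \<mu>. g < \<bar>log_norm_avg f E n \<omega> - lyapunov_exponent \<mu> f E\<bar>} < C * exp (- c * real n)"
    using ULD g unfolding ULD_def by meson
  let ?A = "2 * ln (B + S\<^sub>0 + 2) + 5 * g + 2"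
  have arch: "\<exists>n. y \<le> x * real n" if "0 < x" for x y
    using reals_Archimedean3[OF that] by (metis less_imp_le mult.commute)
  obtain D where D: "?A \<le> g * real D" using arch[OF g] by blast
  obtain r where "?A \<le> c * real r" using arch[OF Cc(2)] by blast
  then have r: "?A \<le> c * real (Suc r)" using Cc(2) by (simp add: distrib_left)
  obtain q where q: "g * real D + 1 \<le> \<alpha> * real q" using arch[OF \<alpha>] by blast
  \<comment> \<open>The factor 3 collects the three deviation events of one block.\<close>
  interpret elimination \<mu> l \<Omega> Cd f K \<alpha> S\<^sub>0 J B g "3 * C" c D r q
  proof
    fix E b k X assume E: "E \<in> J" and k: "1 \<le> k" and X: "X \<in> events" "X \<subseteq> Bad E b k (5 * g)"
    show "prob X \<le> 3 * C * exp (- c * real k)"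
    proof (rule prob_Bad_le[OF _ _ Cc(2) _ k X])
      show "prob {\<omega> \<in> \<Omega>. g < \<bar>log_norm_avg f E n \<omega> - lyapunov_exponent \<mu> f E\<bar>} \<le> C * exp (- c * real n)"
        if "1 \<le> n" for n
        using Cc(3)[of E n] E J(1) that by (auto simp: space_\<mu>)
      show "5 * g \<le> lyapunov_exponent \<mu> f E - 3 * g" using L(2)[of E] E J(1) by (auto simp: g_def)
    qed (use Cc in simp)
  qed (use J g Cc D r q in auto)
  show ?thesis by (rule AE_decaying_solutions)
qed

theorem theorem2p12:
  fixes l :: nat and \<Omega> :: "(int \<Rightarrow> nat) set" and \<mu> :: "(int \<Rightarrow> nat) measure"
    and \<alpha> :: real and f :: "(int \<Rightarrow> nat) \<Rightarrow> real" and I :: "real set"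
  assumes "l \<ge> 2"
    and "subshift_of_finite_type l \<Omega>"
    and "prob_space \<mu>"
    and "sets \<mu> = sets (restrict_space borel \<Omega>)"
    and "ergodic_wrt \<mu> (seq_shift 1)"
    and "measure_support \<mu> = \<Omega>"
    and "bounded_distortion \<Omega> \<mu>"
    and "0 < \<alpha>" and "\<alpha> \<le> 1"
    and "hoelder_on \<alpha> \<Omega> f"
    and "I \<in> sets borel"
    and "PLE \<mu> f I"
    and "ULD \<mu> f I"
  shows "AE \<omega> in \<mu>.
           spectral_localization (schroedinger_operator (\<lambda>n. f (seq_shift n \<omega>))) I"
proof -
  obtain Cd where "sft_measure \<mu> l \<Omega> Cd" using sft_measureI assms by blast
  then interpret sft_measure \<mu> l \<Omega> Cd .
  obtain K where K: "0 \<le> K" "\<And>\<omega> \<omega>' N. \<omega> \<in> \<Omega> \<Longrightarrow> \<omega>' \<in> \<Omega> \<Longrightarrow> agree (- int N) (int N) \<omega> \<omega>' \<Longrightarrow>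
      \<bar>f \<omega> - f \<omega>'\<bar> \<le> K * exp (- \<alpha> * real N)"
    using hoelder_on_local(1)[OF assms(8,10)] by blast
  obtain S where S: "\<And>\<omega>. \<omega> \<in> \<Omega> \<Longrightarrow> \<bar>f \<omega>\<bar> \<le> S"
    using hoelder_on_local(2)[OF assms(8,10)] by blast
  interpret local_potential \<mu> l \<Omega> Cd f K \<alpha> S
    by unfold_locales (use K S assms(8) in auto)
  \<comment> \<open>The possibly unbounded \<open>I\<close> is exhausted by countably many bounded
    pieces. Decay concerns one energy at a time, and every energy lies in some piece.\<close>
  have "AE \<omega> in \<mu>. decaying_solutions (pot f \<omega>) (I \<inter> {- real B..real B})" for B :: nat
    by (rule AE_decaying_solutions_bounded[OF assms(12,13), where B = "real B"]) auto
  then have "AE \<omega> in \<mu>. \<forall>B::nat. decaying_solutions (pot f \<omega>) (I \<inter> {- real B..real B})"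
    by (simp add: AE_all_countable)
  then show ?thesis
  proof (rule AE_mp, intro AE_I2 impI)
    fix \<omega> assume \<omega>: "\<omega> \<in> space \<mu>" and dec: "\<forall>B::nat. decaying_solutions (pot f \<omega>) (I \<inter> {- real B..real B})"
    have "decaying_solutions (pot f \<omega>) I"
      unfolding decaying_solutions_def
    proof
      fix E assume "E \<in> I"
      moreover obtain B :: nat where "\<bar>E\<bar> \<le> real B" using real_arch_simple by blast
      ultimately have "E \<in> I \<inter> {- real B..real B}" by (auto simp: abs_le_iff)
      with dec show "\<forall>u C. sol (\<lambda>n. E - pot f \<omega> n) u \<longrightarrow>
          (\<forall>n. \<bar>u n\<bar> \<le> C * (1 + \<bar>real_of_int n\<bar>)\<^sup>2) \<longrightarrow>
          (\<exists>C>0. \<exists>\<gamma>>0. \<forall>n. \<bar>u n\<bar> \<le> C * exp (- \<gamma> * real_of_int \<bar>n\<bar>))"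
        unfolding decaying_solutions_def by blast
    qed
    then have "spectral_localization (schroedinger_operator (pot f \<omega>)) I"
      using pot_bounded \<omega> assms(11) by (intro spectral_localization_of_decaying_solutions[of _ S]) (auto simp: space_\<mu>)
    then show "spectral_localization (schroedinger_operator (\<lambda>n. f (seq_shift n \<omega>))) I"
      by (simp add: pot_def)
  qed
qed

end
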